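(* Let $A$ be a bialgebra and let $H$ be a Hopf algebra, both over a field $K$. The following assertions are equivalent: (a) $A$ is (can be given the structure of) an object in ${}_H^H\mathfrak{M}_H^H$ such that the counit $\varepsilon_A:A\to K$ is right $H$-linear and $A$ becomes an algebra in $({}_H^H\mathfrak{M}_H^H,\otimes_H,H)$ and a coalgebra in $({}^H\mathfrak{M}^H,\square_H,H)$. (b) There are an algebra $R$ in ${}_H^H\mathcal{YD}$ and maps $\varepsilon_R:R\to K$, $\delta:R\to R\otimes R$, $\omega:H\to R\otimes R$ such that $(R,\varepsilon_R,\delta,\omega)$ is a Yetter–Drinfeld quadruple and $A$ is isomorphic as a bialgebra to the bosonization $R\#_bH$ of this Yetter–Drinfeld quadruple. (c) There are a bialgebra map $\pi:A\to H$ and an $(H,H)$-bicolinear algebra map $\sigma:H\to A$ such that $\pi\sigma=\mathrm{Id}_H$ (where $A$ is an $(H,H)$-bicomodule via $\pi$). In this case, one can choose $R=A^{co(H)}$, the space of right $H$-coinvariant elements of $A$ (the diagram of $A$).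
   Context: ${}_H^H\mathcal{YD}$: left $H$-modules (action ${}^hv$) and left $H$-comodules (coaction $\rho(v)=\sum v_{\langle-1\rangle}\otimes v_{\langle0\rangle}$) with $\rho({}^hv)=\sum h_{(1)}v_{\langle-1\rangle}S(h_{(3)})\otimes{}^{h_{(2)}}v_{\langle0\rangle}$; tensor product over $K$ with diagonal action and coaction; braiding $c(v\otimes w)=\sum{}^{v_{\langle-1\rangle}}w\otimes v_{\langle0\rangle}$. For an algebra $R$ in ${}_H^H\mathcal{YD}$, $R\otimes R$ is an algebra with $(r\otimes s)(t\otimes v)=\sum r({}^{s_{\langle-1\rangle}}t)\otimes s_{\langle0\rangle}v$, diagonal $H$-action and diagonal coaction $\rho_{R\otimes R}$. ${}_H^H\mathfrak{M}_H^H$ is the category of Hopf bimodules ($H$-bimodules and $H$-bicomodules with both coactions bimodule maps). For a Hopf bimodule $V$, $V^{co(H)}=\{v:\rho^r(v)=v\otimes1\}$ is in ${}_H^H\mathcal{YD}$ with action ${}^hv=\sum h_{(1)}vS(h_{(2)})$ and the restricted left coaction. A $K$-algebra $A$ that is a Hopf bimodule "becomes an algebra in $({}_H^H\mathfrak{M}_H^H,\otimes_H,H)$" if it is an $H$-bicomodule algebra and its multiplication factors through a morphism $A\otimes_HA\to A$ of Hopf bimodules. A $K$-coalgebra $C$ that is an $(H,H)$-bicomodule "becomes a coalgebra in $({}^H\mathfrak{M}^H,\square_H,H)$" if $\mathrm{Im}\,\Delta_C\subseteq C\square_HC$ and $\Delta_C:C\to C\square_HC$ is $(H,H)$-bicolinear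 (coactions $\rho^l\otimes C$, $C\otimes\rho^r$ on $C\square_HC$). Yetter–Drinfeld quadruple: an algebra $R$ in ${}_H^H\mathcal{YD}$ with linear maps $\varepsilon:R\to K$, $\delta:R\to R\otimes R$, $\delta(r)=\sum r^{(1)}\otimes r^{(2)}$, and $\omega:H\to R\otimes R$, $\omega(h)=\sum\omega^1(h)\otimes\omega^2(h)$, such that for all $r,s\in R$, $h,k\in H$: 1. $\varepsilon({}^hr)=\varepsilon(r)\varepsilon_H(h)$ and $\sum r_{\langle-1\rangle}\varepsilon(r_{\langle0\rangle})=\varepsilon(r)1_H$; 2. $\varepsilon(rs)=\varepsilon(r)\varepsilon(s)$, $\varepsilon(1_R)=1$; 3. $\rho_{R\otimes R}(\delta(r))=\sum r_{\langle-1\rangle}\otimes\delta(r_{\langle0\rangle})$; 4. $\rho_{R\otimes R}(\omega(h))=\sum h_{(1)}S(h_{(3)})\otimes\omega(h_{(2)})$; 5. $\delta(rs)=\delta(r)\delta(s)$, $\delta(1_R)=1_R\otimes1_R$; 6. $\omega(hk)=\sum\omega(h_{(1)})\,{}^{h_{(2)}}\omega(k)$, $\omega(1_H)=1_R\otimes1_R$; 7. $\sum\delta({}^{h_{(1)}}r)\omega(h_{(2)})=\sum\omega(h_{(1)})\,{}^{h_{(2)}}\delta(r)$; 8. $\sum r^{(1)}\otimes\delta(r^{(2)})=\sum\delta(r^{(1)})\omega(r^{(2)}_{\langle-1\rangle})\otimes r^{(2)}_{\langle0\rangle}$; 9. $\sum\omega^1(h_{(1)})\otimes\delta(\omega^2(h_{(1)}))\omega(h_{(2)})=\sum\delta(\omega^1(h_{(1)}))\,\omega\big(\omega^2(h_{(1)})_{\langle-1\rangle}h_{(2)}\big)\otimes\omega^2(h_{(1)})_{\langle0\rangle}$;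 10. $(\varepsilon\otimes R)\delta=(R\otimes\varepsilon)\delta=\mathrm{Id}_R$; 11. $(\varepsilon\otimes R)\omega=(R\otimes\varepsilon)\omega=\varepsilon_H(\cdot)1_R$. Its bosonization $R\#_bH$ is the bialgebra $R\otimes H$ with smash product $(r\#h)(s\#k)=\sum r({}^{h_{(1)}}s)\#h_{(2)}k$, unit $1_R\#1_H$, counit $\varepsilon(r)\varepsilon_H(h)$ and comultiplication $\Delta(r\#h)=\sum\widetilde\delta^1(r\#h_{(1)})\#\widetilde\delta^2(r\#h_{(1)})_{\langle-1\rangle}h_{(2)}\otimes\widetilde\delta^2(r\#h_{(1)})_{\langle0\rangle}\#h_{(3)}$, where $\widetilde\delta(r\#h)=\delta(r)\omega(h)=\sum\widetilde\delta^1(r\#h)\otimes\widetilde\delta^2(r\#h)$. *)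

theory Defs
  imports Main "HOL.Vector_Spaces"
begin

section \<open>Vector spaces and linear maps\<close>

text \<open>
  A space over the field \<open>'k\<close> is a subspace (the carrier) of an ambient \<open>'k\<close>-vector space
  living on the whole type \<open>'v\<close>. Carriers are needed because coinvariants form proper subspaces.
  All conditions on maps only refer to elements of carriers.
\<close>

record ('k, 'v) kspace =
  carrier :: "'v set"
  scale :: "'k \<Rightarrow> 'v \<Rightarrow> 'v"

definition vspace :: "('k::field, 'v::ab_group_add, 'x) kspace_scheme \<Rightarrow> bool" where
  "vspace V \<longleftrightarrow> vector_space (scale V) \<and> module.subspace (scale V) (carrier V)"

definition ground :: "('k::field, 'k) kspace" where
  "ground = \<lparr>carrier = UNIV, scale = (*)\<rparr>"

definition linear_on ::
  "('k::field, 'v::ab_group_add, 'x) kspace_scheme \<Rightarrow> ('k, 'w::ab_group_add, 'y) kspace_scheme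
    \<Rightarrow> ('v \<Rightarrow> 'w) \<Rightarrow> bool" where
  "linear_on V W f \<longleftrightarrow>
     (\<forall>v\<in>carrier V. f v \<in> carrier W) \<and>
     (\<forall>u\<in>carrier V. \<forall>v\<in>carrier V. f (u + v) = f u + f v) \<and>
     (\<forall>c. \<forall>v\<in>carrier V. f (scale V c v) = scale W c (f v))"

definition bilinear_on ::
  "('k::field, 'v::ab_group_add, 'x) kspace_scheme \<Rightarrow> ('k, 'w::ab_group_add, 'y) kspace_scheme
    \<Rightarrow> ('k, 'u::ab_group_add, 'z) kspace_scheme \<Rightarrow> ('v \<Rightarrow> 'w \<Rightarrow> 'u) \<Rightarrow> bool" where
  "bilinear_on V W U \<beta> \<longleftrightarrow>
     (\<forall>v\<in>carrier V. linear_on W U (\<lambda>w. \<beta> v w)) \<and> (\<forall>w\<in>carrier W. linear_on V U (\<lambda>v. \<beta> v w))"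


section \<open>Tensor products over the field\<close>

text \<open>
  \<open>V \<Otimes> W\<close> is realised inside the space of functionals on bilinear forms: the elementary tensor
  of \<open>v\<close> and \<open>w\<close> is the evaluation \<open>\<beta> \<mapsto> \<beta> v w\<close> (and \<open>0\<close> on functions \<open>\<beta>\<close> that are not bilinear
  forms), and \<open>V \<Otimes> W\<close> is the span of the elementary tensors. Over a field this construction has
  the universal property of the tensor product; this is proved in \<open>tensor_universal\<close> below.
  Elementary tensors do not depend on the carriers, so for subspaces \<open>V'\<close> of \<open>V\<close> and \<open>W'\<close> of \<open>W\<close>
  the space \<open>V' \<Otimes> W'\<close> is literally a subspace of \<open>V \<Otimes> W\<close>.
\<close>

typedef ('k, 'v, 'w) tensor = "UNIV :: (('v \<Rightarrow> 'w \<Rightarrow> 'k) \<Rightarrow> 'k) set"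
  morphisms eval_at Tensor by simp

setup_lifting type_definition_tensor

instantiation tensor :: (ab_group_add, type, type) ab_group_add
begin

lift_definition zero_tensor :: "('a, 'b, 'c) tensor" is "\<lambda>_. 0" .
lift_definition plus_tensor :: "('a, 'b, 'c) tensor \<Rightarrow> ('a, 'b, 'c) tensor \<Rightarrow> ('a, 'b, 'c) tensor"
  is "\<lambda>s t \<beta>. s \<beta> + t \<beta>" .
lift_definition minus_tensor :: "('a, 'b, 'c) tensor \<Rightarrow> ('a, 'b, 'c) tensor \<Rightarrow> ('a, 'b, 'c) tensor"
  is "\<lambda>s t \<beta>. s \<beta> - t \<beta>" .
lift_definition uminus_tensor :: "('a, 'b, 'c) tensor \<Rightarrow> ('a, 'b, 'c) tensor"
  is "\<lambda>t \<beta>. - t \<beta>" .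

instance by standard (transfer; simp add: fun_eq_iff algebra_simps)+

end

lift_definition tscale :: "'k::field \<Rightarrow> ('k, 'v, 'w) tensor \<Rightarrow> ('k, 'v, 'w) tensor"
  is "\<lambda>c t \<beta>. c * t \<beta>" .

definition bilinear_form ::
  "('k::field, 'v::ab_group_add, 'x) kspace_scheme \<Rightarrow> ('k, 'w::ab_group_add, 'y) kspace_scheme
    \<Rightarrow> ('v \<Rightarrow> 'w \<Rightarrow> 'k) \<Rightarrow> bool" where
  "bilinear_form V W \<beta> \<longleftrightarrow>
     (\<forall>v. Vector_Spaces.linear (scale W) (*) (\<lambda>w. \<beta> v w)) \<and>
     (\<forall>w. Vector_Spaces.linear (scale V) (*) (\<lambda>v. \<beta> v w))"

text \<open>The evaluation at \<open>(v, w)\<close> restricted to a class \<open>P\<close> of forms.\<close>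

definition elementary ::
  "(('v \<Rightarrow> 'w \<Rightarrow> 'k) \<Rightarrow> bool) \<Rightarrow> 'v \<Rightarrow> 'w \<Rightarrow> ('k::field, 'v, 'w) tensor" where
  "elementary P v w = Tensor (\<lambda>\<beta>. if P \<beta> then \<beta> v w else 0)"

text \<open>
  Sums in Sweedler style: if \<open>t\<close> is a sum of elementary tensors \<open>T v w\<close> then \<open>sweedler T V W t f\<close>
  is the corresponding sum of the \<open>f v w\<close>. For bilinear \<open>f\<close> (balanced, in the case of tensor
  products over an algebra) the result does not depend on the chosen decomposition of \<open>t\<close>.
\<close>

definition sweedler ::
  "('v \<Rightarrow> 'w \<Rightarrow> 't::ab_group_add) \<Rightarrow> ('k, 'v, 'x) kspace_scheme \<Rightarrow> ('k, 'w, 'y) kspace_scheme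
    \<Rightarrow> 't \<Rightarrow> ('v \<Rightarrow> 'w \<Rightarrow> 'u::ab_group_add) \<Rightarrow> 'u" where
  "sweedler T V W t f =
     (\<Sum>(v, w) \<leftarrow> (SOME ps. set ps \<subseteq> carrier V \<times> carrier W \<and> t = (\<Sum>(v, w)\<leftarrow>ps. T v w)). f v w)"

definition tens ::
  "('k::field, 'v::ab_group_add, 'x) kspace_scheme \<Rightarrow> ('k, 'w::ab_group_add, 'y) kspace_scheme
    \<Rightarrow> 'v \<Rightarrow> 'w \<Rightarrow> ('k, 'v, 'w) tensor" where
  "tens V W = elementary (bilinear_form V W)"

abbreviation tens_syntax (\<open>_ \<otimes>\<^bsub>_,_\<^esub> _\<close> [71, 0, 0, 71] 70) where
  "v \<otimes>\<^bsub>V,W\<^esub> w \<equiv> tens V W v w"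

definition tensor_space ::
  "('k::field, 'v::ab_group_add, 'x) kspace_scheme \<Rightarrow> ('k, 'w::ab_group_add, 'y) kspace_scheme
    \<Rightarrow> ('k, ('k, 'v, 'w) tensor) kspace" (infixr \<open>\<Otimes>\<close> 75) where
  "V \<Otimes> W =
     \<lparr>carrier = module.span tscale {v \<otimes>\<^bsub>V,W\<^esub> w | v w. v \<in> carrier V \<and> w \<in> carrier W},
      scale = tscale\<rparr>"

definition tsum ::
  "('k::field, 'v::ab_group_add, 'x) kspace_scheme \<Rightarrow> ('k, 'w::ab_group_add, 'y) kspace_scheme
    \<Rightarrow> ('k, 'v, 'w) tensor \<Rightarrow> ('v \<Rightarrow> 'w \<Rightarrow> 'u::ab_group_add) \<Rightarrow> 'u" where
  "tsum V W = sweedler (tens V W) V W"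

definition tensor_assoc ::
  "('k::field, 'u::ab_group_add, 'x) kspace_scheme \<Rightarrow> ('k, 'v::ab_group_add, 'y) kspace_scheme
    \<Rightarrow> ('k, 'w::ab_group_add, 'z) kspace_scheme
    \<Rightarrow> ('k, ('k, 'u, 'v) tensor, 'w) tensor \<Rightarrow> ('k, 'u, ('k, 'v, 'w) tensor) tensor" where
  "tensor_assoc U V W t =
     tsum (U \<Otimes> V) W t (\<lambda>s w. tsum U V s (\<lambda>u v. u \<otimes>\<^bsub>U, V \<Otimes> W\<^esub> (v \<otimes>\<^bsub>V,W\<^esub> w)))"


section \<open>Algebras, bialgebras, Hopf algebras\<close>

record ('k, 'v) algebra = "('k, 'v) kspace" +
  mult :: "'v \<Rightarrow> 'v \<Rightarrow> 'v" (infixl \<open>\<cdot>\<index>\<close> 76)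
  unit :: "'v" (\<open>\<one>\<index>\<close>)

definition is_algebra :: "('k::field, 'v::ab_group_add, 'x) algebra_scheme \<Rightarrow> bool" where
  "is_algebra A \<longleftrightarrow>
     vspace A \<and> bilinear_on A A A (mult A) \<and> \<one>\<^bsub>A\<^esub> \<in> carrier A \<and>
     (\<forall>a\<in>carrier A. \<forall>b\<in>carrier A. \<forall>c\<in>carrier A.
        (a \<cdot>\<^bsub>A\<^esub> b) \<cdot>\<^bsub>A\<^esub> c = a \<cdot>\<^bsub>A\<^esub> (b \<cdot>\<^bsub>A\<^esub> c)) \<and>
     (\<forall>a\<in>carrier A. \<one>\<^bsub>A\<^esub> \<cdot>\<^bsub>A\<^esub> a = a \<and> a \<cdot>\<^bsub>A\<^esub> \<one>\<^bsub>A\<^esub> = a)"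

definition algebra_hom ::
  "('k::field, 'v::ab_group_add, 'x) algebra_scheme \<Rightarrow> ('k, 'w::ab_group_add, 'y) algebra_scheme
    \<Rightarrow> ('v \<Rightarrow> 'w) \<Rightarrow> bool" where
  "algebra_hom A B f \<longleftrightarrow>
     linear_on A B f \<and>
     (\<forall>a\<in>carrier A. \<forall>b\<in>carrier A. f (a \<cdot>\<^bsub>A\<^esub> b) = f a \<cdot>\<^bsub>B\<^esub> f b) \<and> f \<one>\<^bsub>A\<^esub> = \<one>\<^bsub>B\<^esub>"

definition ground_algebra :: "('k::field, 'k) algebra" where
  "ground_algebra = \<lparr>carrier = UNIV, scale = (*), mult = (*), unit = 1\<rparr>"

definition tensor_algebra ::
  "('k::field, 'v::ab_group_add, 'x) algebra_scheme \<Rightarrow> ('k, 'w::ab_group_add, 'y) algebra_scheme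
    \<Rightarrow> ('k, ('k, 'v, 'w) tensor) algebra" where
  "tensor_algebra A B =
     \<lparr>carrier = carrier (A \<Otimes> B), scale = tscale,
      mult = (\<lambda>s t. tsum A B s (\<lambda>a b. tsum A B t (\<lambda>a' b'. (a \<cdot>\<^bsub>A\<^esub> a') \<otimes>\<^bsub>A,B\<^esub> (b \<cdot>\<^bsub>B\<^esub> b')))),
      unit = \<one>\<^bsub>A\<^esub> \<otimes>\<^bsub>A,B\<^esub> \<one>\<^bsub>B\<^esub>\<rparr>"

record ('k, 'v) bialgebra = "('k, 'v) algebra" +
  comult :: "'v \<Rightarrow> ('k, 'v, 'v) tensor"
  counit :: "'v \<Rightarrow> 'k"

text \<open>\<open>sw2 C c f\<close> and \<open>sw3 C c f\<close> are the sums of \<open>f c\<^sub>(\<^sub>1\<^sub>) c\<^sub>(\<^sub>2\<^sub>)\<close> and of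
  \<open>f c\<^sub>(\<^sub>1\<^sub>) c\<^sub>(\<^sub>2\<^sub>) c\<^sub>(\<^sub>3\<^sub>)\<close>.\<close>

definition sw2 ::
  "('k::field, 'v::ab_group_add, 'x) bialgebra_scheme \<Rightarrow> 'v
    \<Rightarrow> ('v \<Rightarrow> 'v \<Rightarrow> 'u::ab_group_add) \<Rightarrow> 'u" where
  "sw2 C c f = tsum C C (comult C c) f"

definition sw3 ::
  "('k::field, 'v::ab_group_add, 'x) bialgebra_scheme \<Rightarrow> 'v
    \<Rightarrow> ('v \<Rightarrow> 'v \<Rightarrow> 'v \<Rightarrow> 'u::ab_group_add) \<Rightarrow> 'u" where
  "sw3 C c f = sw2 C c (\<lambda>c1 c'. sw2 C c' (\<lambda>c2 c3. f c1 c2 c3))"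

definition is_coalgebra :: "('k::field, 'v::ab_group_add, 'x) bialgebra_scheme \<Rightarrow> bool" where
  "is_coalgebra C \<longleftrightarrow>
     vspace C \<and> linear_on C (C \<Otimes> C) (comult C) \<and> linear_on C ground (counit C) \<and>
     (\<forall>c\<in>carrier C.
        tensor_assoc C C C (sw2 C c (\<lambda>c1 c2. comult C c1 \<otimes>\<^bsub>C \<Otimes> C, C\<^esub> c2))
          = sw2 C c (\<lambda>c1 c2. c1 \<otimes>\<^bsub>C, C \<Otimes> C\<^esub> comult C c2) \<and>
        sw2 C c (\<lambda>c1 c2. scale C (counit C c1) c2) = c \<and>
        sw2 C c (\<lambda>c1 c2. scale C (counit C c2) c1) = c)"

definition is_bialgebra :: "('k::field, 'v::ab_group_add, 'x) bialgebra_scheme \<Rightarrow> bool" where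
  "is_bialgebra B \<longleftrightarrow>
     is_algebra B \<and> is_coalgebra B \<and>
     algebra_hom B (tensor_algebra B B) (comult B) \<and> algebra_hom B ground_algebra (counit B)"

definition bialgebra_hom ::
  "('k::field, 'v::ab_group_add, 'x) bialgebra_scheme \<Rightarrow> ('k, 'w::ab_group_add, 'y) bialgebra_scheme
    \<Rightarrow> ('v \<Rightarrow> 'w) \<Rightarrow> bool" where
  "bialgebra_hom A B f \<longleftrightarrow>
     algebra_hom A B f \<and>
     (\<forall>a\<in>carrier A. comult B (f a) = sw2 A a (\<lambda>a1 a2. f a1 \<otimes>\<^bsub>B,B\<^esub> f a2)) \<and>
     (\<forall>a\<in>carrier A. counit B (f a) = counit A a)"

definition bialgebra_iso ::
  "('k::field, 'v::ab_group_add, 'x) bialgebra_scheme \<Rightarrow> ('k, 'w::ab_group_add, 'y) bialgebra_scheme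
    \<Rightarrow> bool" (infix \<open>\<simeq>\<close> 50) where
  "A \<simeq> B \<longleftrightarrow> (\<exists>f. bialgebra_hom A B f \<and> bij_betw f (carrier A) (carrier B))"

record ('k, 'v) hopf = "('k, 'v) bialgebra" +
  antipode :: "'v \<Rightarrow> 'v"

definition is_hopf :: "('k::field, 'v::ab_group_add, 'x) hopf_scheme \<Rightarrow> bool" where
  "is_hopf H \<longleftrightarrow>
     is_bialgebra H \<and> linear_on H H (antipode H) \<and>
     (\<forall>h\<in>carrier H.
        sw2 H h (\<lambda>h1 h2. antipode H h1 \<cdot>\<^bsub>H\<^esub> h2) = scale H (counit H h) \<one>\<^bsub>H\<^esub> \<and>
        sw2 H h (\<lambda>h1 h2. h1 \<cdot>\<^bsub>H\<^esub> antipode H h2) = scale H (counit H h) \<one>\<^bsub>H\<^esub>)"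


section \<open>Modules and comodules\<close>

definition left_module ::
  "('k::field, 'h::ab_group_add, 'x) algebra_scheme \<Rightarrow> ('k, 'v::ab_group_add, 'y) kspace_scheme
    \<Rightarrow> ('h \<Rightarrow> 'v \<Rightarrow> 'v) \<Rightarrow> bool" where
  "left_module H V l \<longleftrightarrow>
     vspace V \<and> bilinear_on H V V l \<and>
     (\<forall>h\<in>carrier H. \<forall>k\<in>carrier H. \<forall>v\<in>carrier V. l (h \<cdot>\<^bsub>H\<^esub> k) v = l h (l k v)) \<and>
     (\<forall>v\<in>carrier V. l \<one>\<^bsub>H\<^esub> v = v)"

definition right_module ::
  "('k::field, 'h::ab_group_add, 'x) algebra_scheme \<Rightarrow> ('k, 'v::ab_group_add, 'y) kspace_scheme
    \<Rightarrow> ('v \<Rightarrow> 'h \<Rightarrow> 'v) \<Rightarrow> bool" where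
  "right_module H V r \<longleftrightarrow>
     vspace V \<and> bilinear_on V H V r \<and>
     (\<forall>h\<in>carrier H. \<forall>k\<in>carrier H. \<forall>v\<in>carrier V. r v (h \<cdot>\<^bsub>H\<^esub> k) = r (r v h) k) \<and>
     (\<forall>v\<in>carrier V. r v \<one>\<^bsub>H\<^esub> = v)"

definition left_comodule ::
  "('k::field, 'h::ab_group_add, 'x) bialgebra_scheme \<Rightarrow> ('k, 'v::ab_group_add, 'y) kspace_scheme
    \<Rightarrow> ('v \<Rightarrow> ('k, 'h, 'v) tensor) \<Rightarrow> bool" where
  "left_comodule H V \<rho> \<longleftrightarrow>
     vspace V \<and> linear_on V (H \<Otimes> V) \<rho> \<and>
     (\<forall>v\<in>carrier V.
        tensor_assoc H H V (tsum H V (\<rho> v) (\<lambda>a v0. comult H a \<otimes>\<^bsub>H \<Otimes> H, V\<^esub> v0))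
          = tsum H V (\<rho> v) (\<lambda>a v0. a \<otimes>\<^bsub>H, H \<Otimes> V\<^esub> \<rho> v0) \<and>
        tsum H V (\<rho> v) (\<lambda>a v0. scale V (counit H a) v0) = v)"

definition right_comodule ::
  "('k::field, 'h::ab_group_add, 'x) bialgebra_scheme \<Rightarrow> ('k, 'v::ab_group_add, 'y) kspace_scheme
    \<Rightarrow> ('v \<Rightarrow> ('k, 'v, 'h) tensor) \<Rightarrow> bool" where
  "right_comodule H V \<rho> \<longleftrightarrow>
     vspace V \<and> linear_on V (V \<Otimes> H) \<rho> \<and>
     (\<forall>v\<in>carrier V.
        tensor_assoc V H H (tsum V H (\<rho> v) (\<lambda>v0 a. \<rho> v0 \<otimes>\<^bsub>V \<Otimes> H, H\<^esub> a))
          = tsum V H (\<rho> v) (\<lambda>v0 a. v0 \<otimes>\<^bsub>V, H \<Otimes> H\<^esub> comult H a) \<and>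
        tsum V H (\<rho> v) (\<lambda>v0 a. scale V (counit H a) v0) = v)"


section \<open>Yetter-Drinfeld modules\<close>

text \<open>
  The data of a Yetter-Drinfeld module together with a product and a unit. The predicates
  \<open>yd_module\<close> and \<open>yd_hom\<close> ignore the latter.
\<close>

record ('k, 'h, 'v) yd = "('k, 'v) algebra" +
  act :: "'h \<Rightarrow> 'v \<Rightarrow> 'v"
  coact :: "'v \<Rightarrow> ('k, 'h, 'v) tensor"

definition yd_module ::
  "('k::field, 'h::ab_group_add, 'x) hopf_scheme \<Rightarrow> ('k, 'h, 'v::ab_group_add, 'y) yd_scheme
    \<Rightarrow> bool" where
  "yd_module H V \<longleftrightarrow>
     left_module H V (act V) \<and> left_comodule H V (coact V) \<and>
     (\<forall>h\<in>carrier H. \<forall>v\<in>carrier V.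
        coact V (act V h v) =
          sw3 H h (\<lambda>h1 h2 h3. tsum H V (coact V v) (\<lambda>a v0.
            (h1 \<cdot>\<^bsub>H\<^esub> a \<cdot>\<^bsub>H\<^esub> antipode H h3) \<otimes>\<^bsub>H,V\<^esub> act V h2 v0)))"

definition yd_hom ::
  "('k::field, 'h::ab_group_add, 'x) hopf_scheme \<Rightarrow> ('k, 'h, 'v::ab_group_add, 'y) yd_scheme
    \<Rightarrow> ('k, 'h, 'w::ab_group_add, 'z) yd_scheme \<Rightarrow> ('v \<Rightarrow> 'w) \<Rightarrow> bool" where
  "yd_hom H V W f \<longleftrightarrow>
     linear_on V W f \<and>
     (\<forall>h\<in>carrier H. \<forall>v\<in>carrier V. f (act V h v) = act W h (f v)) \<and>
     (\<forall>v\<in>carrier V. coact W (f v) = tsum H V (coact V v) (\<lambda>a v0. a \<otimes>\<^bsub>H,W\<^esub> f v0))"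

definition yd_ground ::
  "('k::field, 'h::ab_group_add, 'x) hopf_scheme \<Rightarrow> ('k, 'h, 'k) yd" where
  "yd_ground H =
     \<lparr>carrier = UNIV, scale = (*), mult = (*), unit = 1,
      act = (\<lambda>h c. counit H h * c), coact = (\<lambda>c. \<one>\<^bsub>H\<^esub> \<otimes>\<^bsub>H,ground\<^esub> c)\<rparr>"

text \<open>Diagonal action and coaction; the product is twisted by the Yetter-Drinfeld braiding.\<close>

definition yd_tensor ::
  "('k::field, 'h::ab_group_add, 'x) hopf_scheme \<Rightarrow> ('k, 'h, 'v::ab_group_add, 'y) yd_scheme
    \<Rightarrow> ('k, 'h, 'w::ab_group_add, 'z) yd_scheme \<Rightarrow> ('k, 'h, ('k, 'v, 'w) tensor) yd" where
  "yd_tensor H V W =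
     \<lparr>carrier = carrier (V \<Otimes> W), scale = tscale,
      mult = (\<lambda>x y. tsum V W x (\<lambda>r s. tsum V W y (\<lambda>t v. tsum H W (coact W s) (\<lambda>a s0.
                (r \<cdot>\<^bsub>V\<^esub> act V a t) \<otimes>\<^bsub>V,W\<^esub> (s0 \<cdot>\<^bsub>W\<^esub> v))))),
      unit = \<one>\<^bsub>V\<^esub> \<otimes>\<^bsub>V,W\<^esub> \<one>\<^bsub>W\<^esub>,
      act = (\<lambda>h x. tsum V W x (\<lambda>v w. sw2 H h (\<lambda>h1 h2. act V h1 v \<otimes>\<^bsub>V,W\<^esub> act W h2 w))),
      coact = (\<lambda>x. tsum V W x (\<lambda>v w. tsum H V (coact V v) (\<lambda>a v0. tsum H W (coact W w) (\<lambda>b w0.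
                (a \<cdot>\<^bsub>H\<^esub> b) \<otimes>\<^bsub>H, V \<Otimes> W\<^esub> (v0 \<otimes>\<^bsub>V,W\<^esub> w0)))))\<rparr>"

definition yd_algebra ::
  "('k::field, 'h::ab_group_add, 'x) hopf_scheme \<Rightarrow> ('k, 'h, 'r::ab_group_add, 'y) yd_scheme
    \<Rightarrow> bool" where
  "yd_algebra H R \<longleftrightarrow>
     is_algebra R \<and> yd_module H R \<and>
     yd_hom H (yd_tensor H R R) R (\<lambda>t. tsum R R t (mult R)) \<and>
     yd_hom H (yd_ground H) R (\<lambda>c. scale R c \<one>\<^bsub>R\<^esub>)"

definition yd_quadruple ::
  "('k::field, 'h::ab_group_add, 'x) hopf_scheme \<Rightarrow> ('k, 'h, 'r::ab_group_add, 'y) yd_scheme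
    \<Rightarrow> ('r \<Rightarrow> 'k) \<Rightarrow> ('r \<Rightarrow> ('k, 'r, 'r) tensor) \<Rightarrow> ('h \<Rightarrow> ('k, 'r, 'r) tensor) \<Rightarrow> bool" where
  "yd_quadruple H R \<epsilon> \<delta> \<omega> \<longleftrightarrow>
     (let RR = yd_tensor H R R in
     yd_algebra H R \<and> linear_on R ground \<epsilon> \<and> linear_on R RR \<delta> \<and> linear_on H RR \<omega> \<and>
     (\<forall>h\<in>carrier H. \<forall>r\<in>carrier R. \<epsilon> (act R h r) = \<epsilon> r * counit H h) \<and>
     (\<forall>r\<in>carrier R. tsum H R (coact R r) (\<lambda>a r0. scale H (\<epsilon> r0) a) = scale H (\<epsilon> r) \<one>\<^bsub>H\<^esub>) \<and>
     (\<forall>r\<in>carrier R. \<forall>s\<in>carrier R. \<epsilon> (r \<cdot>\<^bsub>R\<^esub> s) = \<epsilon> r * \<epsilon> s) \<and> \<epsilon> \<one>\<^bsub>R\<^esub> = 1 \<and>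
     (\<forall>r\<in>carrier R. coact RR (\<delta> r) = tsum H R (coact R r) (\<lambda>a r0. a \<otimes>\<^bsub>H,RR\<^esub> \<delta> r0)) \<and>
     (\<forall>h\<in>carrier H. coact RR (\<omega> h) =
        sw3 H h (\<lambda>h1 h2 h3. (h1 \<cdot>\<^bsub>H\<^esub> antipode H h3) \<otimes>\<^bsub>H,RR\<^esub> \<omega> h2)) \<and>
     (\<forall>r\<in>carrier R. \<forall>s\<in>carrier R. \<delta> (r \<cdot>\<^bsub>R\<^esub> s) = \<delta> r \<cdot>\<^bsub>RR\<^esub> \<delta> s) \<and> \<delta> \<one>\<^bsub>R\<^esub> = \<one>\<^bsub>R\<^esub> \<otimes>\<^bsub>R,R\<^esub> \<one>\<^bsub>R\<^esub> \<and>
     (\<forall>h\<in>carrier H. \<forall>k\<in>carrier H.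
        \<omega> (h \<cdot>\<^bsub>H\<^esub> k) = sw2 H h (\<lambda>h1 h2. \<omega> h1 \<cdot>\<^bsub>RR\<^esub> act RR h2 (\<omega> k))) \<and>
     \<omega> \<one>\<^bsub>H\<^esub> = \<one>\<^bsub>R\<^esub> \<otimes>\<^bsub>R,R\<^esub> \<one>\<^bsub>R\<^esub> \<and>
     (\<forall>h\<in>carrier H. \<forall>r\<in>carrier R.
        sw2 H h (\<lambda>h1 h2. \<delta> (act R h1 r) \<cdot>\<^bsub>RR\<^esub> \<omega> h2)
          = sw2 H h (\<lambda>h1 h2. \<omega> h1 \<cdot>\<^bsub>RR\<^esub> act RR h2 (\<delta> r))) \<and>
     (\<forall>r\<in>carrier R.
        tsum R R (\<delta> r) (\<lambda>x y. x \<otimes>\<^bsub>R,RR\<^esub> \<delta> y)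
          = tensor_assoc R R R (tsum R R (\<delta> r) (\<lambda>x y. tsum H R (coact R y) (\<lambda>a y0.
              (\<delta> x \<cdot>\<^bsub>RR\<^esub> \<omega> a) \<otimes>\<^bsub>RR,R\<^esub> y0)))) \<and>
     (\<forall>h\<in>carrier H.
        sw2 H h (\<lambda>h1 h2. tsum R R (\<omega> h1) (\<lambda>x y. x \<otimes>\<^bsub>R,RR\<^esub> (\<delta> y \<cdot>\<^bsub>RR\<^esub> \<omega> h2)))
          = tensor_assoc R R R (sw2 H h (\<lambda>h1 h2. tsum R R (\<omega> h1) (\<lambda>x y.
              tsum H R (coact R y) (\<lambda>a y0.
                (\<delta> x \<cdot>\<^bsub>RR\<^esub> \<omega> (a \<cdot>\<^bsub>H\<^esub> h2)) \<otimes>\<^bsub>RR,R\<^esub> y0))))) \<and>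
     (\<forall>r\<in>carrier R.
        tsum R R (\<delta> r) (\<lambda>x y. scale R (\<epsilon> x) y) = r \<and>
        tsum R R (\<delta> r) (\<lambda>x y. scale R (\<epsilon> y) x) = r) \<and>
     (\<forall>h\<in>carrier H.
        tsum R R (\<omega> h) (\<lambda>x y. scale R (\<epsilon> x) y) = scale R (counit H h) \<one>\<^bsub>R\<^esub> \<and>
        tsum R R (\<omega> h) (\<lambda>x y. scale R (\<epsilon> y) x) = scale R (counit H h) \<one>\<^bsub>R\<^esub>))"

definition bosonization ::
  "('k::field, 'h::ab_group_add, 'x) hopf_scheme \<Rightarrow> ('k, 'h, 'r::ab_group_add, 'y) yd_scheme
    \<Rightarrow> ('r \<Rightarrow> 'k) \<Rightarrow> ('r \<Rightarrow> ('k, 'r, 'r) tensor) \<Rightarrow> ('h \<Rightarrow> ('k, 'r, 'r) tensor)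
    \<Rightarrow> ('k, ('k, 'r, 'h) tensor) bialgebra" where
  "bosonization H R \<epsilon> \<delta> \<omega> =
     \<lparr>carrier = carrier (R \<Otimes> H), scale = tscale,
      mult = (\<lambda>x y. tsum R H x (\<lambda>r h. tsum R H y (\<lambda>s k. sw2 H h (\<lambda>h1 h2.
                (r \<cdot>\<^bsub>R\<^esub> act R h1 s) \<otimes>\<^bsub>R,H\<^esub> (h2 \<cdot>\<^bsub>H\<^esub> k))))),
      unit = \<one>\<^bsub>R\<^esub> \<otimes>\<^bsub>R,H\<^esub> \<one>\<^bsub>H\<^esub>,
      comult = (\<lambda>x. tsum R H x (\<lambda>r h. sw3 H h (\<lambda>h1 h2 h3.
                tsum R R (\<delta> r \<cdot>\<^bsub>yd_tensor H R R\<^esub> \<omega> h1) (\<lambda>p q. tsum H R (coact R q) (\<lambda>a q0.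
                  (p \<otimes>\<^bsub>R,H\<^esub> (a \<cdot>\<^bsub>H\<^esub> h2)) \<otimes>\<^bsub>R \<Otimes> H, R \<Otimes> H\<^esub> (q0 \<otimes>\<^bsub>R,H\<^esub> h3)))))),
      counit = (\<lambda>x. tsum R H x (\<lambda>r h. \<epsilon> r * counit H h))\<rparr>"


section \<open>Bicomodules and Hopf bimodules\<close>

record ('k, 'h, 'v) bicomod = "('k, 'v) kspace" +
  lcoact :: "'v \<Rightarrow> ('k, 'h, 'v) tensor"
  rcoact :: "'v \<Rightarrow> ('k, 'v, 'h) tensor"

record ('k, 'h, 'v) hopf_bimod = "('k, 'h, 'v) bicomod" +
  lact :: "'h \<Rightarrow> 'v \<Rightarrow> 'v"
  ract :: "'v \<Rightarrow> 'h \<Rightarrow> 'v"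

definition is_bicomodule ::
  "('k::field, 'h::ab_group_add, 'x) bialgebra_scheme
    \<Rightarrow> ('k, 'h, 'v::ab_group_add, 'y) bicomod_scheme \<Rightarrow> bool" where
  "is_bicomodule H M \<longleftrightarrow>
     left_comodule H M (lcoact M) \<and> right_comodule H M (rcoact M) \<and>
     (\<forall>m\<in>carrier M.
        tensor_assoc H M H (tsum M H (rcoact M m) (\<lambda>m0 b. lcoact M m0 \<otimes>\<^bsub>H \<Otimes> M, H\<^esub> b))
          = tsum H M (lcoact M m) (\<lambda>a m0. a \<otimes>\<^bsub>H, M \<Otimes> H\<^esub> rcoact M m0))"

definition bicomodule_hom ::
  "('k::field, 'h::ab_group_add, 'x) bialgebra_scheme
    \<Rightarrow> ('k, 'h, 'v::ab_group_add, 'y) bicomod_scheme \<Rightarrow> ('k, 'h, 'w::ab_group_add, 'z) bicomod_scheme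
    \<Rightarrow> ('v \<Rightarrow> 'w) \<Rightarrow> bool" where
  "bicomodule_hom H M N f \<longleftrightarrow>
     linear_on M N f \<and>
     (\<forall>m\<in>carrier M. lcoact N (f m) = tsum H M (lcoact M m) (\<lambda>a m0. a \<otimes>\<^bsub>H,N\<^esub> f m0)) \<and>
     (\<forall>m\<in>carrier M. rcoact N (f m) = tsum M H (rcoact M m) (\<lambda>m0 a. f m0 \<otimes>\<^bsub>N,H\<^esub> a))"

text \<open>The last four conditions say that the coactions are maps of bimodules, where
  \<open>H \<Otimes> M\<close> and \<open>M \<Otimes> H\<close> carry the diagonal left and right actions.\<close>

definition is_hopf_bimodule ::
  "('k::field, 'h::ab_group_add, 'x) bialgebra_scheme
    \<Rightarrow> ('k, 'h, 'v::ab_group_add, 'y) hopf_bimod_scheme \<Rightarrow> bool" where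
  "is_hopf_bimodule H M \<longleftrightarrow>
     left_module H M (lact M) \<and> right_module H M (ract M) \<and>
     (\<forall>h\<in>carrier H. \<forall>k\<in>carrier H. \<forall>m\<in>carrier M. ract M (lact M h m) k = lact M h (ract M m k)) \<and>
     is_bicomodule H M \<and>
     (\<forall>h\<in>carrier H. \<forall>m\<in>carrier M.
        lcoact M (lact M h m) =
          sw2 H h (\<lambda>h1 h2. tsum H M (lcoact M m) (\<lambda>a m0. (h1 \<cdot>\<^bsub>H\<^esub> a) \<otimes>\<^bsub>H,M\<^esub> lact M h2 m0)) \<and>
        lcoact M (ract M m h) =
          sw2 H h (\<lambda>h1 h2. tsum H M (lcoact M m) (\<lambda>a m0. (a \<cdot>\<^bsub>H\<^esub> h1) \<otimes>\<^bsub>H,M\<^esub> ract M m0 h2)) \<and>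
        rcoact M (lact M h m) =
          sw2 H h (\<lambda>h1 h2. tsum M H (rcoact M m) (\<lambda>m0 a. lact M h1 m0 \<otimes>\<^bsub>M,H\<^esub> (h2 \<cdot>\<^bsub>H\<^esub> a))) \<and>
        rcoact M (ract M m h) =
          sw2 H h (\<lambda>h1 h2. tsum M H (rcoact M m) (\<lambda>m0 a. ract M m0 h1 \<otimes>\<^bsub>M,H\<^esub> (a \<cdot>\<^bsub>H\<^esub> h2))))"

definition hopf_bimodule_hom ::
  "('k::field, 'h::ab_group_add, 'x) bialgebra_scheme
    \<Rightarrow> ('k, 'h, 'v::ab_group_add, 'y) hopf_bimod_scheme
    \<Rightarrow> ('k, 'h, 'w::ab_group_add, 'z) hopf_bimod_scheme \<Rightarrow> ('v \<Rightarrow> 'w) \<Rightarrow> bool" where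
  "hopf_bimodule_hom H M N f \<longleftrightarrow>
     bicomodule_hom H M N f \<and>
     (\<forall>h\<in>carrier H. \<forall>m\<in>carrier M.
        f (lact M h m) = lact N h (f m) \<and> f (ract M m h) = ract N (f m) h)"


subsection \<open>Tensor product over H\<close>

text \<open>
  The same construction as for \<open>\<Otimes>\<close>, using balanced bilinear forms only; see
  \<open>balanced_universal\<close> for the universal property.
\<close>

definition balanced_form ::
  "('k::field, 'h, 'x) kspace_scheme \<Rightarrow> ('k, 'h, 'v::ab_group_add, 'y) hopf_bimod_scheme
    \<Rightarrow> ('k, 'h, 'w::ab_group_add, 'z) hopf_bimod_scheme \<Rightarrow> ('v \<Rightarrow> 'w \<Rightarrow> 'k) \<Rightarrow> bool" where
  "balanced_form H M N \<beta> \<longleftrightarrow>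
     bilinear_form M N \<beta> \<and>
     (\<forall>m\<in>carrier M. \<forall>h\<in>carrier H. \<forall>n\<in>carrier N. \<beta> (ract M m h) n = \<beta> m (lact N h n))"

definition btens ::
  "('k::field, 'h, 'x) kspace_scheme \<Rightarrow> ('k, 'h, 'v::ab_group_add, 'y) hopf_bimod_scheme
    \<Rightarrow> ('k, 'h, 'w::ab_group_add, 'z) hopf_bimod_scheme \<Rightarrow> 'v \<Rightarrow> 'w \<Rightarrow> ('k, 'v, 'w) tensor" where
  "btens H M N = elementary (balanced_form H M N)"

definition bsum ::
  "('k::field, 'h, 'x) kspace_scheme \<Rightarrow> ('k, 'h, 'v::ab_group_add, 'y) hopf_bimod_scheme
    \<Rightarrow> ('k, 'h, 'w::ab_group_add, 'z) hopf_bimod_scheme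
    \<Rightarrow> ('k, 'v, 'w) tensor \<Rightarrow> ('v \<Rightarrow> 'w \<Rightarrow> 'u::ab_group_add) \<Rightarrow> 'u" where
  "bsum H M N = sweedler (btens H M N) M N"

definition balanced_space ::
  "('k::field, 'h, 'x) kspace_scheme \<Rightarrow> ('k, 'h, 'v::ab_group_add, 'y) hopf_bimod_scheme
    \<Rightarrow> ('k, 'h, 'w::ab_group_add, 'z) hopf_bimod_scheme \<Rightarrow> ('k, ('k, 'v, 'w) tensor) kspace" where
  "balanced_space H M N =
     \<lparr>carrier = module.span tscale {btens H M N m n | m n. m \<in> carrier M \<and> n \<in> carrier N},
      scale = tscale\<rparr>"

definition hopf_bimod_tensor ::
  "('k::field, 'h::ab_group_add, 'x) bialgebra_scheme
    \<Rightarrow> ('k, 'h, 'v::ab_group_add, 'y) hopf_bimod_scheme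
    \<Rightarrow> ('k, 'h, 'w::ab_group_add, 'z) hopf_bimod_scheme
    \<Rightarrow> ('k, 'h, ('k, 'v, 'w) tensor) hopf_bimod" where
  "hopf_bimod_tensor H M N =
     (let MN = balanced_space H M N in
     \<lparr>carrier = carrier MN, scale = scale MN,
      lcoact = (\<lambda>t. bsum H M N t (\<lambda>m n.
        tsum H M (lcoact M m) (\<lambda>a m0. tsum H N (lcoact N n) (\<lambda>b n0.
          (a \<cdot>\<^bsub>H\<^esub> b) \<otimes>\<^bsub>H,MN\<^esub> btens H M N m0 n0)))),
      rcoact = (\<lambda>t. bsum H M N t (\<lambda>m n.
        tsum M H (rcoact M m) (\<lambda>m0 a. tsum N H (rcoact N n) (\<lambda>n0 b.
          btens H M N m0 n0 \<otimes>\<^bsub>MN,H\<^esub> (a \<cdot>\<^bsub>H\<^esub> b))))),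
      lact = (\<lambda>h t. bsum H M N t (\<lambda>m n. btens H M N (lact M h m) n)),
      ract = (\<lambda>t h. bsum H M N t (\<lambda>m n. btens H M N m (ract N n h)))\<rparr>)"


subsection \<open>Cotensor product over H\<close>

definition cotensor ::
  "('k::field, 'h::ab_group_add, 'x) kspace_scheme
    \<Rightarrow> ('k, 'h, 'v::ab_group_add, 'y) bicomod_scheme \<Rightarrow> ('k, 'h, 'w::ab_group_add, 'z) bicomod_scheme
    \<Rightarrow> ('k, 'h, ('k, 'v, 'w) tensor) bicomod" where
  "cotensor H M N =
     \<lparr>carrier = {t \<in> carrier (M \<Otimes> N).
        tensor_assoc M H N (tsum M N t (\<lambda>m n. rcoact M m \<otimes>\<^bsub>M \<Otimes> H, N\<^esub> n))
          = tsum M N t (\<lambda>m n. m \<otimes>\<^bsub>M, H \<Otimes> N\<^esub> lcoact N n)},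
      scale = tscale,
      lcoact = (\<lambda>t. tensor_assoc H M N (tsum M N t (\<lambda>m n. lcoact M m \<otimes>\<^bsub>H \<Otimes> M, N\<^esub> n))),
      rcoact = (\<lambda>t. tsum M N t (\<lambda>m n. tsum N H (rcoact N n) (\<lambda>n0 a.
                  (m \<otimes>\<^bsub>M,N\<^esub> n0) \<otimes>\<^bsub>M \<Otimes> N, H\<^esub> a)))\<rparr>"


section \<open>The three conditions\<close>

definition becomes_algebra ::
  "('k::field, 'h::ab_group_add, 'x) bialgebra_scheme \<Rightarrow> ('k, 'v::ab_group_add, 'y) algebra_scheme
    \<Rightarrow> ('k, 'h, 'v, 'z) hopf_bimod_scheme \<Rightarrow> bool" where
  "becomes_algebra H A M \<longleftrightarrow>
     algebra_hom A (tensor_algebra H A) (lcoact M) \<and> algebra_hom A (tensor_algebra A H) (rcoact M) \<and>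
     (\<exists>\<mu>. hopf_bimodule_hom H (hopf_bimod_tensor H M M) M \<mu> \<and>
        (\<forall>a\<in>carrier A. \<forall>b\<in>carrier A. a \<cdot>\<^bsub>A\<^esub> b = \<mu> (btens H M M a b)))"

definition becomes_coalgebra ::
  "('k::field, 'h::ab_group_add, 'x) bialgebra_scheme \<Rightarrow> ('k, 'v::ab_group_add, 'y) bialgebra_scheme
    \<Rightarrow> ('k, 'h, 'v, 'z) bicomod_scheme \<Rightarrow> bool" where
  "becomes_coalgebra H C M \<longleftrightarrow>
     comult C ` carrier C \<subseteq> carrier (cotensor H M M) \<and>
     bicomodule_hom H M (cotensor H M M) (comult C)"

definition compatible_structure ::
  "('k::field, 'h::ab_group_add, 'x) bialgebra_scheme \<Rightarrow> ('k, 'v::ab_group_add, 'y) bialgebra_scheme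
    \<Rightarrow> ('k, 'h, 'v) hopf_bimod \<Rightarrow> bool" where
  "compatible_structure H A M \<longleftrightarrow>
     carrier M = carrier A \<and> scale M = scale A \<and> is_hopf_bimodule H M \<and>
     (\<forall>a\<in>carrier A. \<forall>h\<in>carrier H. counit A (ract M a h) = counit A a * counit H h) \<and>
     becomes_algebra H A M \<and> becomes_coalgebra H A M"

definition bicomod_via ::
  "('k::field, 'h::ab_group_add, 'x) kspace_scheme \<Rightarrow> ('k, 'v::ab_group_add, 'y) bialgebra_scheme
    \<Rightarrow> ('v \<Rightarrow> 'h) \<Rightarrow> ('k, 'h, 'v) bicomod" where
  "bicomod_via H A \<pi> =
     \<lparr>carrier = carrier A, scale = scale A,
      lcoact = (\<lambda>a. sw2 A a (\<lambda>a1 a2. \<pi> a1 \<otimes>\<^bsub>H,A\<^esub> a2)),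
      rcoact = (\<lambda>a. sw2 A a (\<lambda>a1 a2. a1 \<otimes>\<^bsub>A,H\<^esub> \<pi> a2))\<rparr>"

text \<open>\<open>H\<close> itself is an \<open>(H, H)\<close>-bicomodule via its comultiplication, that is, via the identity.\<close>

definition bicolinear_splitting ::
  "('k::field, 'h::ab_group_add, 'x) bialgebra_scheme \<Rightarrow> ('k, 'v::ab_group_add, 'y) bialgebra_scheme
    \<Rightarrow> ('v \<Rightarrow> 'h) \<Rightarrow> ('h \<Rightarrow> 'v) \<Rightarrow> bool" where
  "bicolinear_splitting H A \<pi> \<sigma> \<longleftrightarrow>
     bialgebra_hom A H \<pi> \<and> algebra_hom H A \<sigma> \<and>
     bicomodule_hom H (bicomod_via H H id) (bicomod_via H A \<pi>) \<sigma> \<and>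
     (\<forall>h\<in>carrier H. \<pi> (\<sigma> h) = h)"

definition hopf_bimod_via ::
  "('k::field, 'h::ab_group_add, 'x) kspace_scheme \<Rightarrow> ('k, 'v::ab_group_add, 'y) bialgebra_scheme
    \<Rightarrow> ('v \<Rightarrow> 'h) \<Rightarrow> ('h \<Rightarrow> 'v) \<Rightarrow> ('k, 'h, 'v) hopf_bimod" where
  "hopf_bimod_via H A \<pi> \<sigma> =
     \<lparr>carrier = carrier A, scale = scale A,
      lcoact = lcoact (bicomod_via H A \<pi>), rcoact = rcoact (bicomod_via H A \<pi>),
      lact = (\<lambda>h a. \<sigma> h \<cdot>\<^bsub>A\<^esub> a), ract = (\<lambda>a h. a \<cdot>\<^bsub>A\<^esub> \<sigma> h)\<rparr>"

definition coinvariants ::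
  "('k::field, 'h::ab_group_add, 'x) algebra_scheme
    \<Rightarrow> ('k, 'h, 'v::ab_group_add, 'y) bicomod_scheme \<Rightarrow> 'v set" where
  "coinvariants H M = {v \<in> carrier M. rcoact M v = v \<otimes>\<^bsub>M,H\<^esub> \<one>\<^bsub>H\<^esub>}"

definition diagram ::
  "('k::field, 'h::ab_group_add, 'x) hopf_scheme \<Rightarrow> ('k, 'v::ab_group_add, 'y) algebra_scheme
    \<Rightarrow> ('k, 'h, 'v, 'z) hopf_bimod_scheme \<Rightarrow> ('k, 'h, 'v) yd" where
  "diagram H A M =
     \<lparr>carrier = coinvariants H M, scale = scale A, mult = mult A, unit = \<one>\<^bsub>A\<^esub>,
      act = (\<lambda>h v. sw2 H h (\<lambda>h1 h2. ract M (lact M h1 v) (antipode H h2))),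
      coact = lcoact M\<rparr>"


section \<open>Universal properties\<close>

lemma vector_space_tscale: "vector_space (tscale :: 'k::field \<Rightarrow> ('k, 'v, 'w) tensor \<Rightarrow> _)"
  by unfold_locales (transfer; simp add: fun_eq_iff algebra_simps)+

interpretation tensor: vector_space "tscale :: 'k::field \<Rightarrow> ('k, 'v, 'w) tensor \<Rightarrow> _"
  by (rule vector_space_tscale)

lemma vector_space_mult: "vector_space ((*) :: 'k::field \<Rightarrow> 'k \<Rightarrow> 'k)"
  by unfold_locales (simp_all add: algebra_simps)

lemma eval_at_0 [simp]: "eval_at 0 \<beta> = 0"
  by transfer simp

lemma eval_at_add [simp]: "eval_at (s + t) \<beta> = eval_at s \<beta> + eval_at t \<beta>"
  by transfer simp

lemma eval_at_tscale [simp]: "eval_at (tscale c t) \<beta> = c * eval_at t \<beta>"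
  by transfer simp

lemma eval_at_elementary [simp]: "eval_at (elementary P v w) \<beta> = (if P \<beta> then \<beta> v w else 0)"
  by (simp add: elementary_def Tensor_inverse)

lemma tensor_eqI: "(\<And>\<beta>. eval_at s \<beta> = eval_at t \<beta>) \<Longrightarrow> s = t"
  by (simp add: eval_at_inject[symmetric] fun_eq_iff)

lemma eval_at_sum_list:
  "eval_at (\<Sum>(v, w)\<leftarrow>ps. T v w) \<beta> = (\<Sum>(v, w)\<leftarrow>ps. eval_at (T v w) \<beta>)"
  by (induction ps) auto

lemma bilinear_formD:
  assumes "bilinear_form V W \<beta>"
  shows "\<beta> (x + y) w = \<beta> x w + \<beta> y w" and "\<beta> v (z + u) = \<beta> v z + \<beta> v u"
    and "\<beta> (scale V c v) w = c * \<beta> v w" and "\<beta> v (scale W c w) = c * \<beta> v w"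
proof -
  interpret l: Vector_Spaces.linear "scale V" "(*)" "\<lambda>v. \<beta> v w"
    using assms by (simp add: bilinear_form_def)
  interpret r: Vector_Spaces.linear "scale W" "(*)" "\<lambda>w. \<beta> v w"
    using assms by (simp add: bilinear_form_def)
  show "\<beta> (x + y) w = \<beta> x w + \<beta> y w" and "\<beta> v (z + u) = \<beta> v z + \<beta> v u"
    and "\<beta> (scale V c v) w = c * \<beta> v w" and "\<beta> v (scale W c w) = c * \<beta> v w"
    by (rule l.add r.add l.scale r.scale)+
qed

lemma separating_functional:
  fixes s :: "'k::field \<Rightarrow> 'u::ab_group_add \<Rightarrow> 'u"
  assumes "vector_space s" and "u \<noteq> 0"
  shows "\<exists>\<phi>. Vector_Spaces.linear s (*) \<phi> \<and> \<phi> u \<noteq> 0"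
proof -
  interpret p: vector_space_pair s "(*) :: 'k \<Rightarrow> 'k \<Rightarrow> 'k"
    by (simp add: vector_space_pair_def assms vector_space_mult)
  have "p.vs1.independent {u}"
    using assms(2) by simp
  from p.linear_independent_extend[OF this, of "\<lambda>_. 1"]
  show ?thesis by auto
qed

lemma subspace_projection:
  fixes s :: "'k::field \<Rightarrow> 'u::ab_group_add \<Rightarrow> 'u"
  assumes "vector_space s" and "module.subspace s S"
  shows "\<exists>p. Vector_Spaces.linear s s p \<and> (\<forall>x. p x \<in> S) \<and> (\<forall>x\<in>S. p x = x)"
proof -
  interpret p: vector_space_pair s s
    by (simp add: vector_space_pair_def assms)
  obtain B where B: "B \<subseteq> S" "p.vs1.independent B" "S = p.vs1.span B"
    using p.vs1.basis_exists p.vs1.span_subspace assms(2) by metis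
  obtain g where g: "Vector_Spaces.linear s s g" "\<forall>x\<in>B. g x = x" "range g = p.vs1.span (id ` B)"
    using p.linear_independent_extend_subspace[OF B(2), of id] by auto
  have "g x = x" if "x \<in> S" for x
    using p.linear_eq_on[OF g(1) p.vs1.linear_ident, of x B] that g(2) B(3) by auto
  moreover have "g x \<in> S" for x
    using g(3) B(3) by auto
  ultimately show ?thesis
    using g(1) by blast
qed

lemma sweedler_eq:
  fixes P :: "('v::ab_group_add \<Rightarrow> 'w::ab_group_add \<Rightarrow> 'k::field) \<Rightarrow> bool"
    and U :: "('k, 'u::ab_group_add, 'z) kspace_scheme"
  assumes U: "vector_space (scale U)"
    and sep: "\<And>\<phi>. Vector_Spaces.linear (scale U) (*) \<phi> \<Longrightarrow>
      \<exists>\<beta>. P \<beta> \<and> (\<forall>v\<in>carrier V. \<forall>w\<in>carrier W. \<beta> v w = \<phi> (f v w))"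
    and ps: "set ps \<subseteq> carrier V \<times> carrier W"
  shows "sweedler (elementary P) V W (\<Sum>(v, w)\<leftarrow>ps. elementary P v w) f = (\<Sum>(v, w)\<leftarrow>ps. f v w)"
proof -
  let ?R = "\<lambda>qs. set qs \<subseteq> carrier V \<times> carrier W \<and>
    (\<Sum>(v, w)\<leftarrow>ps. elementary P v w) = (\<Sum>(v, w)\<leftarrow>qs. elementary P v w)"
  define qs where "qs = (SOME qs. ?R qs)"
  have qs: "?R qs"
    unfolding qs_def by (rule someI[of ?R ps]) (simp add: ps)
  have "(\<Sum>(v, w)\<leftarrow>qs. f v w) = (\<Sum>(v, w)\<leftarrow>ps. f v w)"
  proof (rule ccontr)
    assume "\<not> ?thesis"
    then have "(\<Sum>(v, w)\<leftarrow>qs. f v w) - (\<Sum>(v, w)\<leftarrow>ps. f v w) \<noteq> 0" by simp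
    then obtain \<phi> where \<phi>: "Vector_Spaces.linear (scale U) (*) \<phi>"
      "\<phi> ((\<Sum>(v, w)\<leftarrow>qs. f v w) - (\<Sum>(v, w)\<leftarrow>ps. f v w)) \<noteq> 0"
      using separating_functional[OF U] by blast
    interpret \<phi>: Vector_Spaces.linear "scale U" "(*)" \<phi> by fact
    obtain \<beta> where \<beta>: "P \<beta>" "\<forall>v\<in>carrier V. \<forall>w\<in>carrier W. \<beta> v w = \<phi> (f v w)"
      using sep[OF \<phi>(1)] by blast
    have *: "\<phi> (\<Sum>(v, w)\<leftarrow>rs. f v w) = eval_at (\<Sum>(v, w)\<leftarrow>rs. elementary P v w) \<beta>"
      if "set rs \<subseteq> carrier V \<times> carrier W" for rs
      using that by (induction rs) (use \<beta> in \<open>auto simp: \<phi>.add \<phi>.zero\<close>)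
    show False
      using \<phi>(2) qs ps by (simp add: \<phi>.diff *)
  qed
  then show ?thesis
    by (simp add: sweedler_def qs_def)
qed

lemma span_elementary:
  fixes P :: "('v::ab_group_add \<Rightarrow> 'w::ab_group_add \<Rightarrow> 'k::field) \<Rightarrow> bool"
    and V :: "('k, 'v, 'x) kspace_scheme" and W :: "('k, 'w, 'y) kspace_scheme"
  assumes V: "vspace V" and P: "\<And>\<beta>. P \<beta> \<Longrightarrow> bilinear_form V W \<beta>"
  shows "t \<in> tensor.span {elementary P v w | v w. v \<in> carrier V \<and> w \<in> carrier W} \<longleftrightarrow>
    (\<exists>ps. set ps \<subseteq> carrier V \<times> carrier W \<and> t = (\<Sum>(v, w)\<leftarrow>ps. elementary P v w))"
    (is "t \<in> tensor.span ?S \<longleftrightarrow> ?R t")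
proof
  interpret V: vector_space "scale V" using V by (simp add: vspace_def)
  assume "t \<in> tensor.span ?S"
  then show "?R t"
  proof (induction rule: tensor.span_induct_alt)
    case base
    show ?case by (rule exI[of _ "[]"]) simp
  next
    case (step c x y)
    then obtain v w ps where vw: "v \<in> carrier V" "w \<in> carrier W" "x = elementary P v w"
      "set ps \<subseteq> carrier V \<times> carrier W" "y = (\<Sum>(v, w)\<leftarrow>ps. elementary P v w)"
      by auto
    have "tscale c x = elementary P (scale V c v) w"
    proof (rule tensor_eqI)
      fix \<beta>
      show "eval_at (tscale c x) \<beta> = eval_at (elementary P (scale V c v) w) \<beta>"
        using bilinear_formD(3)[OF P] by (simp add: vw)
    qed
    moreover have "scale V c v \<in> carrier V"
      using V vw by (simp add: vspace_def V.subspace_scale)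
    ultimately show ?case
      using vw by (intro exI[of _ "(scale V c v, w) # ps"]) simp
  qed
next
  assume "?R t"
  then obtain ps where "set ps \<subseteq> carrier V \<times> carrier W" "t = (\<Sum>(v, w)\<leftarrow>ps. elementary P v w)"
    by blast
  then show "t \<in> tensor.span ?S"
    by (induction ps arbitrary: t) (auto intro!: tensor.span_add tensor.span_zero intro: tensor.span_base)
qed

lemma bilinear_form_extend:
  fixes U :: "('k::field, 'u::ab_group_add, 'z) kspace_scheme"
  assumes V: "vspace V" and W: "vspace W" and f: "bilinear_on V W U f"
    and \<phi>: "Vector_Spaces.linear (scale U) (*) \<phi>"
  shows "\<exists>\<beta>. bilinear_form V W \<beta> \<and> (\<forall>v\<in>carrier V. \<forall>w\<in>carrier W. \<beta> v w = \<phi> (f v w))"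
proof -
  obtain p where p: "Vector_Spaces.linear (scale V) (scale V) p"
    "\<forall>x. p x \<in> carrier V" "\<forall>x\<in>carrier V. p x = x"
    using subspace_projection V unfolding vspace_def by blast
  obtain q where q: "Vector_Spaces.linear (scale W) (scale W) q"
    "\<forall>x. q x \<in> carrier W" "\<forall>x\<in>carrier W. q x = x"
    using subspace_projection W unfolding vspace_def by blast
  interpret p: Vector_Spaces.linear "scale V" "scale V" p by fact
  interpret q: Vector_Spaces.linear "scale W" "scale W" q by fact
  interpret \<phi>: Vector_Spaces.linear "scale U" "(*)" \<phi> by fact
  have "bilinear_form V W (\<lambda>v w. \<phi> (f (p v) (q w)))"
    unfolding bilinear_form_def
    using f p(2) q(2) unfolding bilinear_on_def linear_on_def
    by (auto intro!: Vector_Spaces.linear_module_homI module_hom.intro module_hom_axioms.intro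
        simp: p.vs1.module_axioms q.vs1.module_axioms \<phi>.vs2.module_axioms p.add q.add \<phi>.add
          p.scale q.scale \<phi>.scale)
  with p q show ?thesis by (intro exI[of _ "\<lambda>v w. \<phi> (f (p v) (q w))"]) auto
qed

lemma elementary_universal:
  fixes P :: "('v::ab_group_add \<Rightarrow> 'w::ab_group_add \<Rightarrow> 'k::field) \<Rightarrow> bool"
    and V :: "('k, 'v, 'x) kspace_scheme" and W :: "('k, 'w, 'y) kspace_scheme"
    and U :: "('k, 'u::ab_group_add, 'z) kspace_scheme"
    and T :: "('k, ('k, 'v, 'w) tensor, 't) kspace_scheme"
  assumes V: "vspace V" and W: "vspace W" and U: "vspace U"
    and P: "\<And>\<beta>. P \<beta> \<Longrightarrow> bilinear_form V W \<beta>"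
    and f: "bilinear_on V W U f"
    and sep: "\<And>\<phi>. Vector_Spaces.linear (scale U) (*) \<phi> \<Longrightarrow>
      \<exists>\<beta>. P \<beta> \<and> (\<forall>v\<in>carrier V. \<forall>w\<in>carrier W. \<beta> v w = \<phi> (f v w))"
    and T: "carrier T = tensor.span {elementary P v w | v w. v \<in> carrier V \<and> w \<in> carrier W}"
      "scale T = tscale"
  shows "linear_on T U (\<lambda>t. sweedler (elementary P) V W t f)"
    and "v \<in> carrier V \<Longrightarrow> w \<in> carrier W \<Longrightarrow>
      sweedler (elementary P) V W (elementary P v w) f = f v w"
    and "linear_on T U g \<Longrightarrow>
      (\<And>v w. v \<in> carrier V \<Longrightarrow> w \<in> carrier W \<Longrightarrow> g (elementary P v w) = f v w) \<Longrightarrow>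
      t \<in> carrier T \<Longrightarrow> g t = sweedler (elementary P) V W t f"
proof -
  interpret V: vector_space "scale V" using V by (simp add: vspace_def)
  interpret U: vector_space "scale U" using U by (simp add: vspace_def)
  have eq: "sweedler (elementary P) V W (\<Sum>(v, w)\<leftarrow>ps. elementary P v w) f = (\<Sum>(v, w)\<leftarrow>ps. f v w)"
    if "set ps \<subseteq> carrier V \<times> carrier W" for ps
    by (rule sweedler_eq[of U]) (fact U.vector_space_axioms, erule sep, fact that)
  have mem: "t \<in> carrier T \<longleftrightarrow>
      (\<exists>ps. set ps \<subseteq> carrier V \<times> carrier W \<and> t = (\<Sum>(v, w)\<leftarrow>ps. elementary P v w))" for t
    unfolding T(1) by (rule span_elementary[OF V]) (rule P)
  have memE: thesis
    if "t \<in> carrier T"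
      and "\<And>ps. set ps \<subseteq> carrier V \<times> carrier W \<Longrightarrow> t = (\<Sum>(v, w)\<leftarrow>ps. elementary P v w) \<Longrightarrow> thesis"
    for t thesis
    using mem[THEN iffD1, OF that(1)] that(2) by (elim exE conjE)
  show *: "sweedler (elementary P) V W (elementary P v w) f = f v w"
    if "v \<in> carrier V" "w \<in> carrier W" for v w
    using eq[where ps = "[(v, w)]"] that by simp
  have sV: "U.subspace (carrier U)" "V.subspace (carrier V)"
    using U V by (simp_all add: vspace_def)
  show lin: "linear_on T U (\<lambda>t. sweedler (elementary P) V W t f)"
    unfolding linear_on_def
  proof (intro conjI ballI allI)
    fix t assume "t \<in> carrier T"
    then obtain ps where ps: "set ps \<subseteq> carrier V \<times> carrier W" "t = (\<Sum>(v, w)\<leftarrow>ps. elementary P v w)"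
      by (rule memE)
    have "(\<Sum>(v, w)\<leftarrow>ps. f v w) \<in> carrier U"
      using ps(1) f
      by (induction ps) (auto intro!: U.subspace_0 U.subspace_add sV simp: bilinear_on_def linear_on_def)
    then show "sweedler (elementary P) V W t f \<in> carrier U"
      using eq[OF ps(1)] ps(2) by simp
  next
    fix s t assume s: "s \<in> carrier T" and t: "t \<in> carrier T"
    from s obtain ps where ps: "set ps \<subseteq> carrier V \<times> carrier W" "s = (\<Sum>(v, w)\<leftarrow>ps. elementary P v w)"
      by (rule memE)
    from t obtain qs where qs: "set qs \<subseteq> carrier V \<times> carrier W" "t = (\<Sum>(v, w)\<leftarrow>qs. elementary P v w)"
      by (rule memE)
    from ps qs show "sweedler (elementary P) V W (s + t) f
        = sweedler (elementary P) V W s f + sweedler (elementary P) V W t f"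
      using eq[where ps = ps] eq[where ps = qs] eq[where ps = "ps @ qs"] by simp
  next
    fix c t assume "t \<in> carrier T"
    then obtain ps where ps: "set ps \<subseteq> carrier V \<times> carrier W" "t = (\<Sum>(v, w)\<leftarrow>ps. elementary P v w)"
      by (rule memE)
    let ?qs = "map (\<lambda>(v, w). (scale V c v, w)) ps"
    have qs: "set ?qs \<subseteq> carrier V \<times> carrier W"
      using ps(1) by (auto intro!: V.subspace_scale sV)
    have "tscale c t = (\<Sum>(v, w)\<leftarrow>?qs. elementary P v w)"
    proof (rule tensor_eqI)
      fix \<beta>
      show "eval_at (tscale c t) \<beta> = eval_at (\<Sum>(v, w)\<leftarrow>?qs. elementary P v w) \<beta>"
        unfolding ps(2) using bilinear_formD(3)[OF P]
        by (induction ps) (auto simp: distrib_left)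
    qed
    moreover have "(\<Sum>(v, w)\<leftarrow>?qs. f v w) = scale U c (\<Sum>(v, w)\<leftarrow>ps. f v w)"
      using ps(1) f
      by (induction ps) (auto simp: bilinear_on_def linear_on_def U.scale_right_distrib)
    ultimately show "sweedler (elementary P) V W (scale T c t) f
        = scale U c (sweedler (elementary P) V W t f)"
      using eq[OF qs] eq[OF ps(1)] ps(2) T(2) by simp
  qed
  assume g: "linear_on T U g"
    "\<And>v w. v \<in> carrier V \<Longrightarrow> w \<in> carrier W \<Longrightarrow> g (elementary P v w) = f v w"
    and t: "t \<in> carrier T"
  from t obtain ps where ps: "set ps \<subseteq> carrier V \<times> carrier W" "t = (\<Sum>(v, w)\<leftarrow>ps. elementary P v w)"
    by (rule memE)
  have "0 \<in> carrier T"
    unfolding T by (rule tensor.span_zero)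
  then have "g (0 + 0) = g 0 + g 0"
    using g(1) unfolding linear_on_def by blast
  then have g0: "g 0 = 0" by simp
  have el: "elementary P v w \<in> carrier T" if "v \<in> carrier V" "w \<in> carrier W" for v w
    unfolding T using that by (auto intro: tensor.span_base)
  have "g (\<Sum>(v, w)\<leftarrow>ps. elementary P v w) = (\<Sum>(v, w)\<leftarrow>ps. f v w)"
    using ps(1)
  proof (induction ps)
    case Nil
    show ?case by (simp add: g0)
  next
    case (Cons x ps)
    moreover have "(\<Sum>(v, w)\<leftarrow>ps. elementary P v w) \<in> carrier T"
      using Cons.prems mem by auto
    ultimately show ?case
      using g el unfolding linear_on_def by (cases x) auto
  qed
  then show "g t = sweedler (elementary P) V W t f"
    using eq[OF ps(1)] ps(2) by simp
qed

lemma vspace_tensor: "vspace (V \<Otimes> W)"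
  by (simp add: vspace_def tensor_space_def vector_space_tscale)

lemma bilinear_tens: "bilinear_on V W (V \<Otimes> W) (tens V W)"
  unfolding bilinear_on_def linear_on_def
  by (auto simp: tensor_space_def tens_def bilinear_formD
      intro!: tensor_eqI intro: tensor.span_base)

theorem tensor_universal:
  assumes "vspace V" and "vspace W" and "vspace U" and "bilinear_on V W U f"
  shows "linear_on (V \<Otimes> W) U (\<lambda>t. tsum V W t f)"
    and "v \<in> carrier V \<Longrightarrow> w \<in> carrier W \<Longrightarrow> tsum V W (v \<otimes>\<^bsub>V,W\<^esub> w) f = f v w"
    and "linear_on (V \<Otimes> W) U g \<Longrightarrow>
      (\<And>v w. v \<in> carrier V \<Longrightarrow> w \<in> carrier W \<Longrightarrow> g (v \<otimes>\<^bsub>V,W\<^esub> w) = f v w) \<Longrightarrow>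
      t \<in> carrier (V \<Otimes> W) \<Longrightarrow> g t = tsum V W t f"
proof -
  note f = assms(4)
  have T: "carrier (V \<Otimes> W) = tensor.span
      {elementary (bilinear_form V W) v w | v w. v \<in> carrier V \<and> w \<in> carrier W}"
    "scale (V \<Otimes> W) = tscale"
    by (simp_all add: tensor_space_def tens_def)
  show "linear_on (V \<Otimes> W) U (\<lambda>t. tsum V W t f)"
    unfolding tsum_def tens_def
    by (rule elementary_universal(1)[OF assms(1-3), where P = "bilinear_form V W" and f = f and T = "V \<Otimes> W"])
      (assumption, fact f, erule bilinear_form_extend[OF assms(1,2) f], rule T, rule T)
  show "tsum V W (v \<otimes>\<^bsub>V,W\<^esub> w) f = f v w" if "v \<in> carrier V" "w \<in> carrier W"
    unfolding tsum_def tens_def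
    by (rule elementary_universal(2)[OF assms(1-3), where P = "bilinear_form V W" and f = f and T = "V \<Otimes> W"])
      (assumption, fact f, erule bilinear_form_extend[OF assms(1,2) f], rule T, rule T, fact that, fact that)
  show "g t = tsum V W t f"
    if "linear_on (V \<Otimes> W) U g"
      and "\<And>v w. v \<in> carrier V \<Longrightarrow> w \<in> carrier W \<Longrightarrow> g (v \<otimes>\<^bsub>V,W\<^esub> w) = f v w"
      and "t \<in> carrier (V \<Otimes> W)"
    unfolding tsum_def tens_def
    by (rule elementary_universal(3)[OF assms(1-3), where P = "bilinear_form V W" and f = f and T = "V \<Otimes> W"
          and g = g and t = t])
      (assumption, fact f, erule bilinear_form_extend[OF assms(1,2) f], rule T, rule T, fact that(1),
        erule that(2)[unfolded tens_def], assumption, fact that(3))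
qed

lemma vspace_balanced: "vspace (balanced_space H M N)"
  by (simp add: vspace_def balanced_space_def vector_space_tscale)

lemma bilinear_btens: "bilinear_on M N (balanced_space H M N) (btens H M N)"
  unfolding bilinear_on_def linear_on_def
  by (auto simp: balanced_space_def btens_def balanced_form_def bilinear_formD
      intro!: tensor_eqI intro: tensor.span_base)

lemma balanced_btens:
  assumes "m \<in> carrier M" and "h \<in> carrier H" and "n \<in> carrier N"
  shows "btens H M N (ract M m h) n = btens H M N m (lact N h n)"
  using assms by (auto simp: btens_def balanced_form_def intro!: tensor_eqI)

theorem balanced_universal:
  assumes "vspace M" and "vspace N" and "vspace U" and f: "bilinear_on M N U f"
    and closed: "\<And>m h. m \<in> carrier M \<Longrightarrow> h \<in> carrier H \<Longrightarrow> ract M m h \<in> carrier M"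
      "\<And>h n. h \<in> carrier H \<Longrightarrow> n \<in> carrier N \<Longrightarrow> lact N h n \<in> carrier N"
    and balanced: "\<And>m h n. m \<in> carrier M \<Longrightarrow> h \<in> carrier H \<Longrightarrow> n \<in> carrier N \<Longrightarrow>
      f (ract M m h) n = f m (lact N h n)"
  shows "linear_on (balanced_space H M N) U (\<lambda>t. bsum H M N t f)"
    and "m \<in> carrier M \<Longrightarrow> n \<in> carrier N \<Longrightarrow> bsum H M N (btens H M N m n) f = f m n"
    and "linear_on (balanced_space H M N) U g \<Longrightarrow>
      (\<And>m n. m \<in> carrier M \<Longrightarrow> n \<in> carrier N \<Longrightarrow> g (btens H M N m n) = f m n) \<Longrightarrow>
      t \<in> carrier (balanced_space H M N) \<Longrightarrow> g t = bsum H M N t f"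
proof -
  have *: "\<exists>\<beta>. balanced_form H M N \<beta> \<and> (\<forall>m\<in>carrier M. \<forall>n\<in>carrier N. \<beta> m n = \<phi> (f m n))"
    if "Vector_Spaces.linear (scale U) (*) \<phi>" for \<phi>
    using bilinear_form_extend[OF assms(1,2) f that] closed balanced
    unfolding balanced_form_def by metis
  have P: "bilinear_form M N \<beta>" if "balanced_form H M N \<beta>" for \<beta>
    using that by (simp add: balanced_form_def)
  have T: "carrier (balanced_space H M N) = tensor.span
      {elementary (balanced_form H M N) m n | m n. m \<in> carrier M \<and> n \<in> carrier N}"
    "scale (balanced_space H M N) = tscale"
    by (simp_all add: balanced_space_def btens_def)
  show "linear_on (balanced_space H M N) U (\<lambda>t. bsum H M N t f)"
    unfolding bsum_def btens_def
    by (rule elementary_universal(1)[OF assms(1-3), where P = "balanced_form H M N" and f = f and T = "balanced_space H M N"])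
      (erule P, fact f, erule *, rule T, rule T)
  show "bsum H M N (btens H M N m n) f = f m n" if "m \<in> carrier M" "n \<in> carrier N"
    unfolding bsum_def btens_def
    by (rule elementary_universal(2)[OF assms(1-3), where P = "balanced_form H M N" and f = f and T = "balanced_space H M N"])
      (erule P, fact f, erule *, rule T, rule T, fact that, fact that)
  show "g t = bsum H M N t f"
    if "linear_on (balanced_space H M N) U g"
      and "\<And>m n. m \<in> carrier M \<Longrightarrow> n \<in> carrier N \<Longrightarrow> g (btens H M N m n) = f m n"
      and "t \<in> carrier (balanced_space H M N)"
    unfolding bsum_def btens_def
    by (rule elementary_universal(3)[OF assms(1-3), where P = "balanced_form H M N" and f = f and T = "balanced_space H M N"
          and g = g and t = t])
      (erule P, fact f, erule *, rule T, rule T, fact that(1),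
        erule that(2)[unfolded btens_def], assumption, fact that(3))
qed

end

theory Submission
  imports Defs
begin

text \<open>
  A structure as in (a) amounts to a splitting as in (c): since \<open>A\<close> is a coalgebra in bicomodules, both
  coactions come from \<open>\<pi> a = \<Sum> \<epsilon>(a\<^sub>0) a\<^sub>1\<close>, and since the product is balanced over \<open>H\<close>, both
  actions are multiplication by \<open>\<sigma> h = 1 h\<close>. Given a splitting, \<open>\<tau> a = \<Sum> a\<^sub>0 \<sigma>(S a\<^sub>1)\<close> projects \<open>A\<close>
  onto the coinvariants \<open>R\<close>, and \<open>a = \<Sum> \<tau>(a\<^sub>0) \<sigma>(a\<^sub>1)\<close> yields the linear isomorphism \<open>A \<cong> R \<Otimes> H\<close>.
  With \<open>\<delta> a = \<Sum> \<tau>(a\<^sub>(\<^sub>1\<^sub>)) \<otimes> \<tau>(a\<^sub>(\<^sub>2\<^sub>))\<close> on all of \<open>A\<close> and \<open>\<omega> = \<delta> \<sigma>\<close>, the multiplicativity axioms of a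
  quadruple are all instances of \<open>\<delta>(a b) = \<Sum> \<delta>(a\<^sub>0) (a\<^sub>1 \<delta>(b))\<close>, with \<open>a\<^sub>1\<close> acting diagonally, for \<open>a\<close>
  in \<open>R\<close> or \<open>\<sigma> H\<close>; axioms 8 and 9 are coassociativity of \<open>A\<close> at \<open>r\<close> and at \<open>\<sigma> h\<close>. Conversely, a
  bosonization splits via \<open>r # h \<mapsto> \<epsilon>(r) h\<close> and \<open>h \<mapsto> 1 # h\<close>.
  Identities between tensors are checked on linear forms, so that all Sweedler sums are sums of scalars.
\<close>

section \<open>Sums over tensors\<close>

text \<open>\<open>\<sigma>\<close> is multiplicative and bicolinear but need not be
  comultiplicative, and \<open>\<omega>\<close> measures the defect: by \<open>tau_sigma\<close>,
  \<open>\<omega> h\<close> would be \<open>counit H h\<close> times the unit tensor if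
  \<open>\<sigma>\<close> were a coalgebra map. Right colinearity of \<open>\<sigma>\<close> makes
  the values of \<open>\<tau>\<close> coinvariant; left colinearity gives \<open>\<tau> a\<close>
  the left coaction a_{-1} S(a_1) \<otimes> \<tau>(a_0). The long computations share one pattern.
  The antipode in this coaction meets a neighbouring leg and cancels; the leg that survives is
  carried across a coproduct, because a right coaction on a_(1) and a left coaction on a_(2) both
  amount to applying \<open>\<pi>\<close> to the middle one of three legs. Scalar sums matter for a
  further reason. Evaluating a sum at an elementary tensor requires its summand to be bilinear into
  some space \<open>U\<close>, which the sum itself does not determine; for forms this space is
  always \<open>ground\<close>, so that evaluation and coassociativity can serve as rewrite
  rules.\<close>

text \<open>Unlike \<open>tsum\<close>, the sum \<open>ssum\<close> has only members of the carriers as summation indices, even for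
  junk arguments. Hence congruence, exchange of sums and additivity in the summand hold without
  side conditions; bilinearity is only needed to change the representation of a tensor.\<close>

definition rep ::
  "('k::field, 'v::ab_group_add, 'x) kspace_scheme \<Rightarrow> ('k, 'w::ab_group_add, 'y) kspace_scheme
    \<Rightarrow> ('k, 'v, 'w) tensor \<Rightarrow> ('v \<times> 'w) list" where
  "rep V W t =
     (let P = (\<lambda>ps. set ps \<subseteq> carrier V \<times> carrier W \<and> t = (\<Sum>(v, w)\<leftarrow>ps. v \<otimes>\<^bsub>V,W\<^esub> w))
      in if \<exists>ps. P ps then SOME ps. P ps else [])"

definition ssum ::
  "('k::field, 'v::ab_group_add, 'x) kspace_scheme \<Rightarrow> ('k, 'w::ab_group_add, 'y) kspace_scheme
    \<Rightarrow> ('k, 'v, 'w) tensor \<Rightarrow> ('v \<Rightarrow> 'w \<Rightarrow> 'u::ab_group_add) \<Rightarrow> 'u" where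
  "ssum V W t f = (\<Sum>(v, w)\<leftarrow>rep V W t. f v w)"

abbreviation csum ::
  "('k::field, 'v::ab_group_add, 'x) bialgebra_scheme \<Rightarrow> 'v
    \<Rightarrow> ('v \<Rightarrow> 'v \<Rightarrow> 'u::ab_group_add) \<Rightarrow> 'u" where
  "csum C c \<equiv> ssum C C (comult C c)"

abbreviation form :: "('k::field, 'v::ab_group_add, 'x) kspace_scheme \<Rightarrow> ('v \<Rightarrow> 'k) \<Rightarrow> bool" where
  "form V \<equiv> linear_on V ground"

abbreviation biform ::
  "('k::field, 'v::ab_group_add, 'x) kspace_scheme \<Rightarrow> ('k, 'w::ab_group_add, 'y) kspace_scheme
    \<Rightarrow> ('v \<Rightarrow> 'w \<Rightarrow> 'k) \<Rightarrow> bool" where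
  "biform V W \<equiv> bilinear_on V W ground"

definition triform ::
  "('k::field, 'u::ab_group_add, 'x) kspace_scheme \<Rightarrow> ('k, 'v::ab_group_add, 'y) kspace_scheme
    \<Rightarrow> ('k, 'w::ab_group_add, 'z) kspace_scheme \<Rightarrow> ('u \<Rightarrow> 'v \<Rightarrow> 'w \<Rightarrow> 'k) \<Rightarrow> bool" where
  "triform U V W G \<longleftrightarrow>
     (\<forall>u\<in>carrier U. biform V W (G u)) \<and> (\<forall>v\<in>carrier V. \<forall>w\<in>carrier W. form U (\<lambda>u. G u v w))"

section \<open>Subspaces and decompositions of tensors\<close>

lemma vspaceD:
  assumes "vspace V"
  shows "0 \<in> carrier V" and "u \<in> carrier V \<Longrightarrow> v \<in> carrier V \<Longrightarrow> u + v \<in> carrier V"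
    and "v \<in> carrier V \<Longrightarrow> scale V c v \<in> carrier V"
    and "scale V c (u + v) = scale V c u + scale V c v"
    and "scale V (c + d) v = scale V c v + scale V d v"
    and "scale V c (scale V d v) = scale V (c * d) v" and "scale V 1 v = v"
    and "scale V c 0 = 0"
proof -
  interpret vector_space "scale V" using assms by (simp add: vspace_def)
  have *: "subspace (carrier V)" using assms by (simp add: vspace_def)
  show "0 \<in> carrier V" "u \<in> carrier V \<Longrightarrow> v \<in> carrier V \<Longrightarrow> u + v \<in> carrier V"
    "v \<in> carrier V \<Longrightarrow> scale V c v \<in> carrier V"
    using * by (auto simp: subspace_def)
  show "scale V c (u + v) = scale V c u + scale V c v" "scale V (c + d) v = scale V c v + scale V d v"
    "scale V c (scale V d v) = scale V (c * d) v" "scale V 1 v = v" "scale V c 0 = 0"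
    by (simp_all add: scale_right_distrib scale_left_distrib)
qed

lemma vspace_ground [simp]: "vspace ground"
proof -
  interpret vector_space "(*) :: 'a \<Rightarrow> 'a \<Rightarrow> 'a" by (rule vector_space_mult)
  show ?thesis by (simp add: vspace_def ground_def vector_space_mult subspace_UNIV)
qed

lemma ground_simps [simp]: "carrier ground = UNIV" "scale ground = (*)"
  by (simp_all add: ground_def)

declare vspace_tensor [simp]

lemma scale_tensor_space [simp]: "scale (V \<Otimes> W) = tscale"
  by (simp add: tensor_space_def)

lemma tens_closed [simp]:
  "v \<in> carrier V \<Longrightarrow> w \<in> carrier W \<Longrightarrow> v \<otimes>\<^bsub>V,W\<^esub> w \<in> carrier (V \<Otimes> W)"
  using bilinear_tens[of V W] by (auto simp: bilinear_on_def linear_on_def)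

lemma tens_cong: "scale V = scale V' \<Longrightarrow> scale W = scale W' \<Longrightarrow> tens V W = tens V' W'"
  unfolding tens_def bilinear_form_def by simp

lemma tensor_space_cong:
  "carrier V = carrier V' \<Longrightarrow> scale V = scale V' \<Longrightarrow> carrier W = carrier W' \<Longrightarrow> scale W = scale W'
    \<Longrightarrow> V \<Otimes> W = V' \<Otimes> W'"
  by (simp add: tensor_space_def tens_cong[of V V' W W'])

lemma tsum_cong_space:
  "carrier V = carrier V' \<Longrightarrow> scale V = scale V' \<Longrightarrow> carrier W = carrier W' \<Longrightarrow> scale W = scale W'
    \<Longrightarrow> tsum V W = tsum V' W'"
  by (simp add: fun_eq_iff tsum_def sweedler_def tens_cong[of V V' W W'])

lemma tensor_space_mono:
  "carrier V \<subseteq> carrier V' \<Longrightarrow> scale V = scale V' \<Longrightarrow> carrier W \<subseteq> carrier W' \<Longrightarrow> scale W = scale W'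
    \<Longrightarrow> carrier (V \<Otimes> W) \<subseteq> carrier (V' \<Otimes> W')"
  unfolding tensor_space_def kspace.simps using tens_cong[of V V' W W']
  by (intro tensor.span_mono) (smt (verit) Collect_mono subsetD)

lemma linear_on_cong_space:
  "carrier V = carrier V' \<Longrightarrow> scale V = scale V' \<Longrightarrow> carrier W = carrier W' \<Longrightarrow> scale W = scale W'
    \<Longrightarrow> linear_on V W = linear_on V' W'"
  by (simp add: linear_on_def fun_eq_iff)

lemma mem_tensor_space:
  assumes "vspace V"
  shows "t \<in> carrier (V \<Otimes> W) \<longleftrightarrow>
    (\<exists>ps. set ps \<subseteq> carrier V \<times> carrier W \<and> t = (\<Sum>(v, w)\<leftarrow>ps. v \<otimes>\<^bsub>V,W\<^esub> w))"
  using span_elementary[OF assms, of "bilinear_form V W" W] by (simp add: tensor_space_def tens_def)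

lemma rep_subset: "set (rep V W t) \<subseteq> carrier V \<times> carrier W"
proof (cases "\<exists>ps. set ps \<subseteq> carrier V \<times> carrier W \<and> t = (\<Sum>(v, w)\<leftarrow>ps. v \<otimes>\<^bsub>V,W\<^esub> w)")
  case True
  from someI_ex[OF this] True show ?thesis by (simp add: rep_def Let_def)
next
  case False
  then show ?thesis by (auto simp: rep_def Let_def)
qed

text \<open>Both sides choose a list by the same predicate, which is satisfiable for members of the
  tensor space; there the default \<open>[]\<close> of \<open>rep\<close> is not reached.\<close>

lemma tsum_ssum:
  "vspace V \<Longrightarrow> t \<in> carrier (V \<Otimes> W) \<Longrightarrow> tsum V W t f = ssum V W t f"
  by (auto simp: mem_tensor_space tsum_def sweedler_def ssum_def rep_def Let_def)

text \<open>As a congruence rule it hands the membership of the summation indices to the simplifier,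
  so that conditional rules can fire inside nested sums.\<close>

lemma ssum_cong [cong]:
  assumes "t = t'" and "\<And>v w. v \<in> carrier V \<Longrightarrow> w \<in> carrier W \<Longrightarrow> f v w = g v w"
  shows "ssum V W t f = ssum V W t' g"
proof -
  have "map (\<lambda>(v, w). f v w) (rep V W t') = map (\<lambda>(v, w). g v w) (rep V W t')"
    using rep_subset[of V W t'] assms(2) by (auto intro!: map_cong)
  then show ?thesis unfolding ssum_def assms(1) by (rule arg_cong)
qed

lemma ssum_closed:
  assumes "vspace U" and "\<And>v w. v \<in> carrier V \<Longrightarrow> w \<in> carrier W \<Longrightarrow> f v w \<in> carrier U"
  shows "ssum V W t f \<in> carrier U"
proof -
  have "(\<Sum>(v, w)\<leftarrow>ps. f v w) \<in> carrier U" if "set ps \<subseteq> carrier V \<times> carrier W" for ps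
    using that by (induction ps) (auto intro!: vspaceD[OF assms(1)] assms(2))
  then show ?thesis by (simp add: ssum_def rep_subset)
qed

lemma ssum_swap:
  "ssum V W t (\<lambda>v w. ssum V' W' t' (f v w)) = ssum V' W' t' (\<lambda>v' w'. ssum V W t (\<lambda>v w. f v w v' w'))"
proof -
  have "(\<Sum>(v, w)\<leftarrow>ps. \<Sum>(v', w')\<leftarrow>qs. f v w v' w') = (\<Sum>(v', w')\<leftarrow>qs. \<Sum>(v, w)\<leftarrow>ps. f v w v' w')" for ps qs
  proof (induction ps)
    case Nil
    show ?case by (induction qs) auto
  next
    case (Cons p ps)
    show ?case
      using Cons.IH sum_list_addf[of "\<lambda>(v', w'). f (fst p) (snd p) v' w'"
          "\<lambda>(v', w'). \<Sum>(v, w)\<leftarrow>ps. f v w v' w'" qs]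
      by (simp add: split_def)
  qed
  then show ?thesis by (simp add: ssum_def)
qed

lemma linear_zero:
  assumes "linear_on U Z L" and "vspace U"
  shows "L 0 = 0"
proof -
  have "L (0 + 0) = L 0 + L 0"
    using assms vspaceD(1) unfolding linear_on_def by blast
  then show ?thesis by simp
qed

lemma linear_closed: "linear_on U Z L \<Longrightarrow> u \<in> carrier U \<Longrightarrow> L u \<in> carrier Z"
  by (simp add: linear_on_def)

lemma linear_scale: "linear_on U Z L \<Longrightarrow> u \<in> carrier U \<Longrightarrow> L (scale U c u) = scale Z c (L u)"
  by (simp add: linear_on_def)

lemma linear_add: "linear_on U Z L \<Longrightarrow> u \<in> carrier U \<Longrightarrow> v \<in> carrier U \<Longrightarrow> L (u + v) = L u + L v"
  by (simp add: linear_on_def)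

lemma linear_ssum:
  assumes L: "linear_on U Z L" and U: "vspace U"
    and f: "\<And>v w. v \<in> carrier V \<Longrightarrow> w \<in> carrier W \<Longrightarrow> f v w \<in> carrier U"
  shows "L (ssum V W t f) = ssum V W t (\<lambda>v w. L (f v w))"
proof -
  have "(\<Sum>(v, w)\<leftarrow>ps. f v w) \<in> carrier U \<and>
      L (\<Sum>(v, w)\<leftarrow>ps. f v w) = (\<Sum>(v, w)\<leftarrow>ps. L (f v w))" if "set ps \<subseteq> carrier V \<times> carrier W" for ps
    using that
    by (induction ps) (auto simp: linear_zero[OF L U] linear_add[OF L] f intro!: vspaceD[OF U])
  then show ?thesis by (simp add: ssum_def rep_subset)
qed

lemma ssum_tens:
  assumes "bilinear_on V W U f" and "vspace V" and "vspace W" and "vspace U"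
    and "v \<in> carrier V" and "w \<in> carrier W"
  shows "ssum V W (v \<otimes>\<^bsub>V,W\<^esub> w) f = f v w"
  using tensor_universal(2)[OF assms(2-4,1,5,6)] assms by (simp add: tsum_ssum)

lemma linear_ssum_arg:
  assumes "bilinear_on V W U f" and "vspace V" and "vspace W" and "vspace U"
  shows "linear_on (V \<Otimes> W) U (\<lambda>t. ssum V W t f)"
  using tensor_universal(1)[OF assms(2-4,1)] assms(2)
  by (simp add: linear_on_def tsum_ssum vspaceD[OF vspace_tensor, unfolded scale_tensor_space])

lemma ssum_tens_self: "vspace V \<Longrightarrow> t \<in> carrier (V \<Otimes> W) \<Longrightarrow> ssum V W t (tens V W) = t"
proof -
  assume "vspace V" and "t \<in> carrier (V \<Otimes> W)"
  then have *: "\<exists>ps. set ps \<subseteq> carrier V \<times> carrier W \<and> t = (\<Sum>(v, w)\<leftarrow>ps. v \<otimes>\<^bsub>V,W\<^esub> w)"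
    by (simp add: mem_tensor_space)
  from someI_ex[OF this] show ?thesis
    by (simp only: ssum_def rep_def Let_def if_P[OF *])
qed

lemma ssum_tens_self' [simp]: "vspace V \<Longrightarrow> t \<in> carrier (V \<Otimes> W) \<Longrightarrow> ssum V W t (\<lambda>x. tens V W x) = t"
  by (rule ssum_tens_self)

section \<open>Separation of vectors by linear forms\<close>

lemma form_eqI:
  assumes U: "vspace U" and mem: "x \<in> carrier U" "y \<in> carrier U"
    and eq: "\<And>\<phi>. form U \<phi> \<Longrightarrow> \<phi> x = \<phi> y"
  shows "x = y"
proof (rule ccontr)
  assume "x \<noteq> y"
  then have "x - y \<noteq> 0" by simp
  then obtain \<phi> where \<phi>: "Vector_Spaces.linear (scale U) (*) \<phi>" "\<phi> (x - y) \<noteq> 0"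
    using separating_functional[of "scale U" "x - y"] U unfolding vspace_def by metis
  interpret Vector_Spaces.linear "scale U" "(*)" \<phi> by fact
  have "form U \<phi>" by (simp add: linear_on_def add scale)
  with eq \<phi>(2) show False by (simp add: diff)
qed

lemma linear_eq_tensor:
  assumes "linear_on (V \<Otimes> W) U f" and "linear_on (V \<Otimes> W) U g" and "vspace V"
    and "\<And>v w. v \<in> carrier V \<Longrightarrow> w \<in> carrier W \<Longrightarrow> f (v \<otimes>\<^bsub>V,W\<^esub> w) = g (v \<otimes>\<^bsub>V,W\<^esub> w)"
    and "t \<in> carrier (V \<Otimes> W)"
  shows "f t = g t"
proof -
  have "f (ssum V W t (tens V W)) = ssum V W t (\<lambda>v w. f (v \<otimes>\<^bsub>V,W\<^esub> w))"
    by (rule linear_ssum[OF assms(1)]) auto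
  also have "\<dots> = ssum V W t (\<lambda>v w. g (v \<otimes>\<^bsub>V,W\<^esub> w))"
    by (simp add: assms(4))
  also have "\<dots> = g (ssum V W t (tens V W))"
    by (rule linear_ssum[OF assms(2), symmetric]) auto
  finally show ?thesis using assms by (simp add: ssum_tens_self)
qed

subsection \<open>Linearity rules\<close>

text \<open>Keeps the simplifier out of the function. Its bound variable carries no membership
  assumption, so rewriting there would apply only some of the conditional rules and spoil the shape
  on which the linearity rules match.\<close>

lemma linear_on_weak_cong [cong]:
  "U = U' \<Longrightarrow> V = V' \<Longrightarrow> linear_on U V f = linear_on U' V' f"
  by simp

lemma linear_ident [simp]: "linear_on U U (\<lambda>x. x)"
  by (simp add: linear_on_def)

lemma linear_compose:
  "linear_on V W f \<Longrightarrow> linear_on U V g \<Longrightarrow> linear_on U W (\<lambda>x. f (g x))"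
  by (simp add: linear_on_def)

lemma bilinear_compose1:
  "bilinear_on V W Z b \<Longrightarrow> linear_on U V g \<Longrightarrow> w \<in> carrier W \<Longrightarrow> linear_on U Z (\<lambda>x. b (g x) w)"
  by (simp add: linear_on_def bilinear_on_def)

lemma bilinear_compose2:
  "bilinear_on V W Z b \<Longrightarrow> linear_on U W g \<Longrightarrow> v \<in> carrier V \<Longrightarrow> linear_on U Z (\<lambda>x. b v (g x))"
  by (simp add: linear_on_def bilinear_on_def)

lemmas bilinear_rules = bilinear_compose1 bilinear_compose2

lemmas linear_tens [simp] = bilinear_rules[OF bilinear_tens]

lemma linear_scale_left [simp]:
  "vspace V \<Longrightarrow> form U f \<Longrightarrow> v \<in> carrier V \<Longrightarrow> linear_on U V (\<lambda>x. scale V (f x) v)"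
  by (simp add: linear_on_def vspaceD)

lemma linear_scale_right [simp]:
  "vspace V \<Longrightarrow> linear_on U V f \<Longrightarrow> linear_on U V (\<lambda>x. scale V c (f x))"
  by (simp add: linear_on_def vspaceD mult.commute)

lemma form_mult [simp]:
  "form U f \<Longrightarrow> form U (\<lambda>x. f x * c)" "form U f \<Longrightarrow> form U (\<lambda>x. c * f x)"
  by (simp_all add: linear_on_def algebra_simps)

text \<open>A sum can depend on \<open>x\<close> through its summand or through its tensor. This
  rule treats the first case, \<open>linear_ssum_compose\<close> the second.\<close>

lemma linear_ssum_body [simp]:
  assumes "vspace U" and "vspace Z"
    and f: "\<And>v w. v \<in> carrier V \<Longrightarrow> w \<in> carrier W \<Longrightarrow> linear_on U Z (\<lambda>x. f x v w)"
  shows "linear_on U Z (\<lambda>x. ssum V W t (f x))"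
proof -
  have *: "linear_on U Z (\<lambda>x. \<Sum>(v, w)\<leftarrow>ps. f x v w)" if "set ps \<subseteq> carrier V \<times> carrier W" for ps
    using that
  proof (induction ps)
    case Nil
    show ?case by (simp add: linear_on_def vspaceD[OF assms(2)])
  next
    case (Cons p ps)
    then have "linear_on U Z (\<lambda>x. f x (fst p) (snd p))" "linear_on U Z (\<lambda>x. \<Sum>(v, w)\<leftarrow>ps. f x v w)"
      by (auto intro: f)
    then show ?case
      by (auto simp: linear_on_def split_def intro: vspaceD[OF assms(2)] simp: vspaceD[OF assms(2)])
  qed
  show ?thesis unfolding ssum_def by (rule *[OF rep_subset])
qed

lemma linear_ssum_compose [simp]:
  "linear_on U (V \<Otimes> W) g \<Longrightarrow> vspace V \<Longrightarrow> vspace W \<Longrightarrow> vspace Z \<Longrightarrow> bilinear_on V W Z f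
    \<Longrightarrow> linear_on U Z (\<lambda>x. ssum V W (g x) f)"
  by (rule linear_compose[OF linear_ssum_arg])

lemma bilinear_on_simp [simp]:
  "bilinear_on V W U b \<longleftrightarrow>
     (\<forall>v\<in>carrier V. linear_on W U (\<lambda>w. b v w)) \<and> (\<forall>w\<in>carrier W. linear_on V U (\<lambda>v. b v w))"
  by (simp add: bilinear_on_def)

lemma ssum_mult [simp]:
  fixes c :: "'k::field"
  shows "ssum V W t (\<lambda>v w. c * f v w) = c * ssum V W t f"
    and "ssum V W t (\<lambda>v w. f v w * c) = ssum V W t f * c"
proof -
  have "(\<Sum>(v, w)\<leftarrow>ps. c * f v w) = c * (\<Sum>(v, w)\<leftarrow>ps. f v w) \<and>
    (\<Sum>(v, w)\<leftarrow>ps. f v w * c) = (\<Sum>(v, w)\<leftarrow>ps. f v w) * c" for ps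
    by (induction ps) (auto simp: algebra_simps)
  then show "ssum V W t (\<lambda>v w. c * f v w) = c * ssum V W t f"
    "ssum V W t (\<lambda>v w. f v w * c) = ssum V W t f * c"
    by (simp_all add: ssum_def)
qed

lemma tens_ssum1 [simp]:
  "vspace V \<Longrightarrow> w \<in> carrier W \<Longrightarrow> (\<And>a b. a \<in> carrier X \<Longrightarrow> b \<in> carrier Y \<Longrightarrow> f a b \<in> carrier V)
    \<Longrightarrow> ssum X Y t f \<otimes>\<^bsub>V,W\<^esub> w = ssum X Y t (\<lambda>a b. f a b \<otimes>\<^bsub>V,W\<^esub> w)"
  by (rule linear_ssum[where L = "\<lambda>v. v \<otimes>\<^bsub>V,W\<^esub> w", OF linear_tens(1)[OF linear_ident]])

lemma tens_ssum2 [simp]: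
  "vspace W \<Longrightarrow> v \<in> carrier V \<Longrightarrow> (\<And>a b. a \<in> carrier X \<Longrightarrow> b \<in> carrier Y \<Longrightarrow> f a b \<in> carrier W)
    \<Longrightarrow> v \<otimes>\<^bsub>V,W\<^esub> ssum X Y t f = ssum X Y t (\<lambda>a b. v \<otimes>\<^bsub>V,W\<^esub> f a b)"
  by (rule linear_ssum[where L = "\<lambda>w. v \<otimes>\<^bsub>V,W\<^esub> w", OF linear_tens(2)[OF linear_ident]])

lemma form_ssum_tens [simp]:
  fixes f :: "_ \<Rightarrow> _ \<Rightarrow> 'k::field"
  shows "biform V W f \<Longrightarrow> vspace V \<Longrightarrow> vspace W \<Longrightarrow> v \<in> carrier V \<Longrightarrow> w \<in> carrier W
    \<Longrightarrow> ssum V W (v \<otimes>\<^bsub>V,W\<^esub> w) f = f v w"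
  by (rule ssum_tens[where U = ground]) simp_all

lemma form_ssum_ssum [simp]:
  fixes f :: "_ \<Rightarrow> _ \<Rightarrow> 'k::field"
  shows "biform V W f \<Longrightarrow> vspace V \<Longrightarrow> vspace W
    \<Longrightarrow> (\<And>a b. a \<in> carrier X \<Longrightarrow> b \<in> carrier Y \<Longrightarrow> g a b \<in> carrier (V \<Otimes> W))
    \<Longrightarrow> ssum V W (ssum X Y t g) f = ssum X Y t (\<lambda>a b. ssum V W (g a b) f)"
  by (rule linear_ssum[where L = "\<lambda>s. ssum V W s f", OF linear_ssum_arg[where U = ground]])
    (simp_all only: vspace_ground vspace_tensor)

section \<open>The associator and threefold tensors\<close>

lemma linear_tensor_assoc:
  assumes "vspace U" and "vspace V" and "vspace W"
  shows "linear_on ((U \<Otimes> V) \<Otimes> W) (U \<Otimes> (V \<Otimes> W)) (tensor_assoc U V W)"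
    and "u \<in> carrier U \<Longrightarrow> v \<in> carrier V \<Longrightarrow> w \<in> carrier W \<Longrightarrow>
      tensor_assoc U V W ((u \<otimes>\<^bsub>U,V\<^esub> v) \<otimes>\<^bsub>U \<Otimes> V,W\<^esub> w) = u \<otimes>\<^bsub>U,V \<Otimes> W\<^esub> (v \<otimes>\<^bsub>V,W\<^esub> w)"
proof -
  let ?g = "\<lambda>t. ssum (U \<Otimes> V) W t (\<lambda>s w. ssum U V s (\<lambda>u v. u \<otimes>\<^bsub>U, V \<Otimes> W\<^esub> (v \<otimes>\<^bsub>V,W\<^esub> w)))"
  have eq: "tensor_assoc U V W t = ?g t" if "t \<in> carrier ((U \<Otimes> V) \<Otimes> W)" for t
    using that assms by (simp add: tensor_assoc_def tsum_ssum)
  have lin: "linear_on ((U \<Otimes> V) \<Otimes> W) (U \<Otimes> (V \<Otimes> W)) ?g"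
    using assms by simp
  then show "linear_on ((U \<Otimes> V) \<Otimes> W) (U \<Otimes> (V \<Otimes> W)) (tensor_assoc U V W)"
    using vspaceD[OF vspace_tensor[of "U \<Otimes> V" W]] unfolding linear_on_def by (auto simp: eq)
  assume "u \<in> carrier U" "v \<in> carrier V" "w \<in> carrier W"
  then show "tensor_assoc U V W ((u \<otimes>\<^bsub>U,V\<^esub> v) \<otimes>\<^bsub>U \<Otimes> V,W\<^esub> w) = u \<otimes>\<^bsub>U,V \<Otimes> W\<^esub> (v \<otimes>\<^bsub>V,W\<^esub> w)"
    using assms by (simp add: eq ssum_tens[where U = "U \<Otimes> (V \<Otimes> W)"])
qed

lemma tensor_assoc_closed [simp]:
  "vspace U \<Longrightarrow> vspace V \<Longrightarrow> vspace W \<Longrightarrow> t \<in> carrier ((U \<Otimes> V) \<Otimes> W)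
    \<Longrightarrow> tensor_assoc U V W t \<in> carrier (U \<Otimes> (V \<Otimes> W))"
  by (rule linear_closed[OF linear_tensor_assoc(1)])

text \<open>Under a trilinear form the associator merely renests the sums, so it disappears from all
  scalar computations. Both sides are linear in \<open>t\<close>; reducing to elementary tensors
  twice, in the outer and in the inner product, leaves one value of \<open>G\<close>.\<close>

lemma form_tensor_assoc:
  assumes "vspace U" and "vspace V" and "vspace W" and G: "triform U V W G"
    and t: "t \<in> carrier ((U \<Otimes> V) \<Otimes> W)"
  shows "ssum U (V \<Otimes> W) (tensor_assoc U V W t) (\<lambda>u p. ssum V W p (\<lambda>v w. G u v w))
    = ssum (U \<Otimes> V) W t (\<lambda>p w. ssum U V p (\<lambda>u v. G u v w))"
proof (rule linear_eq_tensor[OF _ _ _ _ t, where U = ground])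
  note [simp] = linear_compose[OF linear_tensor_assoc(1)] linear_tensor_assoc(2)
  show "form ((U \<Otimes> V) \<Otimes> W) (\<lambda>t. ssum U (V \<Otimes> W) (tensor_assoc U V W t) (\<lambda>u p. ssum V W p (\<lambda>v w. G u v w)))"
    and "form ((U \<Otimes> V) \<Otimes> W) (\<lambda>t. ssum (U \<Otimes> V) W t (\<lambda>p w. ssum U V p (\<lambda>u v. G u v w)))"
    using assms(1-4) by (simp_all add: triform_def)
  fix p w assume pw: "p \<in> carrier (U \<Otimes> V)" "w \<in> carrier W"
  show "ssum U (V \<Otimes> W) (tensor_assoc U V W (p \<otimes>\<^bsub>U \<Otimes> V,W\<^esub> w)) (\<lambda>u p. ssum V W p (\<lambda>v w. G u v w))
    = ssum (U \<Otimes> V) W (p \<otimes>\<^bsub>U \<Otimes> V,W\<^esub> w) (\<lambda>p w. ssum U V p (\<lambda>u v. G u v w))"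
  proof (rule linear_eq_tensor[OF _ _ _ _ pw(1), where U = ground])
    show "form (U \<Otimes> V) (\<lambda>p. ssum U (V \<Otimes> W) (tensor_assoc U V W (p \<otimes>\<^bsub>U \<Otimes> V,W\<^esub> w)) (\<lambda>u p. ssum V W p (\<lambda>v w. G u v w)))"
      and "form (U \<Otimes> V) (\<lambda>p. ssum (U \<Otimes> V) W (p \<otimes>\<^bsub>U \<Otimes> V,W\<^esub> w) (\<lambda>p w. ssum U V p (\<lambda>u v. G u v w)))"
      using assms(1-4) pw by (simp_all add: triform_def)
  qed (use assms pw in \<open>simp_all add: triform_def\<close>)
qed simp

text \<open>A linear form on the threefold product is determined by its values on u \<otimes> (v
  \<otimes> w), and these are trilinear in the three factors. Hence trilinear forms separate
  threefold tensors.\<close>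

lemma tensor3_eqI:
  assumes "vspace U" and "vspace V" and "vspace W"
    and s: "s \<in> carrier (U \<Otimes> (V \<Otimes> W))" and t: "t \<in> carrier (U \<Otimes> (V \<Otimes> W))"
    and eq: "\<And>G. triform U V W G \<Longrightarrow>
      ssum U (V \<Otimes> W) s (\<lambda>u p. ssum V W p (\<lambda>v w. G u v w)) = ssum U (V \<Otimes> W) t (\<lambda>u p. ssum V W p (\<lambda>v w. G u v w))"
  shows "s = t"
proof (rule form_eqI[OF _ s t])
  fix \<phi> assume \<phi>: "form (U \<Otimes> (V \<Otimes> W)) \<phi>"
  note [simp] = linear_compose[OF \<phi>]
  define G where "G = (\<lambda>u v w. \<phi> (u \<otimes>\<^bsub>U,V \<Otimes> W\<^esub> (v \<otimes>\<^bsub>V,W\<^esub> w)))"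
  have *: "\<phi> t = ssum U (V \<Otimes> W) t (\<lambda>u p. ssum V W p (\<lambda>v w. G u v w))"
    if "t \<in> carrier (U \<Otimes> (V \<Otimes> W))" for t
  proof (rule linear_eq_tensor[OF \<phi> _ _ _ that])
    fix u p assume up: "u \<in> carrier U" "p \<in> carrier (V \<Otimes> W)"
    show "\<phi> (u \<otimes>\<^bsub>U,V \<Otimes> W\<^esub> p) = ssum U (V \<Otimes> W) (u \<otimes>\<^bsub>U,V \<Otimes> W\<^esub> p) (\<lambda>u p. ssum V W p (\<lambda>v w. G u v w))"
      by (rule linear_eq_tensor[OF _ _ _ _ up(2), where U = ground])
        (use up assms(1-3) in \<open>simp_all add: G_def\<close>)
  qed (use assms in \<open>simp_all add: G_def\<close>)
  show "\<phi> s = \<phi> t"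
    using eq[of G] *[OF s] *[OF t] assms by (simp add: G_def triform_def)
qed simp

lemma triform_compose:
  assumes "triform U V W G"
  shows "linear_on X U g \<Longrightarrow> v \<in> carrier V \<Longrightarrow> w \<in> carrier W \<Longrightarrow> form X (\<lambda>x. G (g x) v w)"
    and "linear_on X V g' \<Longrightarrow> u \<in> carrier U \<Longrightarrow> w \<in> carrier W \<Longrightarrow> form X (\<lambda>x. G u (g' x) w)"
    and "linear_on X W g'' \<Longrightarrow> u \<in> carrier U \<Longrightarrow> v \<in> carrier V \<Longrightarrow> form X (\<lambda>x. G u v (g'' x))"
  using assms by (simp_all add: triform_def linear_on_def)

lemma biform_ssum:
  assumes G: "bilinear_on V W ground G" and "vspace V" and "vspace W"
  shows "w \<in> carrier W \<Longrightarrow> (\<And>x y. x \<in> carrier X \<Longrightarrow> y \<in> carrier Y \<Longrightarrow> f x y \<in> carrier V)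
      \<Longrightarrow> G (ssum X Y t f) w = ssum X Y t (\<lambda>x y. G (f x y) w)"
    and "v \<in> carrier V \<Longrightarrow> (\<And>x y. x \<in> carrier X \<Longrightarrow> y \<in> carrier Y \<Longrightarrow> g x y \<in> carrier W)
      \<Longrightarrow> G v (ssum X Y t g) = ssum X Y t (\<lambda>x y. G v (g x y))"
  by (rule linear_ssum[OF bilinear_compose1[OF G linear_ident] assms(2)]; simp)
    (rule linear_ssum[OF bilinear_compose2[OF G linear_ident] assms(3)]; simp)

lemmas form_rules = linear_compose linear_ssum

lemma form_tensor:
  assumes "form (V \<Otimes> W) \<phi>" and "vspace V" and "t \<in> carrier (V \<Otimes> W)"
  shows "\<phi> t = ssum V W t (\<lambda>v w. \<phi> (v \<otimes>\<^bsub>V,W\<^esub> w))"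
  using linear_ssum[OF assms(1) vspace_tensor, where f = "tens V W" and t = t and V = V and W = W] assms
  by simp

text \<open>Elementary tensors do not depend on the carriers, so a decomposition over the subspaces
  is also one over the larger spaces, and bilinearity on the latter makes the two choices agree.
  This lets sums over the diagram be computed in the whole bialgebra.\<close>

lemma ssum_subspace:
  assumes sub: "carrier V \<subseteq> carrier V'" "carrier W \<subseteq> carrier W'"
    and sc: "scale V = scale V'" "scale W = scale W'"
    and vs: "vspace V" "vspace V'" "vspace W" "vspace W'" "vspace U"
    and f: "bilinear_on V' W' U f" and t: "t \<in> carrier (V \<Otimes> W)"
  shows "ssum V W t f = ssum V' W' t f"
proof -
  have eq: "tens V W = tens V' W'" by (rule tens_cong[OF sc])
  have mem: "v \<in> carrier V \<Longrightarrow> v \<in> carrier V'" "w \<in> carrier W \<Longrightarrow> w \<in> carrier W'" for v w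
    using sub by auto
  have "t = ssum V W t (tens V' W')"
    using ssum_tens_self[OF vs(1) t] by (simp add: eq)
  then have "ssum V' W' t f = ssum V' W' (ssum V W t (\<lambda>v w. v \<otimes>\<^bsub>V',W'\<^esub> w)) f"
    by simp
  also have "\<dots> = ssum V W t (\<lambda>v w. ssum V' W' (v \<otimes>\<^bsub>V',W'\<^esub> w) f)"
    by (rule linear_ssum[OF linear_ssum_arg[OF f vs(2,4,5)]]) (simp_all add: mem)
  also have "\<dots> = ssum V W t f"
    using ssum_tens[OF f vs(2,4,5)] mem by simp
  finally show ?thesis by simp
qed

lemma linear_on_restrict:
  assumes "linear_on V W f" and "carrier V' \<subseteq> carrier V" and "scale V' = scale V" and "scale W' = scale W"
    and "\<And>v. v \<in> carrier V' \<Longrightarrow> f v \<in> carrier W'"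
  shows "linear_on V' W' f"
  using assms by (auto simp: linear_on_def subset_iff)

lemma linear_on_eqI:
  assumes "linear_on V W g" and "vspace V" and "\<And>v. v \<in> carrier V \<Longrightarrow> f v = g v"
  shows "linear_on V W f"
  using assms vspaceD(2,3)[OF assms(2)] by (simp add: linear_on_def)

text \<open>Bimodule and bicomodule records carry their own copies of carrier and scaling. Tensors,
  tensor spaces and linearity depend on these two fields only, so everything is rewritten to the
  underlying space \<open>A\<close>.\<close>

locale same_space =
  fixes A :: "('k::field, 'a::ab_group_add, 'x) kspace_scheme" and M :: "('k, 'a, 'y) kspace_scheme"
  assumes same_space [simp]: "carrier M = carrier A" "scale M = scale A"
begin

lemma same_space_simps [simp]:
  "tens M X = tens A X" "tens Y M = tens Y A"
  "M \<Otimes> X = A \<Otimes> X" "Y \<Otimes> M = Y \<Otimes> A"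
  "tsum M X = tsum A X" "tsum Y M = tsum Y A"
  "linear_on M X = linear_on A X" "linear_on Y M = linear_on Y A"
  "vspace M = vspace A"
  by (rule tens_cong tensor_space_cong linear_on_cong_space tsum_cong_space; simp)+
    (simp add: vspace_def)

lemma same_space_assoc [simp]:
  "tensor_assoc M X Y = tensor_assoc A X Y" "tensor_assoc X M Y = tensor_assoc X A Y"
  "tensor_assoc X Y M = tensor_assoc X Y A"
  by (simp_all add: fun_eq_iff tensor_assoc_def)

end

lemma linear_eq_balanced:
  assumes f: "linear_on (balanced_space H M N) U f" and g: "linear_on (balanced_space H M N) U g"
    and M: "vspace M"
    and eq: "\<And>m n. m \<in> carrier M \<Longrightarrow> n \<in> carrier N \<Longrightarrow> f (btens H M N m n) = g (btens H M N m n)"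
    and t: "t \<in> carrier (balanced_space H M N)"
  shows "f t = g t"
proof -
  note vs = vspace_balanced[of H M N]
  have "\<exists>ps. set ps \<subseteq> carrier M \<times> carrier N \<and> t = (\<Sum>(m, n)\<leftarrow>ps. btens H M N m n)"
    using t span_elementary[OF M, where P = "balanced_form H M N" and W = N]
    by (simp add: balanced_space_def btens_def balanced_form_def)
  then obtain ps where ps: "set ps \<subseteq> carrier M \<times> carrier N" "t = (\<Sum>(m, n)\<leftarrow>ps. btens H M N m n)"
    by blast
  have btens_closed: "btens H M N m n \<in> carrier (balanced_space H M N)"
    if "m \<in> carrier M" "n \<in> carrier N" for m n
    using bilinear_btens[of M N H] that by (auto simp: linear_on_def simp del: balanced_space_def)
  have "(\<Sum>(m, n)\<leftarrow>ps. btens H M N m n) \<in> carrier (balanced_space H M N) \<and>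
     f (\<Sum>(m, n)\<leftarrow>ps. btens H M N m n) = g (\<Sum>(m, n)\<leftarrow>ps. btens H M N m n)"
    using ps(1)
  proof (induction ps)
    case Nil
    show ?case by (simp add: linear_zero[OF f vs] linear_zero[OF g vs] vspaceD(1)[OF vs])
  next
    case (Cons p ps)
    then show ?case
      by (cases p) (simp add: linear_add[OF f] linear_add[OF g] btens_closed eq vspaceD(2)[OF vs])
  qed
  then show ?thesis by (simp add: ps(2))
qed

section \<open>Bialgebras\<close>

locale algebra_on =
  fixes B :: "('k::field, 'v::ab_group_add, 'x) algebra_scheme" (structure)
  assumes algebra: "is_algebra B"
begin

lemma vspace [simp]: "vspace B"
  using algebra by (simp add: is_algebra_def)

lemma mult_bilinear: "bilinear_on B B B (mult B)"
  using algebra unfolding is_algebra_def by blast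

lemma mult_closed [simp]: "a \<in> carrier B \<Longrightarrow> b \<in> carrier B \<Longrightarrow> a \<cdot> b \<in> carrier B"
  using mult_bilinear by (simp add: linear_on_def)

lemma unit_closed [simp]: "\<one> \<in> carrier B"
  using algebra by (simp add: is_algebra_def)

lemma mult_assoc [simp]:
  "a \<in> carrier B \<Longrightarrow> b \<in> carrier B \<Longrightarrow> c \<in> carrier B \<Longrightarrow> (a \<cdot> b) \<cdot> c = a \<cdot> (b \<cdot> c)"
  using algebra by (simp add: is_algebra_def)

lemma mult_unit [simp]: "a \<in> carrier B \<Longrightarrow> \<one> \<cdot> a = a" "a \<in> carrier B \<Longrightarrow> a \<cdot> \<one> = a"
  using algebra by (simp_all add: is_algebra_def)

lemmas linear_mult [simp] = bilinear_rules[OF mult_bilinear]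

lemma mult_scale [simp]:
  "a \<in> carrier B \<Longrightarrow> b \<in> carrier B \<Longrightarrow> scale B c a \<cdot> b = scale B c (a \<cdot> b)"
  "a \<in> carrier B \<Longrightarrow> b \<in> carrier B \<Longrightarrow> a \<cdot> scale B c b = scale B c (a \<cdot> b)"
  using linear_scale[OF linear_mult(1)[OF linear_ident]] linear_scale[OF linear_mult(2)[OF linear_ident]]
  by blast+

lemma mult_ssum_left [simp]:
  "b \<in> carrier B \<Longrightarrow> (\<And>x y. x \<in> carrier X \<Longrightarrow> y \<in> carrier Y \<Longrightarrow> f x y \<in> carrier B)
    \<Longrightarrow> ssum X Y t f \<cdot> b = ssum X Y t (\<lambda>x y. f x y \<cdot> b)"
  by (rule linear_ssum[where L = "\<lambda>x. x \<cdot> b", OF linear_mult(1)[OF linear_ident] vspace])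

lemma mult_ssum_right [simp]:
  "b \<in> carrier B \<Longrightarrow> (\<And>x y. x \<in> carrier X \<Longrightarrow> y \<in> carrier Y \<Longrightarrow> f x y \<in> carrier B)
    \<Longrightarrow> b \<cdot> ssum X Y t f = ssum X Y t (\<lambda>x y. b \<cdot> f x y)"
  by (rule linear_ssum[where L = "\<lambda>x. b \<cdot> x", OF linear_mult(2)[OF linear_ident] vspace])

lemma ssum_closed_carrier [simp]:
  "(\<And>x y. x \<in> carrier X \<Longrightarrow> y \<in> carrier Y \<Longrightarrow> f x y \<in> carrier B) \<Longrightarrow> ssum X Y t f \<in> carrier B"
  by (rule ssum_closed) simp_all

lemma scale_closed [simp]: "b \<in> carrier B \<Longrightarrow> scale B c b \<in> carrier B"
  by (simp add: vspaceD)

end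

lemma ssum_closed_tensor [simp]:
  "(\<And>x y. x \<in> carrier X \<Longrightarrow> y \<in> carrier Y \<Longrightarrow> f x y \<in> carrier (V \<Otimes> W)) \<Longrightarrow> ssum X Y t f \<in> carrier (V \<Otimes> W)"
  by (rule ssum_closed) simp_all

lemma tscale_closed [simp]: "t \<in> carrier (V \<Otimes> W) \<Longrightarrow> tscale c t \<in> carrier (V \<Otimes> W)"
  using vspaceD(3)[OF vspace_tensor, of t V W c] by simp

lemmas linear_tscale [simp] =
  linear_scale_left[OF vspace_tensor, unfolded scale_tensor_space]
  linear_scale_right[OF vspace_tensor, unfolded scale_tensor_space]

lemma tens_scale [simp]:
  "v \<in> carrier V \<Longrightarrow> w \<in> carrier W \<Longrightarrow> scale V c v \<otimes>\<^bsub>V,W\<^esub> w = tscale c (v \<otimes>\<^bsub>V,W\<^esub> w)"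
  "v \<in> carrier V \<Longrightarrow> w \<in> carrier W \<Longrightarrow> v \<otimes>\<^bsub>V,W\<^esub> scale W c w = tscale c (v \<otimes>\<^bsub>V,W\<^esub> w)"
  using linear_scale[OF linear_tens(1)[OF linear_ident]] linear_scale[OF linear_tens(2)[OF linear_ident]]
  by fastforce+

lemma tensor_algebra_simps [simp]:
  "carrier (tensor_algebra A B) = carrier (A \<Otimes> B)" "scale (tensor_algebra A B) = tscale"
  "unit (tensor_algebra A B) = \<one>\<^bsub>A\<^esub> \<otimes>\<^bsub>A,B\<^esub> \<one>\<^bsub>B\<^esub>"
  by (simp_all add: tensor_algebra_def)

lemma linear_tensor_algebra [simp]:
  "linear_on U (tensor_algebra A B) = linear_on U (A \<Otimes> B)"
  "linear_on (tensor_algebra A B) U = linear_on (A \<Otimes> B) U"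
  by (rule linear_on_cong_space; simp)+

lemma tensor_algebra_mult:
  assumes "is_algebra A" and "is_algebra B" and "s \<in> carrier (A \<Otimes> B)" and "t \<in> carrier (A \<Otimes> B)"
  shows "s \<cdot>\<^bsub>tensor_algebra A B\<^esub> t =
    ssum A B s (\<lambda>a b. ssum A B t (\<lambda>a' b'. (a \<cdot>\<^bsub>A\<^esub> a') \<otimes>\<^bsub>A,B\<^esub> (b \<cdot>\<^bsub>B\<^esub> b')))"
proof -
  interpret A: algebra_on A by standard fact
  interpret B: algebra_on B by standard fact
  show ?thesis using assms by (simp add: tensor_algebra_def tsum_ssum)
qed

text \<open>One rule for the multiplicativity of comultiplications and of coactions, both of which
  are algebra maps into a tensor product.\<close>

lemma form_algebra_hom_tensor:
  fixes G :: "_ \<Rightarrow> _ \<Rightarrow> 'k::field"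
  assumes "is_algebra A" and "is_algebra B" and f: "algebra_hom C (tensor_algebra A B) f"
    and "biform A B G" and c: "c \<in> carrier C" "d \<in> carrier C"
  shows "ssum A B (f (c \<cdot>\<^bsub>C\<^esub> d)) G = ssum A B (f c) (\<lambda>a b. ssum A B (f d) (\<lambda>a' b'. G (a \<cdot>\<^bsub>A\<^esub> a') (b \<cdot>\<^bsub>B\<^esub> b')))"
proof -
  interpret A: algebra_on A by standard fact
  interpret B: algebra_on B by standard fact
  have mem: "f x \<in> carrier (A \<Otimes> B)" if "x \<in> carrier C" for x
    using f that by (simp add: algebra_hom_def linear_on_def)
  have "f (c \<cdot>\<^bsub>C\<^esub> d) = ssum A B (f c) (\<lambda>a b. ssum A B (f d) (\<lambda>a' b'. (a \<cdot>\<^bsub>A\<^esub> a') \<otimes>\<^bsub>A,B\<^esub> (b \<cdot>\<^bsub>B\<^esub> b')))"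
    using f c by (simp add: algebra_hom_def tensor_algebra_mult assms mem)
  then show ?thesis using assms(4) by simp
qed

section \<open>Coalgebras and bialgebras\<close>

locale coalgebra_on =
  fixes B :: "('k::field, 'v::ab_group_add, 'x) bialgebra_scheme" (structure)
  assumes coalgebra: "is_coalgebra B"
begin

lemma vspace_coalgebra [simp]: "vspace B"
  using coalgebra by (simp add: is_coalgebra_def)

lemma comult_linear: "linear_on B (B \<Otimes> B) (comult B)"
  and counit_form: "form B (counit B)"
  using coalgebra by (simp_all add: is_coalgebra_def)

lemmas linear_comult [simp] = linear_compose[OF comult_linear]
lemmas linear_counit [simp] = linear_compose[OF counit_form]

lemma comult_closed [simp]: "b \<in> carrier B \<Longrightarrow> comult B b \<in> carrier (B \<Otimes> B)"
  by (rule linear_closed[OF comult_linear])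

lemma sw2_csum [simp]: "b \<in> carrier B \<Longrightarrow> sw2 B b f = csum B b f"
  by (simp add: sw2_def tsum_ssum)

text \<open>The four shapes cover both legs of the coproduct and both orders of the scalar
  factors.\<close>

lemma counit_csum [simp]:
  fixes f :: "_ \<Rightarrow> 'k"
  assumes "form B f" and "b \<in> carrier B"
  shows "csum B b (\<lambda>x y. counit B x * f y) = f b"
    and "csum B b (\<lambda>x y. f x * counit B y) = f b"
    and "csum B b (\<lambda>x y. counit B y * f x) = f b"
    and "csum B b (\<lambda>x y. f y * counit B x) = f b"
proof -
  note [simp] = linear_scale[OF assms(1)] vspaceD(3)[OF vspace_coalgebra]
  have "f (csum B b (\<lambda>x y. scale B (counit B x) y)) = f b" "f (csum B b (\<lambda>x y. scale B (counit B y) x)) = f b"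
    using coalgebra assms(2) by (simp_all add: is_coalgebra_def)
  moreover have "f (csum B b (\<lambda>x y. scale B (counit B x) y)) = csum B b (\<lambda>x y. f (scale B (counit B x) y))"
    "f (csum B b (\<lambda>x y. scale B (counit B y) x)) = csum B b (\<lambda>x y. f (scale B (counit B y) x))"
    by (rule linear_ssum[OF assms(1)]; simp)+
  ultimately show "csum B b (\<lambda>x y. counit B x * f y) = f b" "csum B b (\<lambda>x y. f x * counit B y) = f b"
    "csum B b (\<lambda>x y. counit B y * f x) = f b" "csum B b (\<lambda>x y. f y * counit B x) = f b"
    by (simp_all add: mult.commute)
qed

lemma csum_assoc:
  fixes G :: "_ \<Rightarrow> _ \<Rightarrow> _ \<Rightarrow> 'k"
  assumes "triform B B B G" and "b \<in> carrier B"
  shows "csum B b (\<lambda>x y. csum B x (\<lambda>u v. G u v y)) = csum B b (\<lambda>x y. csum B y (\<lambda>u v. G x u v))"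
proof -
  let ?t = "csum B b (\<lambda>x y. comult B x \<otimes>\<^bsub>B \<Otimes> B, B\<^esub> y)"
  have "ssum B (B \<Otimes> B) (tensor_assoc B B B ?t) (\<lambda>x p. ssum B B p (\<lambda>u v. G x u v))
      = ssum (B \<Otimes> B) B ?t (\<lambda>p y. ssum B B p (\<lambda>u v. G u v y))"
    by (rule form_tensor_assoc) (use assms in simp_all)
  moreover have "tensor_assoc B B B ?t = csum B b (\<lambda>x y. x \<otimes>\<^bsub>B, B \<Otimes> B\<^esub> comult B y)"
    using coalgebra assms(2) by (simp add: is_coalgebra_def)
  ultimately show ?thesis
    using assms by (simp add: triform_def)
qed

end

locale bialgebra_on =
  fixes B :: "('k::field, 'v::ab_group_add, 'x) bialgebra_scheme" (structure)
  assumes bialgebra: "is_bialgebra B"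

sublocale bialgebra_on \<subseteq> algebra_on
  by standard (use bialgebra in \<open>simp add: is_bialgebra_def\<close>)

sublocale bialgebra_on \<subseteq> coalgebra_on
  by standard (use bialgebra in \<open>simp add: is_bialgebra_def\<close>)

context bialgebra_on
begin

lemma csum_mult [simp]:
  fixes G :: "_ \<Rightarrow> _ \<Rightarrow> 'k"
  assumes "biform B B G" and "a \<in> carrier B" and "b \<in> carrier B"
  shows "csum B (a \<cdot> b) G = csum B a (\<lambda>a1 a2. csum B b (\<lambda>b1 b2. G (a1 \<cdot> b1) (a2 \<cdot> b2)))"
  by (rule form_algebra_hom_tensor) (use bialgebra assms in \<open>simp_all add: is_bialgebra_def\<close>)

lemma comult_unit [simp]: "comult B \<one> = \<one> \<otimes>\<^bsub>B,B\<^esub> \<one>"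
  using bialgebra by (simp add: is_bialgebra_def algebra_hom_def)

lemma counit_simps [simp]:
  "counit B \<one> = 1"
  "a \<in> carrier B \<Longrightarrow> b \<in> carrier B \<Longrightarrow> counit B (a \<cdot> b) = counit B a * counit B b"
  "a \<in> carrier B \<Longrightarrow> counit B (scale B c a) = c * counit B a"
  using bialgebra linear_scale[OF counit_form]
  by (simp_all add: is_bialgebra_def algebra_hom_def ground_algebra_def)

lemma counit_ssum:
  "(\<And>x y. x \<in> carrier X \<Longrightarrow> y \<in> carrier Y \<Longrightarrow> f x y \<in> carrier B)
    \<Longrightarrow> counit B (ssum X Y t f) = ssum X Y t (\<lambda>x y. counit B (f x y))"
  by (rule linear_ssum[OF counit_form]) simp_all

end

section \<open>Properties of the antipode\<close>

locale hopf_on =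
  fixes H :: "('k::field, 'v::ab_group_add, 'x) hopf_scheme" (structure)
  assumes hopf: "is_hopf H"

sublocale hopf_on \<subseteq> bialgebra_on H
  by standard (use hopf in \<open>simp add: is_hopf_def\<close>)

context hopf_on
begin

abbreviation S where "S \<equiv> antipode H"
abbreviation \<epsilon> where "\<epsilon> \<equiv> counit H"

lemma antipode_linear: "linear_on H H S"
  using hopf by (simp add: is_hopf_def)

lemmas linear_antipode [simp] = linear_compose[OF antipode_linear]

lemma antipode_closed [simp]: "h \<in> carrier H \<Longrightarrow> S h \<in> carrier H"
  by (rule linear_closed[OF antipode_linear])

lemma antipode_form:
  fixes f :: "_ \<Rightarrow> 'k"
  assumes f: "form H f" and h: "h \<in> carrier H"
  shows "csum H h (\<lambda>x y. f (S x \<cdot> y)) = \<epsilon> h * f \<one>"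
    and "csum H h (\<lambda>x y. f (x \<cdot> S y)) = \<epsilon> h * f \<one>"
proof -
  have "f (csum H h (\<lambda>x y. S x \<cdot> y)) = f (scale H (\<epsilon> h) \<one>)"
    "f (csum H h (\<lambda>x y. x \<cdot> S y)) = f (scale H (\<epsilon> h) \<one>)"
    using hopf h by (simp_all add: is_hopf_def)
  moreover have "f (csum H h (\<lambda>x y. S x \<cdot> y)) = csum H h (\<lambda>x y. f (S x \<cdot> y))"
    "f (csum H h (\<lambda>x y. x \<cdot> S y)) = csum H h (\<lambda>x y. f (x \<cdot> S y))"
    by (rule linear_ssum[OF f]; simp)+
  ultimately show "csum H h (\<lambda>x y. f (S x \<cdot> y)) = \<epsilon> h * f \<one>"
    "csum H h (\<lambda>x y. f (x \<cdot> S y)) = \<epsilon> h * f \<one>"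
    by (simp_all add: linear_scale[OF f])
qed

text \<open>The second argument of the form holds the leg that takes no part in the cancellation. In
  the first two identities coassociativity first regroups the legs, so that the cancelling pair
  comes from one coproduct.\<close>

lemma antipode_biform:
  fixes K :: "_ \<Rightarrow> _ \<Rightarrow> 'k"
  assumes K: "biform H H K" and h: "h \<in> carrier H"
  shows "csum H h (\<lambda>x y. csum H y (\<lambda>u v. K (S x \<cdot> u) v)) = K \<one> h"
    and "csum H h (\<lambda>x y. csum H y (\<lambda>u v. K (x \<cdot> S u) v)) = K \<one> h"
    and "csum H h (\<lambda>x y. csum H y (\<lambda>u v. K x (S u \<cdot> v))) = K h \<one>"
    and "csum H h (\<lambda>x y. csum H y (\<lambda>u v. K x (u \<cdot> S v))) = K h \<one>"
proof -
  have K': "linear_on H H g' \<Longrightarrow> c \<in> carrier H \<Longrightarrow> form H (\<lambda>x. K (g' x) c)"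
    "linear_on H H g' \<Longrightarrow> c \<in> carrier H \<Longrightarrow> form H (\<lambda>x. K c (g' x))" for g' c
    using bilinear_rules[OF K] by blast+
  note [simp] = K'
  show "csum H h (\<lambda>x y. csum H y (\<lambda>u v. K (S x \<cdot> u) v)) = K \<one> h"
    using csum_assoc[of "\<lambda>x u v. K (S x \<cdot> u) v" h] h
      antipode_form(1)[where f = "\<lambda>x. K x c" for c]
    by (simp add: triform_def)
  show "csum H h (\<lambda>x y. csum H y (\<lambda>u v. K (x \<cdot> S u) v)) = K \<one> h"
    using csum_assoc[of "\<lambda>x u v. K (x \<cdot> S u) v" h] h
      antipode_form(2)[where f = "\<lambda>x. K x c" for c]
    by (simp add: triform_def)
  show "csum H h (\<lambda>x y. csum H y (\<lambda>u v. K x (S u \<cdot> v))) = K h \<one>"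
    "csum H h (\<lambda>x y. csum H y (\<lambda>u v. K x (u \<cdot> S v))) = K h \<one>"
    using h by (simp_all add: antipode_form[where f = "K c" for c])
qed

lemma antipode_unit [simp]: "S \<one> = \<one>"
proof (rule form_eqI[OF vspace])
  fix \<phi> assume \<phi>: "form H \<phi>"
  note [simp] = linear_compose[OF \<phi>]
  show "\<phi> (S \<one>) = \<phi> \<one>"
    using antipode_form(1)[of \<phi> "\<one>"] \<phi> by simp
qed simp_all

text \<open>The scalar \<epsilon>(S(h_1) h_2) is evaluated in two ways: by the antipode axiom and by
  multiplicativity of the counit.\<close>

lemma counit_antipode [simp]:
  assumes h: "h \<in> carrier H" shows "\<epsilon> (S h) = \<epsilon> h"
proof -
  have "csum H h (\<lambda>x y. \<epsilon> (S x \<cdot> y)) = \<epsilon> h"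
    using antipode_form(1)[OF counit_form h] by simp
  moreover have "csum H h (\<lambda>x y. \<epsilon> (S x) * \<epsilon> y) = \<epsilon> (S h)"
    using h by simp
  ultimately show ?thesis using h by simp
qed

text \<open>Uniqueness of convolution inverses: S(h_1 k_1) h_2 k_2 S(k_3) S(h_3) collapses from the
  right to S(h k) and from the left to S(k) S(h).\<close>

lemma antipode_mult [simp]:
  assumes h: "h \<in> carrier H" and k: "k \<in> carrier H"
  shows "S (h \<cdot> k) = S k \<cdot> S h"
proof (rule form_eqI[OF vspace])
  fix \<phi> assume \<phi>: "form H \<phi>"
  note [simp] = linear_compose[OF \<phi>]
  let ?T = "csum H h (\<lambda>h1 h'. csum H k (\<lambda>k1 k'.
      csum H h' (\<lambda>h2 h3. csum H k' (\<lambda>k2 k3. \<phi> (S (h1 \<cdot> k1) \<cdot> (h2 \<cdot> ((k2 \<cdot> S k3) \<cdot> S h3)))))))"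
  \<comment> \<open>The inner pair k_2 S(k_3) has to go before h_2 meets S(h_3).\<close>
  have "?T = csum H h (\<lambda>h1 h'. csum H k (\<lambda>k1 k'. \<phi> (S (h1 \<cdot> k1)) * \<epsilon> h' * \<epsilon> k'))"
  proof (intro ssum_cong refl)
    fix h1 h' k1 k' assume [simp]: "h1 \<in> carrier H" "h' \<in> carrier H" "k1 \<in> carrier H" "k' \<in> carrier H"
    have "csum H k' (\<lambda>k2 k3. \<phi> (X \<cdot> (h2 \<cdot> ((k2 \<cdot> S k3) \<cdot> S h3)))) = \<epsilon> k' * \<phi> (X \<cdot> (h2 \<cdot> S h3))"
      if [simp]: "X \<in> carrier H" "h2 \<in> carrier H" "h3 \<in> carrier H" for X h2 h3
      using antipode_form(2)[of "\<lambda>p. \<phi> (X \<cdot> (h2 \<cdot> (p \<cdot> S h3)))" k'] by simp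
    then show "csum H h' (\<lambda>h2 h3. csum H k' (\<lambda>k2 k3. \<phi> (S (h1 \<cdot> k1) \<cdot> (h2 \<cdot> ((k2 \<cdot> S k3) \<cdot> S h3)))))
      = \<phi> (S (h1 \<cdot> k1)) * \<epsilon> h' * \<epsilon> k'"
      using antipode_form(2)[of "\<lambda>p. \<phi> (S (h1 \<cdot> k1) \<cdot> p)" h'] by (simp del: mult_assoc)
  qed
  also have "\<dots> = \<phi> (S (h \<cdot> k))"
    using h k by simp
  finally have 1: "?T = \<phi> (S (h \<cdot> k))" .
  have "?T = csum H h (\<lambda>h1 h'. csum H h' (\<lambda>h2 h3. csum H k (\<lambda>k1 k'. csum H k' (\<lambda>k2 k3.
      \<phi> (S (h1 \<cdot> k1) \<cdot> (h2 \<cdot> ((k2 \<cdot> S k3) \<cdot> S h3)))))))"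
    by (subst ssum_swap[where t = "comult H k"]) (rule refl)
  \<comment> \<open>Regroup so that the first two legs of \<open>h\<close> and of \<open>k\<close>
    together form the coproduct of one product.\<close>
  also have "\<dots> = csum H h (\<lambda>h1 h'. csum H k (\<lambda>k1 k'. csum H h1 (\<lambda>h1 h2. csum H k1 (\<lambda>k1 k2.
      \<phi> (S (h1 \<cdot> k1) \<cdot> ((h2 \<cdot> k2) \<cdot> (S k' \<cdot> S h')))))))"
    by (subst (2) ssum_swap) (use h k in \<open>simp add: csum_assoc triform_def\<close>)
  also have "\<dots> = csum H h (\<lambda>h1 h'. csum H k (\<lambda>k1 k'. csum H (h1 \<cdot> k1) (\<lambda>x y.
      \<phi> ((S x \<cdot> y) \<cdot> (S k' \<cdot> S h')))))"
    using h k by simp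
  also have "\<dots> = \<phi> (S k \<cdot> S h)"
    using h k antipode_form(1)[of "\<lambda>p. \<phi> (p \<cdot> (S k' \<cdot> S h'))" for k' h'] by (simp del: mult_assoc add: mult.assoc)
  finally show "\<phi> (S (h \<cdot> k)) = \<phi> (S k \<cdot> S h)" using 1 by simp
qed (use h k in simp_all)

text \<open>The same device in H \<otimes> H, applied to \<Delta>(S(h_1) h_2) (S(h_4) \<otimes>
  S(h_3)). Cancelling S(h_1) h_2 leaves the flipped antipodes of the two legs; splitting \<Delta> of
  the product and cancelling at the other end leaves \<Delta>(S(h)).\<close>

lemma csum_antipode [simp]:
  fixes G :: "_ \<Rightarrow> _ \<Rightarrow> 'k"
  assumes G: "biform H H G" and h: "h \<in> carrier H"
  shows "csum H (S h) G = csum H h (\<lambda>x y. G (S y) (S x))"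
proof -
  note [simp] = bilinear_rules[OF G]
  let ?T = "csum H h (\<lambda>h1 k. csum H k (\<lambda>h2 l. csum H (S h1 \<cdot> h2) (\<lambda>p q.
      csum H l (\<lambda>x y. G (p \<cdot> S y) (q \<cdot> S x)))))"
  have "?T = csum H h (\<lambda>x y. G (S y) (S x))"
    using antipode_biform(1)[where K = "\<lambda>w l. csum H w (\<lambda>p q. csum H l (\<lambda>x y. G (p \<cdot> S y) (q \<cdot> S x)))"] h
    by (simp del: csum_mult)
  moreover have "?T = csum H h (\<lambda>h1 k. csum H k (\<lambda>h2 l. csum H (S h1) (\<lambda>p q. csum H h2 (\<lambda>u v.
     csum H l (\<lambda>x y. G (p \<cdot> (u \<cdot> S y)) (q \<cdot> (v \<cdot> S x)))))))"
    using h by simp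
  moreover have "\<dots> = csum H h (\<lambda>h1 k. csum H (S h1) (\<lambda>p q. csum H k (\<lambda>h2 l. csum H h2 (\<lambda>u v.
     csum H l (\<lambda>x y. G (p \<cdot> (u \<cdot> S y)) (q \<cdot> (v \<cdot> S x)))))))"
    by (rule ssum_cong[OF refl], rule ssum_swap)
  moreover have "\<dots> = csum H h (\<lambda>h1 k. csum H (S h1) (\<lambda>p q. csum H k (\<lambda>u l'. csum H l' (\<lambda>v l.
     csum H l (\<lambda>x y. G (p \<cdot> (u \<cdot> S y)) (q \<cdot> (v \<cdot> S x)))))))"
    using h by (simp add: csum_assoc triform_def)
  \<comment> \<open>The pair \<open>v\<close>, \<open>S x\<close> cancels first and makes
    \<open>u\<close> and \<open>S y\<close> adjacent.\<close>
  moreover have "\<dots> = csum H h (\<lambda>h1 k. csum H (S h1) (\<lambda>p q. G p q * \<epsilon> k))"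
    using h antipode_biform(2)[where K = "\<lambda>w y. G (p \<cdot> (u \<cdot> S y)) (q \<cdot> w)" for p q u]
      antipode_form(2)[where f = "\<lambda>w. G (p \<cdot> w) q" for p q]
    by simp
  ultimately show ?thesis using h by simp
qed

end

section \<open>Bialgebras with a bicolinear splitting\<close>

locale splitting = A: bialgebra_on A + H: hopf_on H
  for A :: "('k::field, 'a::ab_group_add) bialgebra" (structure) and H :: "('k, 'h::ab_group_add) hopf" +
  fixes \<pi> :: "'a \<Rightarrow> 'h" and \<sigma> :: "'h \<Rightarrow> 'a"
  assumes splitting: "bicolinear_splitting H A \<pi> \<sigma>"
begin

abbreviation S where "S \<equiv> antipode H"

definition rco where "rco a = csum A a (\<lambda>x y. x \<otimes>\<^bsub>A,H\<^esub> \<pi> y)"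
definition lco where "lco a = csum A a (\<lambda>x y. \<pi> x \<otimes>\<^bsub>H,A\<^esub> y)"

abbreviation RA :: "'a \<Rightarrow> ('a \<Rightarrow> 'h \<Rightarrow> 'u::ab_group_add) \<Rightarrow> 'u" where "RA a \<equiv> ssum A H (rco a)"
abbreviation LA :: "'a \<Rightarrow> ('h \<Rightarrow> 'a \<Rightarrow> 'u::ab_group_add) \<Rightarrow> 'u" where "LA a \<equiv> ssum H A (lco a)"

lemma pi_linear: "linear_on A H \<pi>" and sigma_linear: "linear_on H A \<sigma>"
  using splitting by (simp_all add: bicolinear_splitting_def bialgebra_hom_def algebra_hom_def)

lemmas linear_pi [simp] = linear_compose[OF pi_linear]
lemmas linear_sigma [simp] = linear_compose[OF sigma_linear]

lemma pi_closed [simp]: "a \<in> carrier A \<Longrightarrow> \<pi> a \<in> carrier H"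
  and sigma_closed [simp]: "h \<in> carrier H \<Longrightarrow> \<sigma> h \<in> carrier A"
  using linear_closed[OF pi_linear] linear_closed[OF sigma_linear] by auto

lemma pi_simps [simp]:
  "a \<in> carrier A \<Longrightarrow> b \<in> carrier A \<Longrightarrow> \<pi> (a \<cdot> b) = \<pi> a \<cdot>\<^bsub>H\<^esub> \<pi> b"
  "\<pi> \<one> = \<one>\<^bsub>H\<^esub>"
  "a \<in> carrier A \<Longrightarrow> counit H (\<pi> a) = counit A a"
  "h \<in> carrier H \<Longrightarrow> \<pi> (\<sigma> h) = h"
  using splitting by (simp_all add: bicolinear_splitting_def bialgebra_hom_def algebra_hom_def)

lemma sigma_simps [simp]:
  "h \<in> carrier H \<Longrightarrow> k \<in> carrier H \<Longrightarrow> \<sigma> (h \<cdot>\<^bsub>H\<^esub> k) = \<sigma> h \<cdot> \<sigma> k"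
  "\<sigma> \<one>\<^bsub>H\<^esub> = \<one>"
  using splitting by (simp_all add: bicolinear_splitting_def algebra_hom_def)

lemma counit_sigma [simp]: "h \<in> carrier H \<Longrightarrow> counit A (\<sigma> h) = counit H h"
  using pi_simps(3)[of "\<sigma> h"] by simp

lemma csum_pi [simp]:
  fixes G :: "_ \<Rightarrow> _ \<Rightarrow> 'k"
  assumes "biform H H G" and "a \<in> carrier A"
  shows "csum H (\<pi> a) G = csum A a (\<lambda>x y. G (\<pi> x) (\<pi> y))"
proof -
  have "comult H (\<pi> a) = csum A a (\<lambda>x y. \<pi> x \<otimes>\<^bsub>H,H\<^esub> \<pi> y)"
    using splitting assms(2) by (simp add: bicolinear_splitting_def bialgebra_hom_def)
  then show ?thesis using assms(1) by simp
qed

lemma rco_linear: "linear_on A (A \<Otimes> H) rco" and lco_linear: "linear_on A (H \<Otimes> A) lco"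
  unfolding rco_def[abs_def] lco_def[abs_def] by simp_all

lemmas linear_rco [simp] = linear_compose[OF rco_linear]
lemmas linear_lco [simp] = linear_compose[OF lco_linear]

lemma rco_closed [simp]: "a \<in> carrier A \<Longrightarrow> rco a \<in> carrier (A \<Otimes> H)"
  and lco_closed [simp]: "a \<in> carrier A \<Longrightarrow> lco a \<in> carrier (H \<Otimes> A)"
  using linear_closed[OF rco_linear] linear_closed[OF lco_linear] by auto

lemma rco_ssum [simp]:
  "(\<And>x y. x \<in> carrier X \<Longrightarrow> y \<in> carrier Y \<Longrightarrow> f x y \<in> carrier A)
    \<Longrightarrow> rco (ssum X Y t f) = ssum X Y t (\<lambda>x y. rco (f x y))"
  by (rule linear_ssum[OF rco_linear]) simp_all

lemma lco_ssum [simp]: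
  "(\<And>x y. x \<in> carrier X \<Longrightarrow> y \<in> carrier Y \<Longrightarrow> f x y \<in> carrier A)
    \<Longrightarrow> lco (ssum X Y t f) = ssum X Y t (\<lambda>x y. lco (f x y))"
  by (rule linear_ssum[OF lco_linear]) simp_all

lemma RA_csum:
  fixes G :: "_ \<Rightarrow> _ \<Rightarrow> 'k"
  shows "biform A H G \<Longrightarrow> RA a G = csum A a (\<lambda>x y. G x (\<pi> y))"
  by (simp add: rco_def)

lemma LA_csum:
  fixes G :: "_ \<Rightarrow> _ \<Rightarrow> 'k"
  shows "biform H A G \<Longrightarrow> LA a G = csum A a (\<lambda>x y. G (\<pi> x) y)"
  by (simp add: lco_def)

text \<open>Coassociativity, oriented so that repeated sums get nested to the right.\<close>

lemma sum_assoc: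
  fixes G :: "_ \<Rightarrow> _ \<Rightarrow> _ \<Rightarrow> 'k"
  assumes a: "a \<in> carrier A"
  shows "triform A H A G \<Longrightarrow> csum A a (\<lambda>x y. RA x (\<lambda>u h. G u h y)) = csum A a (\<lambda>u z. LA z (G u))"
    and "triform H A A G' \<Longrightarrow> csum A a (\<lambda>x y. LA x (\<lambda>h v. G' h v y)) = LA a (\<lambda>h z. csum A z (G' h))"
    and "triform A A H G'' \<Longrightarrow> RA a (\<lambda>x h. csum A x (\<lambda>u v. G'' u v h)) = csum A a (\<lambda>u z. RA z (G'' u))"
    and "triform A H H K \<Longrightarrow> RA a (\<lambda>x h. RA x (\<lambda>u k. K u k h)) = RA a (\<lambda>u z. csum H z (K u))"
    and "triform H A H K' \<Longrightarrow> RA a (\<lambda>x h. LA x (\<lambda>k u. K' k u h)) = LA a (\<lambda>k z. RA z (K' k))"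
    and "triform H H A K'' \<Longrightarrow> LA a (\<lambda>h z. csum H h (\<lambda>k l. K'' k l z)) = LA a (\<lambda>k z. LA z (K'' k))"
proof -
  note [simp] = RA_csum LA_csum triform_def A.csum_assoc
  show "csum A a (\<lambda>x y. RA x (\<lambda>u h. G u h y)) = csum A a (\<lambda>u z. LA z (G u))" if G: "triform A H A G"
  proof -
    note [simp] = triform_compose[OF G]
    show ?thesis using a by simp
  qed
  show "csum A a (\<lambda>x y. LA x (\<lambda>h v. G' h v y)) = LA a (\<lambda>h z. csum A z (G' h))" if G: "triform H A A G'"
  proof -
    note [simp] = triform_compose[OF G]
    show ?thesis using a by simp
  qed
  show "RA a (\<lambda>x h. csum A x (\<lambda>u v. G'' u v h)) = csum A a (\<lambda>u z. RA z (G'' u))" if G: "triform A A H G''"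
  proof -
    note [simp] = triform_compose[OF G]
    show ?thesis using a by simp
  qed
  show "RA a (\<lambda>x h. RA x (\<lambda>u k. K u k h)) = RA a (\<lambda>u z. csum H z (K u))" if G: "triform A H H K"
  proof -
    note [simp] = triform_compose[OF G]
    show ?thesis using a by simp
  qed
  show "RA a (\<lambda>x h. LA x (\<lambda>k u. K' k u h)) = LA a (\<lambda>k z. RA z (K' k))" if G: "triform H A H K'"
  proof -
    note [simp] = triform_compose[OF G]
    show ?thesis using a by simp
  qed
  show "LA a (\<lambda>h z. csum H h (\<lambda>k l. K'' k l z)) = LA a (\<lambda>k z. LA z (K'' k))" if G: "triform H H A K''"
  proof -
    note [simp] = triform_compose[OF G]
    show ?thesis using a by simp
  qed
qed

lemma RA_counit [simp]:
  fixes f :: "_ \<Rightarrow> 'k"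
  assumes a: "a \<in> carrier A" and f: "form A f"
  shows "RA a (\<lambda>x h. f x * counit H h) = f a" "RA a (\<lambda>x h. counit H h * f x) = f a"
    and "LA a (\<lambda>h x. f x * counit H h) = f a" "LA a (\<lambda>h x. counit H h * f x) = f a"
  using assms by (simp_all add: RA_csum LA_csum)

lemma RA_counit' [simp]:
  fixes f :: "_ \<Rightarrow> 'k"
  assumes a: "a \<in> carrier A" and f: "form H f"
  shows "RA a (\<lambda>x h. f h * counit A x) = f (\<pi> a)" "RA a (\<lambda>x h. counit A x * f h) = f (\<pi> a)"
    and "LA a (\<lambda>h x. f h * counit A x) = f (\<pi> a)" "LA a (\<lambda>h x. counit A x * f h) = f (\<pi> a)"
proof -
  note [simp] = linear_compose[OF f]
  show "RA a (\<lambda>x h. f h * counit A x) = f (\<pi> a)" "RA a (\<lambda>x h. counit A x * f h) = f (\<pi> a)"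
    "LA a (\<lambda>h x. f h * counit A x) = f (\<pi> a)" "LA a (\<lambda>h x. counit A x * f h) = f (\<pi> a)"
    using a by (simp_all add: RA_csum LA_csum)
qed

lemma RA_mult [simp]:
  fixes G :: "_ \<Rightarrow> _ \<Rightarrow> 'k"
  assumes "a \<in> carrier A" and "b \<in> carrier A"
  shows "biform A H G \<Longrightarrow> RA (a \<cdot> b) G = RA a (\<lambda>x h. RA b (\<lambda>y k. G (x \<cdot> y) (h \<cdot>\<^bsub>H\<^esub> k)))"
    and "biform H A G' \<Longrightarrow> LA (a \<cdot> b) G' = LA a (\<lambda>h x. LA b (\<lambda>k y. G' (h \<cdot>\<^bsub>H\<^esub> k) (x \<cdot> y)))"
proof -
  show "RA (a \<cdot> b) G = RA a (\<lambda>x h. RA b (\<lambda>y k. G (x \<cdot> y) (h \<cdot>\<^bsub>H\<^esub> k)))" if G: "biform A H G"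
  proof -
    note [simp] = bilinear_rules[OF G]
    show ?thesis using assms by (simp add: RA_csum)
  qed
  show "LA (a \<cdot> b) G' = LA a (\<lambda>h x. LA b (\<lambda>k y. G' (h \<cdot>\<^bsub>H\<^esub> k) (x \<cdot> y)))" if G: "biform H A G'"
  proof -
    note [simp] = bilinear_rules[OF G]
    show ?thesis using assms by (simp add: LA_csum)
  qed
qed

lemma rco_unit [simp]: "rco \<one> = \<one> \<otimes>\<^bsub>A,H\<^esub> \<one>\<^bsub>H\<^esub>" and lco_unit [simp]: "lco \<one> = \<one>\<^bsub>H\<^esub> \<otimes>\<^bsub>H,A\<^esub> \<one>"
  by (simp_all add: rco_def lco_def ssum_tens[where U = "A \<Otimes> H"] ssum_tens[where U = "H \<Otimes> A"])

lemma sigma_bicolinear: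
  assumes "h \<in> carrier H"
  shows "rco (\<sigma> h) = csum H h (\<lambda>x y. \<sigma> x \<otimes>\<^bsub>A,H\<^esub> y)" and "lco (\<sigma> h) = csum H h (\<lambda>x y. x \<otimes>\<^bsub>H,A\<^esub> \<sigma> y)"
proof -
  have [simp]: "carrier (bicomod_via H B p) = carrier B" "scale (bicomod_via H B p) = scale B"
    for B :: "('k, 'w::ab_group_add) bialgebra" and p
    by (simp_all add: bicomod_via_def)
  have [simp]: "carrier (bicomod_via H H p) = carrier H" "scale (bicomod_via H H p) = scale H" for p
    by (simp_all add: bicomod_via_def)
  note [simp] = tsum_cong_space[of H H "bicomod_via H H id" H]
    tsum_cong_space[of "bicomod_via H H id" H H H] tens_cong[of H H "bicomod_via H A \<pi>" A]
    tens_cong[of "bicomod_via H A \<pi>" A H H]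
  have *: "lcoact (bicomod_via H H id) h = comult H h" "rcoact (bicomod_via H H id) h = comult H h"
    "lcoact (bicomod_via H A \<pi>) (\<sigma> h) = lco (\<sigma> h)" "rcoact (bicomod_via H A \<pi>) (\<sigma> h) = rco (\<sigma> h)"
    using assms by (simp_all add: bicomod_via_def rco_def lco_def)
  have "lcoact (bicomod_via H A \<pi>) (\<sigma> h) = tsum H H (lcoact (bicomod_via H H id) h) (\<lambda>x y. x \<otimes>\<^bsub>H,A\<^esub> \<sigma> y)"
    "rcoact (bicomod_via H A \<pi>) (\<sigma> h) = tsum H H (rcoact (bicomod_via H H id) h) (\<lambda>x y. \<sigma> x \<otimes>\<^bsub>A,H\<^esub> y)"
    using splitting assms by (simp_all add: bicolinear_splitting_def bicomodule_hom_def)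
  then show "rco (\<sigma> h) = csum H h (\<lambda>x y. \<sigma> x \<otimes>\<^bsub>A,H\<^esub> y)" "lco (\<sigma> h) = csum H h (\<lambda>x y. x \<otimes>\<^bsub>H,A\<^esub> \<sigma> y)"
    using assms by (simp_all add: * tsum_ssum)
qed

lemma RA_sigma [simp]:
  fixes G :: "_ \<Rightarrow> _ \<Rightarrow> 'k"
  assumes "h \<in> carrier H"
  shows "biform A H G \<Longrightarrow> RA (\<sigma> h) G = csum H h (\<lambda>x y. G (\<sigma> x) y)"
    and "biform H A G' \<Longrightarrow> LA (\<sigma> h) G' = csum H h (\<lambda>x y. G' x (\<sigma> y))"
proof -
  show "RA (\<sigma> h) G = csum H h (\<lambda>x y. G (\<sigma> x) y)" if G: "biform A H G"
  proof -
    note [simp] = bilinear_rules[OF G]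
    show ?thesis using assms by (simp add: sigma_bicolinear)
  qed
  show "LA (\<sigma> h) G' = csum H h (\<lambda>x y. G' x (\<sigma> y))" if G: "biform H A G'"
  proof -
    note [simp] = bilinear_rules[OF G]
    show ?thesis using assms by (simp add: sigma_bicolinear)
  qed
qed

subsection \<open>The projection onto the coinvariants\<close>

definition \<tau> where "\<tau> a = RA a (\<lambda>x h. x \<cdot> \<sigma> (S h))"

text \<open>The adjoint action of \<open>H\<close> along \<open>\<sigma>\<close>, on all of
  \<open>A\<close>; restricted to coinvariants it becomes the action of the diagram.\<close>

definition ad where "ad h t = csum H h (\<lambda>x y. (\<sigma> x \<cdot> t) \<cdot> \<sigma> (S y))"

lemma tau_linear: "linear_on A A \<tau>"
  unfolding \<tau>_def[abs_def] by simp

lemma ad_bilinear: "bilinear_on H A A ad"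
  unfolding ad_def by simp

lemmas linear_tau [simp] = linear_compose[OF tau_linear]
lemmas linear_ad [simp] = bilinear_rules[OF ad_bilinear]

lemma tau_closed [simp]: "a \<in> carrier A \<Longrightarrow> \<tau> a \<in> carrier A"
  and ad_closed [simp]: "h \<in> carrier H \<Longrightarrow> a \<in> carrier A \<Longrightarrow> ad h a \<in> carrier A"
  by (simp_all add: \<tau>_def ad_def)

text \<open>By right colinearity of \<open>\<sigma>\<close> and since the antipode reverses
  coproducts, the coaction of \<open>\<tau> a\<close> is a_0 \<sigma>(S(a_3)) \<otimes> a_1 S(a_2),
  where the second factor cancels. This is coinvariance in the form needed inside sums.\<close>

lemma RA_tau [simp]:
  fixes G :: "_ \<Rightarrow> _ \<Rightarrow> 'k"
  assumes G: "biform A H G" and a: "a \<in> carrier A"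
  shows "RA (\<tau> a) G = G (\<tau> a) \<one>\<^bsub>H\<^esub>"
proof -
  note [simp] = bilinear_rules[OF G]
  have "RA (\<tau> a) G = RA a (\<lambda>u z. csum H z (\<lambda>k h. csum H h (\<lambda>p q. G (u \<cdot> \<sigma> (S q)) (k \<cdot>\<^bsub>H\<^esub> S p))))"
    using a by (simp add: \<tau>_def sum_assoc triform_def)
  also have "\<dots> = RA a (\<lambda>u z. G (u \<cdot> \<sigma> (S z)) \<one>\<^bsub>H\<^esub>)"
    using a H.antipode_biform(2)[where K = "\<lambda>w q. G (u \<cdot> \<sigma> (S q)) w" for u] by simp
  also have "\<dots> = G (\<tau> a) \<one>\<^bsub>H\<^esub>"
    using a by (simp add: \<tau>_def biform_ssum[OF G])
  finally show ?thesis .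
qed

text \<open>Left colinearity sends \<sigma>(S(h)) to S(h_2) \<otimes> \<sigma>(S(h_1)), which moves
  an antipode into the coaction leg. As a rewrite rule this introduces the antipode that cancels in
  later computations; it is switched off where the coaction of \<open>\<tau> q\<close> has to stay
  intact for matching.\<close>

lemma LA_tau [simp]:
  fixes G :: "_ \<Rightarrow> _ \<Rightarrow> 'k"
  assumes G: "biform H A G" and a: "a \<in> carrier A"
  shows "LA (\<tau> a) G = LA a (\<lambda>b z. RA z (\<lambda>d h. G (b \<cdot>\<^bsub>H\<^esub> S h) (\<tau> d)))"
proof -
  note [simp] = bilinear_rules[OF G]
  show ?thesis
    using a by (simp add: \<tau>_def sum_assoc triform_def biform_ssum[OF G])
qed

lemma tau_coinvariant: "a \<in> carrier A \<Longrightarrow> rco (\<tau> a) = \<tau> a \<otimes>\<^bsub>A,H\<^esub> \<one>\<^bsub>H\<^esub>"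
proof (rule form_eqI[OF vspace_tensor])
  fix \<phi> assume a: "a \<in> carrier A" and \<phi>: "form (A \<Otimes> H) \<phi>"
  note [simp] = linear_compose[OF \<phi>]
  show "\<phi> (rco (\<tau> a)) = \<phi> (\<tau> a \<otimes>\<^bsub>A,H\<^esub> \<one>\<^bsub>H\<^esub>)"
    using a by (subst form_tensor[OF \<phi>]) simp_all
qed simp_all

lemma tau_eq: "r \<in> carrier A \<Longrightarrow> rco r = r \<otimes>\<^bsub>A,H\<^esub> \<one>\<^bsub>H\<^esub> \<Longrightarrow> \<tau> r = r"
  by (simp add: \<tau>_def ssum_tens[where U = A])

section \<open>The adjoint action and the projection\<close>

lemma ad_mult: "h \<in> carrier H \<Longrightarrow> k \<in> carrier H \<Longrightarrow> t \<in> carrier A \<Longrightarrow> ad h (ad k t) = ad (h \<cdot>\<^bsub>H\<^esub> k) t"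
proof (rule form_eqI[OF A.vspace])
  fix \<phi> assume a: "h \<in> carrier H" "k \<in> carrier H" "t \<in> carrier A" and \<phi>: "form A \<phi>"
  note [simp] = form_rules[OF \<phi>]
  show "\<phi> (ad h (ad k t)) = \<phi> (ad (h \<cdot>\<^bsub>H\<^esub> k) t)"
    using a by (simp add: ad_def)
qed simp_all

text \<open>Expanding the right side gives a_0 \<sigma>(S(a_1)) \<sigma>(a_2) \<tau>(b)
  \<sigma>(S(a_3)). The middle cancels, and a_0 \<tau>(b) \<sigma>(S(a_1)) is \<tau>(a b) because
  the antipode is antimultiplicative.\<close>

lemma tau_mult:
  assumes a: "a \<in> carrier A" and b: "b \<in> carrier A"
  shows "\<tau> (a \<cdot> b) = RA a (\<lambda>x h. \<tau> x \<cdot> ad h (\<tau> b))"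
proof (rule form_eqI[OF A.vspace])
  fix \<phi> assume \<phi>: "form A \<phi>"
  note [simp] = form_rules[OF \<phi>]
  define t where "t = \<tau> b"
  have t: "t \<in> carrier A" using b by (simp add: t_def)
  have "\<phi> (RA a (\<lambda>x h. \<tau> x \<cdot> ad h t))
      = RA a (\<lambda>x h. csum H h (\<lambda>p q. RA x (\<lambda>u k. \<phi> (u \<cdot> (\<sigma> (S k) \<cdot> (\<sigma> p \<cdot> (t \<cdot> \<sigma> (S q))))))))"
    using a t by (simp add: \<tau>_def ad_def)
  also have "\<dots> = RA a (\<lambda>x h. RA x (\<lambda>u k. csum H h (\<lambda>p q. \<phi> (u \<cdot> (\<sigma> (S k) \<cdot> (\<sigma> p \<cdot> (t \<cdot> \<sigma> (S q))))))))"
    by (rule ssum_cong[OF refl], rule ssum_swap)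
  also have "\<dots> = RA a (\<lambda>u z. csum H z (\<lambda>k h. csum H h (\<lambda>p q. \<phi> (u \<cdot> (\<sigma> (S k \<cdot>\<^bsub>H\<^esub> p) \<cdot> (t \<cdot> \<sigma> (S q)))))))"
    using a t by (simp add: sum_assoc triform_def)
  also have "\<dots> = RA a (\<lambda>u z. \<phi> (u \<cdot> (t \<cdot> \<sigma> (S z))))"
    using a t H.antipode_biform(1)[where K = "\<lambda>w q. \<phi> (u \<cdot> (\<sigma> w \<cdot> (t \<cdot> \<sigma> (S q))))" for u]
    by (simp del: sigma_simps(1))
  also have "\<dots> = \<phi> (\<tau> (a \<cdot> b))"
    using a b by (simp add: \<tau>_def t_def)
  finally show "\<phi> (\<tau> (a \<cdot> b)) = \<phi> (RA a (\<lambda>x h. \<tau> x \<cdot> ad h (\<tau> b)))"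
    by (simp add: t_def)
qed (use a b in simp_all)

text \<open>The antipode reverses the product a_1 h_2, so that \<sigma>(h_1) meets
  \<sigma>(S(h_2)).\<close>

lemma tau_mult_sigma:
  assumes a: "a \<in> carrier A" and h: "h \<in> carrier H"
  shows "\<tau> (a \<cdot> \<sigma> h) = scale A (counit H h) (\<tau> a)" (is "?l = ?r")
proof (rule form_eqI[OF A.vspace])
  fix \<phi> assume \<phi>: "form A \<phi>"
  note [simp] = form_rules[OF \<phi>] linear_scale[OF \<phi>]
  have "\<phi> ?l = RA a (\<lambda>x k. csum H h (\<lambda>u v. \<phi> (x \<cdot> (\<sigma> (u \<cdot>\<^bsub>H\<^esub> S v) \<cdot> \<sigma> (S k)))))"
    using a h by (simp add: \<tau>_def)
  also have "\<dots> = \<phi> ?r"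
    using a h H.antipode_form(2)[where f = "\<lambda>w. \<phi> (x \<cdot> (\<sigma> w \<cdot> \<sigma> (S k)))" for x k]
    by (simp add: \<tau>_def del: sigma_simps(1))
  finally show "\<phi> ?l = \<phi> ?r" .
qed (use a h in simp_all)

lemma tau_sigma: "h \<in> carrier H \<Longrightarrow> \<tau> (\<sigma> h) = scale A (counit H h) \<one>"
  using tau_mult_sigma[of "\<one>" h] tau_eq[of "\<one>"] by simp

lemma counit_tau [simp]: "a \<in> carrier A \<Longrightarrow> counit A (\<tau> a) = counit A a"
  by (simp add: \<tau>_def A.counit_ssum)

lemma form_tau_sigma:
  fixes f :: "_ \<Rightarrow> 'k"
  assumes f: "form A f" and a: "a \<in> carrier A"
  shows "RA a (\<lambda>x h. f (\<tau> x \<cdot> \<sigma> h)) = f a"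
proof -
  note [simp] = form_rules[OF f]
  have "RA a (\<lambda>x h. f (\<tau> x \<cdot> \<sigma> h)) = RA a (\<lambda>x z. csum H z (\<lambda>k h. f (x \<cdot> \<sigma> (S k \<cdot>\<^bsub>H\<^esub> h))))"
    using a by (simp add: \<tau>_def sum_assoc triform_def)
  also have "\<dots> = f a"
    using a H.antipode_form(1)[where f = "\<lambda>w. f (x \<cdot> \<sigma> w)" for x] by (simp del: sigma_simps(1))
  finally show ?thesis .
qed

text \<open>Between \<open>s\<close> and \<open>t\<close> stands \<sigma>(S(h_2)) \<sigma>(h_3),
  which cancels. Thus \<open>A\<close> is a module algebra under \<open>ad\<close>.\<close>

lemma form_ad_mult:
  fixes f :: "_ \<Rightarrow> 'k"
  assumes f: "form A f" and h: "h \<in> carrier H" and s: "s \<in> carrier A" and t: "t \<in> carrier A"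
  shows "csum H h (\<lambda>x y. f (ad x s \<cdot> ad y t)) = f (ad h (s \<cdot> t))"
proof -
  note [simp] = form_rules[OF f]
  have "csum H h (\<lambda>x y. f (ad x s \<cdot> ad y t)) = csum H h (\<lambda>x y. csum H y (\<lambda>u v. csum H x (\<lambda>p k.
      f (\<sigma> p \<cdot> (s \<cdot> (\<sigma> (S k \<cdot>\<^bsub>H\<^esub> u) \<cdot> (t \<cdot> \<sigma> (S v))))))))"
    using h s t by (simp add: ad_def)
  also have "\<dots> = csum H h (\<lambda>x y. csum H x (\<lambda>p k. csum H y (\<lambda>u v.
      f (\<sigma> p \<cdot> (s \<cdot> (\<sigma> (S k \<cdot>\<^bsub>H\<^esub> u) \<cdot> (t \<cdot> \<sigma> (S v))))))))"
    by (rule ssum_cong[OF refl], rule ssum_swap)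
  also have "\<dots> = csum H h (\<lambda>p z. csum H z (\<lambda>k h. csum H h
      (\<lambda>x y. f (\<sigma> p \<cdot> (s \<cdot> (\<sigma> (S k \<cdot>\<^bsub>H\<^esub> x) \<cdot> (t \<cdot> \<sigma> (S y))))))))"
    using h s t by (simp add: H.csum_assoc triform_def)
  also have "\<dots> = f (ad h (s \<cdot> t))"
    using h s t H.antipode_biform(1)[where K = "\<lambda>w y. f (\<sigma> p \<cdot> (s \<cdot> (\<sigma> w \<cdot> (t \<cdot> \<sigma> (S y)))))" for p]
    by (simp add: ad_def del: sigma_simps(1))
  finally show ?thesis .
qed

lemma ad_unit: "h \<in> carrier H \<Longrightarrow> ad h \<one> = scale A (counit H h) \<one>" (is "_ \<Longrightarrow> _ = ?r")
proof (rule form_eqI[OF A.vspace])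
  fix \<phi> assume h: "h \<in> carrier H" and \<phi>: "form A \<phi>"
  note [simp] = form_rules[OF \<phi>] linear_scale[OF \<phi>]
  have "\<phi> (ad h \<one>) = csum H h (\<lambda>x y. \<phi> (\<sigma> (x \<cdot>\<^bsub>H\<^esub> S y)))"
    using h by (simp add: ad_def)
  also have "\<dots> = \<phi> ?r"
    using h H.antipode_form(2)[where f = "\<lambda>w. \<phi> (\<sigma> w)"] by (simp del: sigma_simps(1))
  finally show "\<phi> (ad h \<one>) = \<phi> ?r" .
qed simp_all

lemma unit_ad: "t \<in> carrier A \<Longrightarrow> ad \<one>\<^bsub>H\<^esub> t = t"
  by (simp add: ad_def ssum_tens[where U = A])

lemma counit_ad [simp]:
  "h \<in> carrier H \<Longrightarrow> t \<in> carrier A \<Longrightarrow> counit A (ad h t) = counit H h * counit A t"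
  by (simp add: ad_def A.counit_ssum mult.assoc)

text \<open>For coinvariant \<open>r\<close> only \<sigma>(h) contributes to the right coaction of
  the product. The point of the identity is that \<open>ad\<close> preserves coinvariants, since
  \<open>\<tau>\<close> takes its values there.\<close>

lemma ad_coinvariant:
  assumes h: "h \<in> carrier H" and r: "r \<in> carrier A" "rco r = r \<otimes>\<^bsub>A,H\<^esub> \<one>\<^bsub>H\<^esub>"
  shows "ad h r = \<tau> (\<sigma> h \<cdot> r)"
proof (rule form_eqI[OF A.vspace])
  fix \<phi> assume \<phi>: "form A \<phi>"
  note [simp] = form_rules[OF \<phi>]
  show "\<phi> (ad h r) = \<phi> (\<tau> (\<sigma> h \<cdot> r))"
    using h r by (simp add: ad_def \<tau>_def)
qed (use h r in simp_all)

text \<open>The Yetter-Drinfeld compatibility. It follows from multiplicativity of the left coaction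
  and left colinearity of \<open>\<sigma>\<close>: the reversed coproduct of S(h_2) leaves S(h_4) in
  \<open>H\<close> and \<sigma>(S(h_3)) in \<open>A\<close>, and the two middle legs recombine to
  \<open>ad\<close>.\<close>

lemma LA_ad:
  fixes G :: "_ \<Rightarrow> _ \<Rightarrow> 'k"
  assumes G: "biform H A G" and h: "h \<in> carrier H" and t: "t \<in> carrier A"
  shows "LA (ad h t) G = csum H h (\<lambda>x z. csum H z (\<lambda>y z. LA t (\<lambda>b u. G (x \<cdot>\<^bsub>H\<^esub> (b \<cdot>\<^bsub>H\<^esub> S z)) (ad y u))))"
proof -
  note [simp] = bilinear_rules[OF G]
  have "LA (ad h t) G = csum H h (\<lambda>x z. csum H x (\<lambda>x1 x2. LA t (\<lambda>b u. csum H z (\<lambda>z1 z2.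
       G (x1 \<cdot>\<^bsub>H\<^esub> (b \<cdot>\<^bsub>H\<^esub> S z2)) (\<sigma> x2 \<cdot> (u \<cdot> \<sigma> (S z1)))))))"
    using h t by (simp add: ad_def)
  also have "\<dots> = csum H h (\<lambda>x z. csum H z (\<lambda>y z. csum H z (\<lambda>z1 z2. LA t (\<lambda>b u. 
       G (x \<cdot>\<^bsub>H\<^esub> (b \<cdot>\<^bsub>H\<^esub> S z2)) (\<sigma> y \<cdot> (u \<cdot> \<sigma> (S z1)))))))"
    using h t by (simp add: H.csum_assoc triform_def ssum_swap[where t = "lco t"])
  also have "\<dots> = csum H h (\<lambda>x z. csum H z (\<lambda>y z. csum H y (\<lambda>z1 z2. LA t (\<lambda>b u. 
       G (x \<cdot>\<^bsub>H\<^esub> (b \<cdot>\<^bsub>H\<^esub> S z)) (\<sigma> z1 \<cdot> (u \<cdot> \<sigma> (S z2)))))))"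
    using h t by (simp add: H.csum_assoc triform_def)
  also have "\<dots> = csum H h (\<lambda>x z. csum H z (\<lambda>y z. LA t (\<lambda>b u. G (x \<cdot>\<^bsub>H\<^esub> (b \<cdot>\<^bsub>H\<^esub> S z)) (ad y u))))"
    using h t by (simp add: ad_def biform_ssum[OF G] ssum_swap[where t = "lco t"])
  finally show ?thesis .
qed

section \<open>The comultiplication of the diagram\<close>

definition \<delta> where "\<delta> a = csum A a (\<lambda>x y. \<tau> x \<otimes>\<^bsub>A,A\<^esub> \<tau> y)"

text \<open>\<open>mAA\<close> and \<open>adAA\<close> repeat the braided product and the diagonal
  action of \<open>yd_tensor\<close> on all of A \<otimes> A, so that computations need not keep
  track of coinvariance. On tensors over the diagram they are the operations of
  \<open>yd_tensor\<close>, by \<open>RR_mult\<close> and \<open>RR_act\<close>.\<close>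

definition mAA where
  "mAA s t = ssum A A s (\<lambda>r s. ssum A A t (\<lambda>t v. LA s (\<lambda>a s0. (r \<cdot> ad a t) \<otimes>\<^bsub>A,A\<^esub> (s0 \<cdot> v))))"

definition adAA where
  "adAA h t = ssum A A t (\<lambda>u v. csum H h (\<lambda>x y. ad x u \<otimes>\<^bsub>A,A\<^esub> ad y v))"

lemma delta_linear: "linear_on A (A \<Otimes> A) \<delta>"
  unfolding \<delta>_def[abs_def] by simp

lemma mAA_bilinear: "bilinear_on (A \<Otimes> A) (A \<Otimes> A) (A \<Otimes> A) mAA"
  unfolding mAA_def by simp

lemma adAA_bilinear: "bilinear_on H (A \<Otimes> A) (A \<Otimes> A) adAA"
  unfolding adAA_def by simp

lemmas linear_delta [simp] = linear_compose[OF delta_linear]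
lemmas linear_mAA [simp] = bilinear_rules[OF mAA_bilinear]
lemmas linear_adAA [simp] = bilinear_rules[OF adAA_bilinear]

lemma delta_closed [simp]: "a \<in> carrier A \<Longrightarrow> \<delta> a \<in> carrier (A \<Otimes> A)"
  and mAA_closed [simp]: "s \<in> carrier (A \<Otimes> A) \<Longrightarrow> t \<in> carrier (A \<Otimes> A) \<Longrightarrow> mAA s t \<in> carrier (A \<Otimes> A)"
  and adAA_closed [simp]: "h \<in> carrier H \<Longrightarrow> t \<in> carrier (A \<Otimes> A) \<Longrightarrow> adAA h t \<in> carrier (A \<Otimes> A)"
  by (simp_all add: \<delta>_def mAA_def adAA_def)

lemma ssum_delta [simp]:
  fixes G :: "_ \<Rightarrow> _ \<Rightarrow> 'k"
  assumes "biform A A G" and "a \<in> carrier A"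
  shows "ssum A A (\<delta> a) G = csum A a (\<lambda>x y. G (\<tau> x) (\<tau> y))"
  using assms by (simp add: \<delta>_def)

text \<open>The left coaction of \<open>\<tau> q\<close> contains an antipode which cancels against
  the first leg of the diagonal action. What remains acts on \<open>u\<close> by the left coaction
  of a_(2) and on \<open>v\<close> by its right coaction.\<close>

lemma form_delta_ad:
  fixes G :: "_ \<Rightarrow> _ \<Rightarrow> 'k"
  assumes G: "biform A A G" and a: "a \<in> carrier A" and u: "u \<in> carrier A" and v: "v \<in> carrier A"
  shows "RA a (\<lambda>x h. csum A x (\<lambda>p q. LA (\<tau> q) (\<lambda>b q0. csum H h (\<lambda>h1 h2.
      G (\<tau> p \<cdot> ad b (ad h1 u)) (q0 \<cdot> ad h2 v)))))
    = csum A a (\<lambda>p z. LA z (\<lambda>b z. RA z (\<lambda>d k. G (\<tau> p \<cdot> ad b u) (\<tau> d \<cdot> ad k v))))"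
proof -
  note [simp] = bilinear_rules[OF G]
  have "RA a (\<lambda>x h. csum A x (\<lambda>p q. LA (\<tau> q) (\<lambda>b q0. csum H h (\<lambda>h1 h2.
      G (\<tau> p \<cdot> ad b (ad h1 u)) (q0 \<cdot> ad h2 v)))))
    = csum A a (\<lambda>p z. LA z (\<lambda>b z. RA z (\<lambda>d m. csum H m (\<lambda>l h. csum H h (\<lambda>h1 h2.
      G (\<tau> p \<cdot> ad (b \<cdot>\<^bsub>H\<^esub> (S l \<cdot>\<^bsub>H\<^esub> h1)) u) (\<tau> d \<cdot> ad h2 v))))))"
    using a u v by (simp add: sum_assoc triform_def ad_mult)
  also have "\<dots> = csum A a (\<lambda>p z. LA z (\<lambda>b z. RA z (\<lambda>d k. G (\<tau> p \<cdot> ad b u) (\<tau> d \<cdot> ad k v))))"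
    using a u v H.antipode_biform(1)[where K = "\<lambda>w k. G (\<tau> p \<cdot> ad (b \<cdot>\<^bsub>H\<^esub> w) u) (\<tau> d \<cdot> ad k v)" for p b d]
    by simp
  finally show ?thesis .
qed

lemma delta_mult:
  assumes a: "a \<in> carrier A" and b: "b \<in> carrier A"
  shows "\<delta> (a \<cdot> b) = RA a (\<lambda>x h. mAA (\<delta> x) (adAA h (\<delta> b)))" (is "_ = ?r")
proof (rule form_eqI[OF vspace_tensor])
  fix \<phi> assume \<phi>: "form (A \<Otimes> A) \<phi>"
  note [simp] = form_rules[OF \<phi>]
  have "\<phi> ?r
    = RA a (\<lambda>x h. csum A x (\<lambda>p q. csum A b (\<lambda>u v. csum H h (\<lambda>h1 h2. LA (\<tau> q) (\<lambda>c q0.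
      \<phi> ((\<tau> p \<cdot> ad c (ad h1 (\<tau> u))) \<otimes>\<^bsub>A,A\<^esub> (q0 \<cdot> ad h2 (\<tau> v))))))))"
    using a b by (simp add: mAA_def adAA_def)
  also have "\<dots> = RA a (\<lambda>x h. csum A x (\<lambda>p q. csum A b (\<lambda>u v. LA (\<tau> q) (\<lambda>c q0. csum H h (\<lambda>h1 h2.
      \<phi> ((\<tau> p \<cdot> ad c (ad h1 (\<tau> u))) \<otimes>\<^bsub>A,A\<^esub> (q0 \<cdot> ad h2 (\<tau> v))))))))"
    by (rule ssum_cong[OF refl], rule ssum_cong[OF refl], rule ssum_cong[OF refl], rule ssum_swap)
  also have "\<dots> = csum A b (\<lambda>u v. RA a (\<lambda>x h. csum A x (\<lambda>p q. LA (\<tau> q) (\<lambda>c q0. csum H h (\<lambda>h1 h2.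
      \<phi> ((\<tau> p \<cdot> ad c (ad h1 (\<tau> u))) \<otimes>\<^bsub>A,A\<^esub> (q0 \<cdot> ad h2 (\<tau> v))))))))"
    by (simp only: ssum_swap[where t' = "comult A b"])
  also have "\<dots> = csum A b (\<lambda>u v. csum A a (\<lambda>p z. LA z (\<lambda>c z. RA z (\<lambda>d k.
      \<phi> ((\<tau> p \<cdot> ad c (\<tau> u)) \<otimes>\<^bsub>A,A\<^esub> (\<tau> d \<cdot> ad k (\<tau> v)))))))"
    using a b by (intro ssum_cong refl form_delta_ad) simp_all
  \<comment> \<open>The left coaction on the second leg is read as a right coaction on the first.
    Both legs then have the shape of \<open>tau_mult\<close>.\<close>
  also have "\<dots> = csum A b (\<lambda>u v. csum A a (\<lambda>x y. RA x (\<lambda>p c. RA y (\<lambda>d k.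
      \<phi> ((\<tau> p \<cdot> ad c (\<tau> u)) \<otimes>\<^bsub>A,A\<^esub> (\<tau> d \<cdot> ad k (\<tau> v)))))))"
    using a b by (simp add: sum_assoc triform_def)
  also have "\<dots> = csum A a (\<lambda>x y. csum A b (\<lambda>u v. RA x (\<lambda>p c. RA y (\<lambda>d k.
      \<phi> ((\<tau> p \<cdot> ad c (\<tau> u)) \<otimes>\<^bsub>A,A\<^esub> (\<tau> d \<cdot> ad k (\<tau> v)))))))"
    by (rule ssum_swap)
  also have "\<dots> = csum A a (\<lambda>x y. csum A b (\<lambda>u v. RA y (\<lambda>d k. RA x (\<lambda>p c.
      \<phi> ((\<tau> p \<cdot> ad c (\<tau> u)) \<otimes>\<^bsub>A,A\<^esub> (\<tau> d \<cdot> ad k (\<tau> v)))))))"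
    by (rule ssum_cong[OF refl], rule ssum_cong[OF refl], rule ssum_swap)
  also have "\<dots> = \<phi> (\<delta> (a \<cdot> b))"
    using a b by (simp add: \<delta>_def tau_mult)
  finally show "\<phi> (\<delta> (a \<cdot> b)) = \<phi> ?r" by simp
qed (use a b in simp_all)

text \<open>The right coaction of \<open>a\<close> moves to the second leg a_(2) of the coproduct,
  which \<open>form_tau_sigma\<close> reassembles.\<close>

lemma form_coassoc_left:
  fixes G :: "_ \<Rightarrow> _ \<Rightarrow> 'k"
  assumes G: "biform A A G" and a: "a \<in> carrier A"
  shows "RA a (\<lambda>x k. csum A x (\<lambda>p q. G p (\<tau> q \<cdot> \<sigma> k))) = csum A a G"
proof -
  note [simp] = bilinear_rules[OF G]
  show ?thesis
    using a form_tau_sigma[where f = "G p" for p] by (simp add: sum_assoc triform_def)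
qed

text \<open>The antipode from the coaction of \<open>\<tau> q\<close> cancels against
  \<open>k\<close>. The remaining left coaction on a_(2) is read as a right coaction on a_(1), so
  that \<open>form_tau_sigma\<close> reassembles the first leg.\<close>

lemma form_coassoc_right:
  fixes G :: "_ \<Rightarrow> _ \<Rightarrow> 'k"
  assumes G: "biform A A G" and a: "a \<in> carrier A"
  shows "RA a (\<lambda>x k. csum A x (\<lambda>p q. LA (\<tau> q) (\<lambda>c t. G (\<tau> p \<cdot> \<sigma> (c \<cdot>\<^bsub>H\<^esub> k)) t)))
    = csum A a (\<lambda>p z. G p (\<tau> z))"
proof -
  note [simp] = bilinear_rules[OF G]
  have "RA a (\<lambda>x k. csum A x (\<lambda>p q. LA (\<tau> q) (\<lambda>c t. G (\<tau> p \<cdot> \<sigma> (c \<cdot>\<^bsub>H\<^esub> k)) t)))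
    = csum A a (\<lambda>p z. LA z (\<lambda>b z. RA z (\<lambda>d m. csum H m (\<lambda>l k. G (\<tau> p \<cdot> (\<sigma> b \<cdot> \<sigma> (S l \<cdot>\<^bsub>H\<^esub> k))) (\<tau> d)))))"
    using a by (simp add: sum_assoc triform_def)
  also have "\<dots> = csum A a (\<lambda>p z. LA z (\<lambda>b z. G (\<tau> p \<cdot> \<sigma> b) (\<tau> z)))"
    using a H.antipode_form(1)[where f = "\<lambda>w. G (\<tau> p \<cdot> (\<sigma> b \<cdot> \<sigma> w)) (\<tau> d)" for p b d]
    by (simp del: sigma_simps(1))
  also have "\<dots> = csum A a (\<lambda>x z. RA x (\<lambda>p b. G (\<tau> p \<cdot> \<sigma> b) (\<tau> z)))"
    using a by (simp add: sum_assoc triform_def)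
  also have "\<dots> = csum A a (\<lambda>p z. G p (\<tau> z))"
    using a form_tau_sigma[where f = "\<lambda>w. G w (\<tau> z)" for z] by simp
  finally show ?thesis .
qed

text \<open>The antipode produced by the first leg cancels against the left coaction of the second.
  At a coinvariant \<open>a\<close> the right coaction is trivial and this becomes colinearity of
  \<open>\<delta>\<close>; at \<sigma>(h) the outer factor is h_1 S(h_3), as in the coaction axiom
  for \<open>\<omega>\<close>.\<close>

lemma form_coaction_delta:
  fixes G :: "_ \<Rightarrow> _ \<Rightarrow> _ \<Rightarrow> 'k"
  assumes G: "triform H A A G" and a: "a \<in> carrier A"
  shows "csum A a (\<lambda>x y. LA (\<tau> x) (\<lambda>b u. LA (\<tau> y) (\<lambda>c v. G (b \<cdot>\<^bsub>H\<^esub> c) u v)))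
    = LA a (\<lambda>b z. RA z (\<lambda>w k. csum A w (\<lambda>x y. G (b \<cdot>\<^bsub>H\<^esub> S k) (\<tau> x) (\<tau> y))))"
proof -
  note [simp] = triform_compose[OF G]
  have "csum A a (\<lambda>x y. LA (\<tau> x) (\<lambda>b u. LA (\<tau> y) (\<lambda>c v. G (b \<cdot>\<^bsub>H\<^esub> c) u v)))
    = csum A a (\<lambda>x y. LA x (\<lambda>b x. RA x (\<lambda>u h. LA y (\<lambda>c y. RA y (\<lambda>v k. G (b \<cdot>\<^bsub>H\<^esub> (S h \<cdot>\<^bsub>H\<^esub> (c \<cdot>\<^bsub>H\<^esub> S k))) (\<tau> u) (\<tau> v))))))"
    using a G by (simp add: triform_def)
  also have "\<dots> = LA a (\<lambda>b z. csum A z (\<lambda>u z. LA z (\<lambda>h z. LA z (\<lambda>c y. RA y (\<lambda>v k.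
      G (b \<cdot>\<^bsub>H\<^esub> (S h \<cdot>\<^bsub>H\<^esub> (c \<cdot>\<^bsub>H\<^esub> S k))) (\<tau> u) (\<tau> v))))))"
    using a by (simp add: sum_assoc triform_def)
  also have "\<dots> = LA a (\<lambda>b z. csum A z (\<lambda>u z. LA z (\<lambda>h z. csum H h (\<lambda>h c. RA z (\<lambda>v k.
      G (b \<cdot>\<^bsub>H\<^esub> ((S h \<cdot>\<^bsub>H\<^esub> c) \<cdot>\<^bsub>H\<^esub> S k)) (\<tau> u) (\<tau> v))))))"
    using a by (simp add: sum_assoc triform_def)
  also have "\<dots> = LA a (\<lambda>b z. csum A z (\<lambda>u z. RA z (\<lambda>v k. G (b \<cdot>\<^bsub>H\<^esub> S k) (\<tau> u) (\<tau> v))))"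
    using a H.antipode_form(1)[where f = "\<lambda>w. RA z (\<lambda>v k. G (b \<cdot>\<^bsub>H\<^esub> (w \<cdot>\<^bsub>H\<^esub> S k)) (\<tau> u) (\<tau> v))" for z b u]
    by (simp del: H.mult_assoc)
  also have "\<dots> = LA a (\<lambda>b z. RA z (\<lambda>w k. csum A w (\<lambda>x y. G (b \<cdot>\<^bsub>H\<^esub> S k) (\<tau> x) (\<tau> y))))"
    using a by (simp add: sum_assoc triform_def)
  finally show ?thesis .
qed

subsection \<open>The Hopf bimodule of a splitting\<close>

abbreviation V where "V \<equiv> hopf_bimod_via H A \<pi> \<sigma>"

lemma V_space: "carrier V = carrier A" "scale V = scale A"
  by (simp_all add: hopf_bimod_via_def)

interpretation V: same_space A V
  by standard (simp_all add: V_space)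

lemma V_act: "lact V = (\<lambda>h a. \<sigma> h \<cdot> a)" "ract V = (\<lambda>a h. a \<cdot> \<sigma> h)"
  by (simp_all add: hopf_bimod_via_def)

lemma V_simps [simp]:
  "lact V h a = \<sigma> h \<cdot> a" "ract V a h = a \<cdot> \<sigma> h"
  "a \<in> carrier A \<Longrightarrow> lcoact V a = lco a" "a \<in> carrier A \<Longrightarrow> rcoact V a = rco a"
  by (simp_all add: hopf_bimod_via_def bicomod_via_def lco_def rco_def)

lemma V_coact_linear: "linear_on A (H \<Otimes> A) (lcoact V)" "linear_on A (A \<Otimes> H) (rcoact V)"
  by (rule linear_on_eqI[OF lco_linear]; simp) (rule linear_on_eqI[OF rco_linear]; simp)

lemma V_bicomodule: "is_bicomodule H V"
proof -
  have 1: "tensor_assoc H H A (tsum H A (lco a) (\<lambda>b x. comult H b \<otimes>\<^bsub>H \<Otimes> H, A\<^esub> x))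
      = tsum H A (lco a) (\<lambda>b x. b \<otimes>\<^bsub>H, H \<Otimes> A\<^esub> lcoact V x)" (is "?l = ?r") if a: "a \<in> carrier A" for a
  proof (rule tensor3_eqI[of H H A])
    fix G :: "'h \<Rightarrow> 'h \<Rightarrow> 'a \<Rightarrow> 'k" assume "triform H H A G"
    note G = triform_compose[OF this] this
    note [simp] = G(1-3)
    show "ssum H (H \<Otimes> A) ?l (\<lambda>u p. ssum H A p (G u))
      = ssum H (H \<Otimes> A) ?r (\<lambda>u p. ssum H A p (G u))"
      using a G(4) by (simp add: form_tensor_assoc tsum_ssum sum_assoc triform_def)
  qed (use a in \<open>simp_all add: tsum_ssum\<close>)
  have 2: "tensor_assoc A H H (tsum A H (rco a) (\<lambda>x b. rcoact V x \<otimes>\<^bsub>A \<Otimes> H, H\<^esub> b))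
      = tsum A H (rco a) (\<lambda>x b. x \<otimes>\<^bsub>A, H \<Otimes> H\<^esub> comult H b)" (is "?l = ?r") if a: "a \<in> carrier A" for a
  proof (rule tensor3_eqI[of A H H])
    fix G :: "'a \<Rightarrow> 'h \<Rightarrow> 'h \<Rightarrow> 'k" assume "triform A H H G"
    note G = triform_compose[OF this] this
    note [simp] = G(1-3)
    show "ssum A (H \<Otimes> H) ?l (\<lambda>u p. ssum H H p (G u))
      = ssum A (H \<Otimes> H) ?r (\<lambda>u p. ssum H H p (G u))"
      using a G(4) by (simp add: form_tensor_assoc tsum_ssum sum_assoc triform_def)
  qed (use a in \<open>simp_all add: tsum_ssum\<close>)
  have 3: "tensor_assoc H A H (tsum A H (rco a) (\<lambda>x b. lcoact V x \<otimes>\<^bsub>H \<Otimes> A, H\<^esub> b))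
      = tsum H A (lco a) (\<lambda>b x. b \<otimes>\<^bsub>H, A \<Otimes> H\<^esub> rcoact V x)" (is "?l = ?r") if a: "a \<in> carrier A" for a
  proof (rule tensor3_eqI[of H A H])
    fix G :: "'h \<Rightarrow> 'a \<Rightarrow> 'h \<Rightarrow> 'k" assume "triform H A H G"
    note G = triform_compose[OF this] this
    note [simp] = G(1-3)
    show "ssum H (A \<Otimes> H) ?l (\<lambda>u p. ssum A H p (G u))
      = ssum H (A \<Otimes> H) ?r (\<lambda>u p. ssum A H p (G u))"
      using a G(4) by (simp add: form_tensor_assoc tsum_ssum sum_assoc triform_def)
  qed (use a in \<open>simp_all add: tsum_ssum\<close>)
  have 4: "tsum H A (lco a) (\<lambda>b x. scale A (counit H b) x) = a \<and> tsum A H (rco a) (\<lambda>x b. scale A (counit H b) x) = a"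
    if a: "a \<in> carrier A" for a
  proof -
    have "\<phi> (tsum H A (lco a) (\<lambda>b x. scale A (counit H b) x)) = \<phi> a"
      "\<phi> (tsum A H (rco a) (\<lambda>x b. scale A (counit H b) x)) = \<phi> a" if \<phi>: "form A \<phi>" for \<phi>
    proof -
      note [simp] = form_rules[OF \<phi>] linear_scale[OF \<phi>]
      show "\<phi> (tsum H A (lco a) (\<lambda>b x. scale A (counit H b) x)) = \<phi> a"
        "\<phi> (tsum A H (rco a) (\<lambda>x b. scale A (counit H b) x)) = \<phi> a"
        using a \<phi> by (simp_all add: tsum_ssum)
    qed
    with a show ?thesis
      by (auto intro!: form_eqI[OF A.vspace] simp: tsum_ssum)
  qed
  show ?thesis
    unfolding is_bicomodule_def left_comodule_def right_comodule_def
    using 1 2 3 4 V_coact_linear by simp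
qed

text \<open>The coactions are multiplicative and \<open>\<sigma>\<close> is bicolinear, so each of
  the four compatibilities is the coaction of a product with one factor \<sigma>(h).\<close>

lemma V_hopf_bimodule: "is_hopf_bimodule H V"
proof -
  have [simp]: "linear_on A A (lact V h)" "linear_on A A (\<lambda>a. ract V a h)" if "h \<in> carrier H" for h
    using that unfolding V_act by simp_all
  have [simp]: "linear_on H A (\<lambda>h. lact V h a)" "linear_on H A (ract V a)" if "a \<in> carrier A" for a
    using that unfolding V_act by simp_all
  have mod: "left_module H V (lact V)" "right_module H V (ract V)"
    by (simp_all add: left_module_def right_module_def)
  have "lco (\<sigma> h \<cdot> a) = csum H h (\<lambda>h1 h2. LA a (\<lambda>b x. (h1 \<cdot>\<^bsub>H\<^esub> b) \<otimes>\<^bsub>H,A\<^esub> (\<sigma> h2 \<cdot> x)))" (is "?l = ?r")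
    if h: "h \<in> carrier H" and a: "a \<in> carrier A" for h a
  proof (rule form_eqI[OF vspace_tensor])
    fix \<phi> assume \<phi>: "form (H \<Otimes> A) \<phi>"
    note [simp] = form_rules[OF \<phi>]
    show "\<phi> ?l = \<phi> ?r"
      using a h by (subst form_tensor[OF \<phi>, of ?l]) (simp_all)
  qed (use a h in simp_all)
  moreover have "lco (a \<cdot> \<sigma> h) = csum H h (\<lambda>h1 h2. LA a (\<lambda>b x. (b \<cdot>\<^bsub>H\<^esub> h1) \<otimes>\<^bsub>H,A\<^esub> (x \<cdot> \<sigma> h2)))" (is "?l = ?r")
    if h: "h \<in> carrier H" and a: "a \<in> carrier A" for h a
  proof (rule form_eqI[OF vspace_tensor])
    fix \<phi> assume \<phi>: "form (H \<Otimes> A) \<phi>"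
    note [simp] = form_rules[OF \<phi>]
    show "\<phi> ?l = \<phi> ?r"
      using a h by (subst form_tensor[OF \<phi>, of ?l]) (simp_all add: ssum_swap[where t = "lco a"])
  qed (use a h in simp_all)
  moreover have "rco (\<sigma> h \<cdot> a) = csum H h (\<lambda>h1 h2. RA a (\<lambda>x b. (\<sigma> h1 \<cdot> x) \<otimes>\<^bsub>A,H\<^esub> (h2 \<cdot>\<^bsub>H\<^esub> b)))" (is "?l = ?r")
    if h: "h \<in> carrier H" and a: "a \<in> carrier A" for h a
  proof (rule form_eqI[OF vspace_tensor])
    fix \<phi> assume \<phi>: "form (A \<Otimes> H) \<phi>"
    note [simp] = form_rules[OF \<phi>]
    show "\<phi> ?l = \<phi> ?r"
      using a h by (subst form_tensor[OF \<phi>, of ?l]) (simp_all)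
  qed (use a h in simp_all)
  moreover have "rco (a \<cdot> \<sigma> h) = csum H h (\<lambda>h1 h2. RA a (\<lambda>x b. (x \<cdot> \<sigma> h1) \<otimes>\<^bsub>A,H\<^esub> (b \<cdot>\<^bsub>H\<^esub> h2)))" (is "?l = ?r")
    if h: "h \<in> carrier H" and a: "a \<in> carrier A" for h a
  proof (rule form_eqI[OF vspace_tensor])
    fix \<phi> assume \<phi>: "form (A \<Otimes> H) \<phi>"
    note [simp] = form_rules[OF \<phi>]
    show "\<phi> ?l = \<phi> ?r"
      using a h by (subst form_tensor[OF \<phi>, of ?l]) (simp_all add: ssum_swap[where t = "rco a"])
  qed (use a h in simp_all)
  ultimately show ?thesis
    unfolding is_hopf_bimodule_def
    using mod V_bicomodule by (simp add: tsum_ssum)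
qed

lemma V_coaction_hom:
  "algebra_hom A (tensor_algebra H A) (lcoact V)" "algebra_hom A (tensor_algebra A H) (rcoact V)"
proof -
  have alg: "is_algebra A" "is_algebra H" by (fact A.algebra H.algebra)+
  have "lco (a \<cdot> b) = lco a \<cdot>\<^bsub>tensor_algebra H A\<^esub> lco b" (is "?l = ?r") if ab: "a \<in> carrier A" "b \<in> carrier A" for a b
  proof (rule form_eqI[OF vspace_tensor])
    fix \<phi> assume \<phi>: "form (H \<Otimes> A) \<phi>"
    note [simp] = form_rules[OF \<phi>]
    show "\<phi> ?l = \<phi> ?r"
      using ab by (subst form_tensor[OF \<phi>, of "lco (a \<cdot> b)"]) (simp_all add: tensor_algebra_mult alg)
  qed (use ab in \<open>simp_all add: tensor_algebra_mult alg\<close>)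
  then show "algebra_hom A (tensor_algebra H A) (lcoact V)"
    unfolding algebra_hom_def using V_coact_linear by simp
  have "rco (a \<cdot> b) = rco a \<cdot>\<^bsub>tensor_algebra A H\<^esub> rco b" (is "?l = ?r") if ab: "a \<in> carrier A" "b \<in> carrier A" for a b
  proof (rule form_eqI[OF vspace_tensor])
    fix \<phi> assume \<phi>: "form (A \<Otimes> H) \<phi>"
    note [simp] = form_rules[OF \<phi>]
    show "\<phi> ?l = \<phi> ?r"
      using ab by (subst form_tensor[OF \<phi>, of "rco (a \<cdot> b)"]) (simp_all add: tensor_algebra_mult alg)
  qed (use ab in \<open>simp_all add: tensor_algebra_mult alg\<close>)
  then show "algebra_hom A (tensor_algebra A H) (rcoact V)"
    unfolding algebra_hom_def using V_coact_linear by simp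
qed

section \<open>The multiplication as a map on the tensor product over H\<close>

abbreviation VV where "VV \<equiv> balanced_space H V V"
abbreviation T where "T \<equiv> hopf_bimod_tensor H V V"
abbreviation bt where "bt \<equiv> btens H V V"

lemma T_space: "carrier T = carrier VV" "scale T = scale VV" "scale VV = tscale"
  by (simp_all add: hopf_bimod_tensor_def Let_def balanced_space_def)

interpretation T: same_space VV T
  by standard (simp_all add: T_space)

lemma linear_bt [simp]:
  "linear_on U A g \<Longrightarrow> n \<in> carrier A \<Longrightarrow> linear_on U VV (\<lambda>x. bt (g x) n)"
  "linear_on U A g \<Longrightarrow> n \<in> carrier A \<Longrightarrow> linear_on U VV (\<lambda>x. bt n (g x))"
  using bilinear_compose1[OF bilinear_btens[of V V H], of U g n]
    bilinear_compose2[OF bilinear_btens[of V V H], of U g n] by (simp_all add: V_space)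

lemma bt_closed [simp]: "m \<in> carrier A \<Longrightarrow> n \<in> carrier A \<Longrightarrow> bt m n \<in> carrier VV"
  using linear_closed[OF linear_bt(1)[OF linear_ident]] by blast

lemma bt_balanced [simp]:
  "m \<in> carrier A \<Longrightarrow> h \<in> carrier H \<Longrightarrow> n \<in> carrier A \<Longrightarrow> bt (m \<cdot> \<sigma> h) n = bt m (\<sigma> h \<cdot> n)"
  using balanced_btens[of m V h H n V] by (simp add: V_space)

lemma V_universal:
  assumes "vspace U" and "bilinear_on A A U f"
    and "\<And>m h n. m \<in> carrier A \<Longrightarrow> h \<in> carrier H \<Longrightarrow> n \<in> carrier A \<Longrightarrow> f (m \<cdot> \<sigma> h) n = f m (\<sigma> h \<cdot> n)"
  shows "linear_on VV U (\<lambda>t. bsum H V V t f)"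
    and "m \<in> carrier A \<Longrightarrow> n \<in> carrier A \<Longrightarrow> bsum H V V (bt m n) f = f m n"
  using balanced_universal(1,2)[of V V U f H] assms by (simp_all add: V_space)

lemma V_multiplication:
  "\<exists>\<mu>. hopf_bimodule_hom H T V \<mu> \<and> (\<forall>a\<in>carrier A. \<forall>b\<in>carrier A. a \<cdot> b = \<mu> (bt a b))"
proof -
  define \<mu> where "\<mu> t = bsum H V V t (mult A)" for t
  have mu_lin: "linear_on VV A \<mu>"
    unfolding \<mu>_def by (rule V_universal(1)) simp_all
  have mu: "\<mu> (bt a b) = a \<cdot> b" if "a \<in> carrier A" "b \<in> carrier A" for a b
    unfolding \<mu>_def by (rule V_universal(2)[where U = A]) (use that in simp_all)
  note [simp] = mu linear_compose[OF mu_lin] linear_closed[OF mu_lin] vspace_balanced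
  let ?l = "\<lambda>m n. LA m (\<lambda>a m0. LA n (\<lambda>b n0. (a \<cdot>\<^bsub>H\<^esub> b) \<otimes>\<^bsub>H,VV\<^esub> bt m0 n0))"
  let ?r = "\<lambda>m n. RA m (\<lambda>m0 a. RA n (\<lambda>n0 b. bt m0 n0 \<otimes>\<^bsub>VV,H\<^esub> (a \<cdot>\<^bsub>H\<^esub> b)))"
  \<comment> \<open>\<open>l\<close> and \<open>r\<close> are the terms occurring in
    \<open>hopf_bimod_tensor\<close>. They agree with \<open>?l\<close> and \<open>?r\<close> on the
    carriers only, so bilinearity is transferred by \<open>linear_on_eqI\<close> instead of by
    rewriting.\<close>
  define l where "l m n = tsum H A (lcoact V m) (\<lambda>a m0. tsum H A (lcoact V n) (\<lambda>b n0.
      (a \<cdot>\<^bsub>H\<^esub> b) \<otimes>\<^bsub>H,VV\<^esub> bt m0 n0))" for m n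
  define r where "r m n = tsum A H (rcoact V m) (\<lambda>m0 a. tsum A H (rcoact V n) (\<lambda>n0 b.
      bt m0 n0 \<otimes>\<^bsub>VV,H\<^esub> (a \<cdot>\<^bsub>H\<^esub> b)))" for m n
  have T: "lcoact T t = bsum H V V t l" "rcoact T t = bsum H V V t r"
    "lact T h t = bsum H V V t (\<lambda>m n. bt (\<sigma> h \<cdot> m) n)" "ract T t h = bsum H V V t (\<lambda>m n. bt m (n \<cdot> \<sigma> h))" for t h
    by (simp_all add: hopf_bimod_tensor_def Let_def l_def[abs_def] r_def[abs_def] V.same_space_simps)
  have eq: "l m n = ?l m n" "r m n = ?r m n" if "m \<in> carrier A" "n \<in> carrier A" for m n
    using that by (simp_all add: l_def r_def tsum_ssum)
  have bil: "bilinear_on A A (H \<Otimes> VV) l" "bilinear_on A A (VV \<Otimes> H) r"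
    unfolding bilinear_on_def
    by (intro conjI ballI; rule linear_on_eqI[OF _ A.vspace], rule_tac [2] eq; simp)+
  \<comment> \<open>Bicolinearity splits \<sigma>(h) into a factor in \<open>H\<close>, the same on
    both sides, and a factor in the image of \<open>\<sigma>\<close>, which
    \<open>bt_balanced\<close> moves across.\<close>
  have bal: "l (m \<cdot> \<sigma> h) n = l m (\<sigma> h \<cdot> n)" "r (m \<cdot> \<sigma> h) n = r m (\<sigma> h \<cdot> n)"
    if mhn: "m \<in> carrier A" "h \<in> carrier H" "n \<in> carrier A" for m h n
  proof -
    show "l (m \<cdot> \<sigma> h) n = l m (\<sigma> h \<cdot> n)"
    proof (rule form_eqI[OF vspace_tensor])
      fix \<phi> assume \<phi>: "form (H \<Otimes> VV) \<phi>"
      note [simp] = form_rules[OF \<phi>]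
      show "\<phi> (l (m \<cdot> \<sigma> h) n) = \<phi> (l m (\<sigma> h \<cdot> n))"
        using mhn by (simp add: eq)
    qed (use mhn in \<open>simp_all add: eq\<close>)
    show "r (m \<cdot> \<sigma> h) n = r m (\<sigma> h \<cdot> n)"
    proof (rule form_eqI[OF vspace_tensor])
      fix \<phi> assume \<phi>: "form (VV \<Otimes> H) \<phi>"
      note [simp] = form_rules[OF \<phi>]
      show "\<phi> (r (m \<cdot> \<sigma> h) n) = \<phi> (r m (\<sigma> h \<cdot> n))"
        using mhn by (simp add: eq)
    qed (use mhn in \<open>simp_all add: eq\<close>)
  qed
  note L = V_universal[OF vspace_tensor bil(1) bal(1)]
  note R = V_universal[OF vspace_tensor bil(2) bal(2)]
  note [simp] = linear_compose[OF L(1)] linear_compose[OF R(1)]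
    linear_closed[OF L(1)] linear_closed[OF R(1)]
  have lcoact: "lcoact V (\<mu> t) = tsum H T (lcoact T t) (\<lambda>a u. a \<otimes>\<^bsub>H,V\<^esub> \<mu> u)" if t: "t \<in> carrier VV" for t
  proof -
    have "lco (\<mu> t) = ssum H VV (bsum H V V t l) (\<lambda>a u. a \<otimes>\<^bsub>H,A\<^esub> \<mu> u)"
    proof (rule linear_eq_balanced[where U = "H \<Otimes> A" and f = "\<lambda>t. lco (\<mu> t)", OF _ _ _ _ t])
      fix m n assume "m \<in> carrier V" "n \<in> carrier V"
      then have mn: "m \<in> carrier A" "n \<in> carrier A" by (simp_all add: V_space)
      show "lco (\<mu> (bt m n)) = ssum H VV (bsum H V V (bt m n) l) (\<lambda>a u. a \<otimes>\<^bsub>H,A\<^esub> \<mu> u)" (is "?l = ?r")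
      proof (rule form_eqI[OF vspace_tensor])
        fix \<phi> assume \<phi>: "form (H \<Otimes> A) \<phi>"
        note [simp] = form_rules[OF \<phi>]
        show "\<phi> ?l = \<phi> ?r"
          using mn by (subst form_tensor[OF \<phi>, of "lco (\<mu> (bt m n))"]) (simp_all add: L(2) eq)
      qed (use mn in simp_all)
    qed (simp_all add: V_space)
    then show ?thesis
      using t by (simp add: T tsum_ssum)
  qed
  have rcoact: "rcoact V (\<mu> t) = tsum T H (rcoact T t) (\<lambda>u a. \<mu> u \<otimes>\<^bsub>V,H\<^esub> a)" if t: "t \<in> carrier VV" for t
  proof -
    have "rco (\<mu> t) = ssum VV H (bsum H V V t r) (\<lambda>u a. \<mu> u \<otimes>\<^bsub>A,H\<^esub> a)"
    proof (rule linear_eq_balanced[where U = "A \<Otimes> H" and f = "\<lambda>t. rco (\<mu> t)", OF _ _ _ _ t])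
      fix m n assume "m \<in> carrier V" "n \<in> carrier V"
      then have mn: "m \<in> carrier A" "n \<in> carrier A" by (simp_all add: V_space)
      show "rco (\<mu> (bt m n)) = ssum VV H (bsum H V V (bt m n) r) (\<lambda>u a. \<mu> u \<otimes>\<^bsub>A,H\<^esub> a)" (is "?l = ?r")
      proof (rule form_eqI[OF vspace_tensor])
        fix \<phi> assume \<phi>: "form (A \<Otimes> H) \<phi>"
        note [simp] = form_rules[OF \<phi>]
        show "\<phi> ?l = \<phi> ?r"
          using mn by (subst form_tensor[OF \<phi>, of "rco (\<mu> (bt m n))"]) (simp_all add: R(2) eq)
      qed (use mn in simp_all)
    qed (simp_all add: V_space)
    then show ?thesis
      using t by (simp add: T tsum_ssum)
  qed
  have act: "\<mu> (lact T h t) = \<sigma> h \<cdot> \<mu> t" "\<mu> (ract T t h) = \<mu> t \<cdot> \<sigma> h"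
    if h: "h \<in> carrier H" and t: "t \<in> carrier VV" for h t
  proof -
    have bal: "bt (\<sigma> h \<cdot> (m \<cdot> \<sigma> k)) n = bt (\<sigma> h \<cdot> m) (\<sigma> k \<cdot> n)"
      if "m \<in> carrier A" "k \<in> carrier H" "n \<in> carrier A" for m k n
      using bt_balanced[of "\<sigma> h \<cdot> m" k n] that h by simp
    note L = V_universal[of VV "\<lambda>m n. bt (\<sigma> h \<cdot> m) n"] V_universal[of VV "\<lambda>m n. bt m (n \<cdot> \<sigma> h)"]
    note [simp] = linear_compose[OF L(1)] linear_compose[OF L(3)]
    show "\<mu> (lact T h t) = \<sigma> h \<cdot> \<mu> t"
      unfolding T
      by (rule linear_eq_balanced[where U = A and f = "\<lambda>t. \<mu> (bsum H V V t (\<lambda>m n. bt (\<sigma> h \<cdot> m) n))", OF _ _ _ _ t])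
        (use h in \<open>simp_all add: V_space L bal\<close>)
    show "\<mu> (ract T t h) = \<mu> t \<cdot> \<sigma> h"
      unfolding T
      by (rule linear_eq_balanced[where U = A and f = "\<lambda>t. \<mu> (bsum H V V t (\<lambda>m n. bt m (n \<cdot> \<sigma> h)))", OF _ _ _ _ t])
        (use h in \<open>simp_all add: V_space L\<close>)
  qed
  have "hopf_bimodule_hom H T V \<mu>"
    unfolding hopf_bimodule_hom_def bicomodule_hom_def
    using mu_lin lcoact rcoact act by (simp add: T_space)
  then show ?thesis using mu by (intro exI[of _ \<mu>]) simp
qed

text \<open>All three identities are coassociativity of \<open>A\<close> with \<open>\<pi>\<close>
  applied to one of three legs: to the middle one for the cotensor condition, to an outer one for
  left and right colinearity.\<close>

lemma V_coalgebra: "becomes_coalgebra H A V"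
proof -
  have 1: "tensor_assoc A H A (tsum A A (comult A a) (\<lambda>m n. rcoact V m \<otimes>\<^bsub>A \<Otimes> H, A\<^esub> n))
      = tsum A A (comult A a) (\<lambda>m n. m \<otimes>\<^bsub>A, H \<Otimes> A\<^esub> lcoact V n)" (is "?l = ?r") if a: "a \<in> carrier A" for a
  proof (rule tensor3_eqI[of A H A])
    fix G :: "'a \<Rightarrow> 'h \<Rightarrow> 'a \<Rightarrow> 'k" assume "triform A H A G"
    note G = triform_compose[OF this] this
    note [simp] = G(1-3)
    show "ssum A (H \<Otimes> A) ?l (\<lambda>u p. ssum H A p (G u))
      = ssum A (H \<Otimes> A) ?r (\<lambda>u p. ssum H A p (G u))"
      using a G(4) by (simp add: form_tensor_assoc tsum_ssum sum_assoc triform_def)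
  qed (use a in \<open>simp_all add: tsum_ssum\<close>)
  have 2: "tensor_assoc H A A (tsum A A (comult A a) (\<lambda>m n. lcoact V m \<otimes>\<^bsub>H \<Otimes> A, A\<^esub> n))
      = tsum H A (lco a) (\<lambda>b x. b \<otimes>\<^bsub>H, A \<Otimes> A\<^esub> comult A x)" (is "?l = ?r") if a: "a \<in> carrier A" for a
  proof (rule tensor3_eqI[of H A A])
    fix G :: "'h \<Rightarrow> 'a \<Rightarrow> 'a \<Rightarrow> 'k" assume "triform H A A G"
    note G = triform_compose[OF this] this
    note [simp] = G(1-3)
    show "ssum H (A \<Otimes> A) ?l (\<lambda>u p. ssum A A p (G u))
      = ssum H (A \<Otimes> A) ?r (\<lambda>u p. ssum A A p (G u))"
      using a G(4) by (simp add: form_tensor_assoc tsum_ssum sum_assoc triform_def)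
  qed (use a in \<open>simp_all add: tsum_ssum\<close>)
  have 3: "tsum A A (comult A a) (\<lambda>m n. tsum A H (rcoact V n) (\<lambda>n0 b. (m \<otimes>\<^bsub>A,A\<^esub> n0) \<otimes>\<^bsub>A \<Otimes> A, H\<^esub> b))
      = tsum A H (rco a) (\<lambda>x b. comult A x \<otimes>\<^bsub>A \<Otimes> A, H\<^esub> b)" if a: "a \<in> carrier A" for a
  proof -
    have "csum A a (\<lambda>m n. RA n (\<lambda>n0 b. (m \<otimes>\<^bsub>A,A\<^esub> n0) \<otimes>\<^bsub>A \<Otimes> A, H\<^esub> b)) = RA a (\<lambda>x b. comult A x \<otimes>\<^bsub>A \<Otimes> A, H\<^esub> b)" (is "?l = ?r")
    proof (rule form_eqI[OF vspace_tensor])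
      fix \<phi> assume \<phi>: "form ((A \<Otimes> A) \<Otimes> H) \<phi>"
      note [simp] = form_rules[OF \<phi>]
      have "\<phi> (comult A x \<otimes>\<^bsub>A \<Otimes> A, H\<^esub> b) = csum A x (\<lambda>u v. \<phi> ((u \<otimes>\<^bsub>A,A\<^esub> v) \<otimes>\<^bsub>A \<Otimes> A, H\<^esub> b))"
        if "x \<in> carrier A" "b \<in> carrier H" for x b
        by (rule form_tensor[where \<phi> = "\<lambda>s. \<phi> (s \<otimes>\<^bsub>A \<Otimes> A, H\<^esub> b)"]) (use that in simp_all)
      then show "\<phi> ?l = \<phi> ?r"
        using a by (simp add: sum_assoc triform_def)
    qed (use a in simp_all)
    with a show ?thesis by (simp add: tsum_ssum)
  qed
  have [simp]: "tens H (cotensor H V V) = tens H (A \<Otimes> A)" "tens (cotensor H V V) H = tens (A \<Otimes> A) H"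
    by (rule tens_cong; simp add: cotensor_def)+
  have mem: "comult A a \<in> carrier (cotensor H V V)" if "a \<in> carrier A" for a
    using that 1[OF that] by (simp add: cotensor_def)
  moreover have "linear_on A (cotensor H V V) (comult A)"
    by (rule linear_on_restrict[OF A.comult_linear]) (simp_all add: cotensor_def mem[unfolded cotensor_def, simplified])
  moreover have "lcoact (cotensor H V V) (comult A a) = tsum H A (lco a) (\<lambda>b x. b \<otimes>\<^bsub>H, A \<Otimes> A\<^esub> comult A x)"
    "rcoact (cotensor H V V) (comult A a) = tsum A H (rco a) (\<lambda>x b. comult A x \<otimes>\<^bsub>A \<Otimes> A, H\<^esub> b)"
    if "a \<in> carrier A" for a
    using 2[OF that] 3[OF that] by (simp_all add: cotensor_def)
  ultimately show ?thesis
    unfolding becomes_coalgebra_def bicomodule_hom_def by (auto simp: V_space)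
qed

theorem V_compatible: "compatible_structure H A V"
  unfolding compatible_structure_def becomes_algebra_def
  using V_hopf_bimodule V_coaction_hom V_multiplication V_coalgebra by (simp add: V_space)

end

section \<open>The diagram and its bosonization\<close>

text \<open>\<open>M\<close> is only required to agree with \<open>hopf_bimod_via\<close> on the
  carriers. A given compatible structure may differ from it elsewhere, and the diagram to be
  described is the one of the given structure.\<close>

locale splitting_bimodule = splitting A H \<pi> \<sigma>
  for A :: "('k::field, 'a::ab_group_add) bialgebra" (structure) and H :: "('k, 'h::ab_group_add) hopf" and \<pi> \<sigma> +
  fixes M :: "('k, 'h, 'a) hopf_bimod"
  assumes M_space: "carrier M = carrier A" "scale M = scale A"
    and M_coact: "\<And>a. a \<in> carrier A \<Longrightarrow> lcoact M a = lco a" "\<And>a. a \<in> carrier A \<Longrightarrow> rcoact M a = rco a"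
    and M_act: "\<And>h a. h \<in> carrier H \<Longrightarrow> a \<in> carrier A \<Longrightarrow> lact M h a = \<sigma> h \<cdot> a"
      "\<And>h a. h \<in> carrier H \<Longrightarrow> a \<in> carrier A \<Longrightarrow> ract M a h = a \<cdot> \<sigma> h"
begin

abbreviation R where "R \<equiv> diagram H A M"
abbreviation RR where "RR \<equiv> yd_tensor H R R"

lemma mem_R: "r \<in> carrier R \<longleftrightarrow> r \<in> carrier A \<and> rco r = r \<otimes>\<^bsub>A,H\<^esub> \<one>\<^bsub>H\<^esub>"
  by (auto simp: diagram_def coinvariants_def M_space M_coact tens_cong[of M A H H])

lemma R_simps [simp]: "scale R = scale A" "mult R = mult A" "unit R = unit A"
  by (simp_all add: diagram_def)

lemma R_sub [simp]: "r \<in> carrier R \<Longrightarrow> r \<in> carrier A"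
  by (simp add: mem_R)

lemma R_coinv: "r \<in> carrier R \<Longrightarrow> rco r = r \<otimes>\<^bsub>A,H\<^esub> \<one>\<^bsub>H\<^esub>"
  by (simp add: mem_R)

lemma R_tau: "r \<in> carrier R \<Longrightarrow> \<tau> r = r"
  by (simp add: mem_R tau_eq)

lemma R_act [simp]: "h \<in> carrier H \<Longrightarrow> r \<in> carrier A \<Longrightarrow> act R h r = ad h r"
  by (simp add: diagram_def ad_def M_act)

lemma R_coact [simp]: "r \<in> carrier A \<Longrightarrow> coact R r = lco r"
  by (simp add: diagram_def M_coact)

lemma tau_mem_R [simp]: "a \<in> carrier A \<Longrightarrow> \<tau> a \<in> carrier R"
  by (simp add: mem_R tau_coinvariant)

lemma ad_mem_R [simp]: "h \<in> carrier H \<Longrightarrow> r \<in> carrier R \<Longrightarrow> ad h r \<in> carrier R"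
  using tau_mem_R[of "\<sigma> h \<cdot> r"] by (simp add: ad_coinvariant R_coinv)

lemma vspace_R [simp]: "vspace R"
proof -
  note lin = linear_tens(1)[OF linear_ident, of "\<one>\<^bsub>H\<^esub>" H A]
  have facts: "rco 0 = 0" "0 \<otimes>\<^bsub>A,H\<^esub> \<one>\<^bsub>H\<^esub> = 0"
    "u \<in> carrier A \<Longrightarrow> v \<in> carrier A \<Longrightarrow> rco (u + v) = rco u + rco v"
    "u \<in> carrier A \<Longrightarrow> v \<in> carrier A \<Longrightarrow> (u + v) \<otimes>\<^bsub>A,H\<^esub> \<one>\<^bsub>H\<^esub> = u \<otimes>\<^bsub>A,H\<^esub> \<one>\<^bsub>H\<^esub> + v \<otimes>\<^bsub>A,H\<^esub> \<one>\<^bsub>H\<^esub>"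
    "u \<in> carrier A \<Longrightarrow> rco (scale A c u) = tscale c (rco u)" for u v c
    using linear_zero[OF rco_linear A.vspace] linear_add[OF rco_linear] linear_scale[OF rco_linear]
      linear_zero[OF lin A.vspace] linear_add[OF lin] by simp_all
  interpret vector_space "scale A" using A.vspace by (simp add: vspace_def)
  have "subspace (carrier R)"
    by (auto simp: subspace_def mem_R facts vspaceD[OF A.vspace])
  then show ?thesis
    using vector_space_axioms by (simp add: vspace_def)
qed

lemma unit_mem_R [simp]: "\<one> \<in> carrier R"
  by (simp add: mem_R)

lemma mult_mem_R [simp]: "r \<in> carrier R \<Longrightarrow> s \<in> carrier R \<Longrightarrow> r \<cdot> s \<in> carrier R"
proof -
  assume rs: "r \<in> carrier R" "s \<in> carrier R"
  have "rco (r \<cdot> s) = (r \<cdot> s) \<otimes>\<^bsub>A,H\<^esub> \<one>\<^bsub>H\<^esub>"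
  proof (rule form_eqI[OF vspace_tensor])
    fix \<phi> assume \<phi>: "form (A \<Otimes> H) \<phi>"
    note [simp] = linear_compose[OF \<phi>]
    show "\<phi> (rco (r \<cdot> s)) = \<phi> ((r \<cdot> s) \<otimes>\<^bsub>A,H\<^esub> \<one>\<^bsub>H\<^esub>)"
      using rs by (subst form_tensor[OF \<phi>]) (simp_all add: R_coinv)
  qed (use rs in simp_all)
  with rs show ?thesis by (simp add: mem_R)
qed

lemma tens_R [simp]:
  "tens R R = tens A A" "tens H R = tens H A" "tens R H = tens A H"
  "tens R RR = tens A (A \<Otimes> A)" "tens RR R = tens (A \<Otimes> A) A" "tens H RR = tens H (A \<Otimes> A)"
  "tens (R \<Otimes> R) R = tens (A \<Otimes> A) A" "tens R (R \<Otimes> R) = tens A (A \<Otimes> A)" "tens H (R \<Otimes> R) = tens H (A \<Otimes> A)"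
  "tens (R \<Otimes> H) (R \<Otimes> H) = tens (A \<Otimes> H) (A \<Otimes> H)"
  by (rule tens_cong; simp add: yd_tensor_def)+

lemma tensor_space_R_sub:
  "t \<in> carrier (R \<Otimes> R) \<Longrightarrow> t \<in> carrier (A \<Otimes> A)"
  "s \<in> carrier (H \<Otimes> R) \<Longrightarrow> s \<in> carrier (H \<Otimes> A)"
  "u \<in> carrier (R \<Otimes> H) \<Longrightarrow> u \<in> carrier (A \<Otimes> H)"
  by (rule subsetD[OF tensor_space_mono]; simp add: subset_iff)+

lemma tens_mem_R [simp]:
  "r \<in> carrier R \<Longrightarrow> s \<in> carrier R \<Longrightarrow> r \<otimes>\<^bsub>A,A\<^esub> s \<in> carrier (R \<Otimes> R)"
  "h \<in> carrier H \<Longrightarrow> r \<in> carrier R \<Longrightarrow> h \<otimes>\<^bsub>H,A\<^esub> r \<in> carrier (H \<Otimes> R)"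
  "r \<in> carrier R \<Longrightarrow> h \<in> carrier H \<Longrightarrow> r \<otimes>\<^bsub>A,H\<^esub> h \<in> carrier (R \<Otimes> H)"
  using tens_closed[of r R s R] tens_closed[of h H r R] tens_closed[of r R h H] by auto

lemma ssum_R:
  fixes G :: "_ \<Rightarrow> _ \<Rightarrow> 'k" and G' :: "_ \<Rightarrow> _ \<Rightarrow> 'k" and G'' :: "_ \<Rightarrow> _ \<Rightarrow> 'k"
  shows "biform A A G \<Longrightarrow> t \<in> carrier (R \<Otimes> R) \<Longrightarrow> ssum R R t G = ssum A A t G"
    and "biform H A G' \<Longrightarrow> s \<in> carrier (H \<Otimes> R) \<Longrightarrow> ssum H R s G' = ssum H A s G'"
    and "biform A H G'' \<Longrightarrow> u \<in> carrier (R \<Otimes> H) \<Longrightarrow> ssum R H u G'' = ssum A H u G''"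
  by (rule ssum_subspace[where U = ground]; (simp add: subset_iff; fail)?; assumption)+

text \<open>A coinvariant is its own image under \<open>\<tau>\<close>, and the formula for the left
  coaction of \<open>\<tau> r\<close> exhibits right legs that are again values of
  \<open>\<tau>\<close>.\<close>

lemma lco_mem_R [simp]: 
  assumes "r \<in> carrier R" shows "lco r \<in> carrier (H \<Otimes> R)"
proof -
  have "lco (\<tau> r) = LA r (\<lambda>b z. RA z (\<lambda>d h. (b \<cdot>\<^bsub>H\<^esub> S h) \<otimes>\<^bsub>H,A\<^esub> \<tau> d))" (is "_ = ?r")
  proof (rule form_eqI[OF vspace_tensor])
    fix \<phi> assume \<phi>: "form (H \<Otimes> A) \<phi>"
    note [simp] = form_rules[OF \<phi>]
    show "\<phi> (lco (\<tau> r)) = \<phi> ?r"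
      using assms by (subst form_tensor[OF \<phi>]) simp_all
  qed (use assms in simp_all)
  moreover have "LA r (\<lambda>b z. RA z (\<lambda>d h. (b \<cdot>\<^bsub>H\<^esub> S h) \<otimes>\<^bsub>H,A\<^esub> \<tau> d)) \<in> carrier (H \<Otimes> R)"
    by simp
  ultimately show ?thesis by (simp add: R_tau assms)
qed

lemma delta_mem_R [simp]: "a \<in> carrier A \<Longrightarrow> \<delta> a \<in> carrier (R \<Otimes> R)"
  by (simp add: \<delta>_def)

section \<open>The tensor square of the diagram\<close>

lemma RR_simps [simp]:
  "carrier RR = carrier (R \<Otimes> R)" "scale RR = tscale" "unit RR = \<one> \<otimes>\<^bsub>A,A\<^esub> \<one>"
  by (simp_all add: yd_tensor_def)

lemma RR_mult [simp]:
  assumes s: "s \<in> carrier (R \<Otimes> R)" and t: "t \<in> carrier (R \<Otimes> R)"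
  shows "s \<cdot>\<^bsub>RR\<^esub> t = mAA s t"
proof -
  have eq: "s \<cdot>\<^bsub>RR\<^esub> t = ssum R R s (\<lambda>r s. ssum R R t (\<lambda>t v. ssum H R (lco s) (\<lambda>a s0. (r \<cdot> ad a t) \<otimes>\<^bsub>A,A\<^esub> (s0 \<cdot> v))))"
    using s t by (simp add: yd_tensor_def tsum_ssum)
  show ?thesis
  proof (rule form_eqI[OF vspace_tensor])
    fix \<phi> assume \<phi>: "form (A \<Otimes> A) \<phi>"
    note [simp] = form_rules[OF \<phi>]
    show "\<phi> (s \<cdot>\<^bsub>RR\<^esub> t) = \<phi> (mAA s t)"
      unfolding eq using s t by (simp add: mAA_def ssum_R)
  qed (use s t in \<open>simp_all add: eq tensor_space_R_sub\<close>)
qed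

lemma RR_act [simp]:
  assumes h: "h \<in> carrier H" and t: "t \<in> carrier (R \<Otimes> R)"
  shows "act RR h t = adAA h t"
proof -
  have eq: "act RR h t = ssum R R t (\<lambda>u v. csum H h (\<lambda>x y. ad x u \<otimes>\<^bsub>A,A\<^esub> ad y v))"
    using h t by (simp add: yd_tensor_def tsum_ssum)
  show ?thesis
  proof (rule form_eqI[OF vspace_tensor])
    fix \<phi> assume \<phi>: "form (A \<Otimes> A) \<phi>"
    note [simp] = form_rules[OF \<phi>]
    show "\<phi> (act RR h t) = \<phi> (adAA h t)"
      unfolding eq using h t by (simp add: adAA_def ssum_R)
  qed (use h t in \<open>simp_all add: eq tensor_space_R_sub\<close>)
qed

lemma RR_coact:
  assumes t: "t \<in> carrier (R \<Otimes> R)"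
  shows "coact RR t = ssum R R t (\<lambda>u v. ssum H R (lco u) (\<lambda>b u. ssum H R (lco v) (\<lambda>c v.
      (b \<cdot>\<^bsub>H\<^esub> c) \<otimes>\<^bsub>H,A \<Otimes> A\<^esub> (u \<otimes>\<^bsub>A,A\<^esub> v))))"
  using t by (simp add: yd_tensor_def tsum_ssum)

lemma RR_coact_closed:
  assumes t: "t \<in> carrier (R \<Otimes> R)"
  shows "coact RR t \<in> carrier (H \<Otimes> (R \<Otimes> R))"
proof -
  have [simp]: "h \<otimes>\<^bsub>H,A \<Otimes> A\<^esub> t \<in> carrier (H \<Otimes> (R \<Otimes> R))" if "h \<in> carrier H" "t \<in> carrier (R \<Otimes> R)" for h t
    using tens_closed[of h H t "R \<Otimes> R"] that by simp
  show ?thesis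
    unfolding RR_coact[OF t] by simp
qed

lemma form_RR_coact:
  fixes \<phi> :: "_ \<Rightarrow> 'k"
  assumes \<phi>: "form (H \<Otimes> (A \<Otimes> A)) \<phi>" and t: "t \<in> carrier (R \<Otimes> R)"
  shows "\<phi> (coact RR t) = ssum A A t (\<lambda>u v. LA u (\<lambda>b u. LA v (\<lambda>c v. \<phi> ((b \<cdot>\<^bsub>H\<^esub> c) \<otimes>\<^bsub>H,A \<Otimes> A\<^esub> (u \<otimes>\<^bsub>A,A\<^esub> v)))))"
proof -
  note [simp] = form_rules[OF \<phi>]
  show ?thesis
    unfolding RR_coact[OF t] using t by (simp add: ssum_R)
qed

lemma adAA_unit [simp]: "t \<in> carrier (A \<Otimes> A) \<Longrightarrow> adAA \<one>\<^bsub>H\<^esub> t = t"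
  by (simp add: adAA_def unit_ad ssum_tens[where U = "A \<Otimes> A"])

text \<open>A coinvariant has trivial right coaction, so in \<open>delta_mult\<close> only the
  action of the unit of \<open>H\<close> survives.\<close>

lemma delta_mult_R:
  assumes r: "r \<in> carrier R" and a: "a \<in> carrier A"
  shows "\<delta> (r \<cdot> a) = mAA (\<delta> r) (\<delta> a)"
  using assms by (simp add: delta_mult R_coinv ssum_tens[where U = "A \<Otimes> A"])

text \<open>Applying the counit of \<open>A\<close> to the first leg of the right coaction yields
  \<open>\<pi> r\<close>, and that coaction is r \<otimes> 1.\<close>

lemma pi_R: "r \<in> carrier R \<Longrightarrow> \<pi> r = scale H (counit A r) \<one>\<^bsub>H\<^esub>"
proof (rule form_eqI[OF H.vspace])
  fix \<phi> assume r: "r \<in> carrier R" and \<phi>: "form H \<phi>"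
  note [simp] = linear_scale[OF \<phi>]
  show "\<phi> (\<pi> r) = \<phi> (scale H (counit A r) \<one>\<^bsub>H\<^esub>)"
    using RA_counit'(2)[OF R_sub[OF r] \<phi>] \<phi> r by (simp add: R_coinv)
qed simp_all

lemma vspace_RR [simp]: "vspace RR"
  using vspace_tensor[of R R] by (simp add: vspace_def)

lemma ssum_RR:
  fixes G :: "_ \<Rightarrow> _ \<Rightarrow> 'k"
  shows "biform H (A \<Otimes> A) G \<Longrightarrow> t \<in> carrier (H \<Otimes> (R \<Otimes> R)) \<Longrightarrow> ssum H (R \<Otimes> R) t G = ssum H (A \<Otimes> A) t G"
  by (rule ssum_subspace[where U = ground]; (simp add: subset_iff tensor_space_R_sub; fail)?; assumption)

section \<open>The diagram as an algebra in Yetter-Drinfeld modules\<close>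

lemma R_algebra: "is_algebra R"
proof -
  have "linear_on R R (\<lambda>w. v \<cdot> w)" "linear_on R R (\<lambda>w. w \<cdot> v)" if "v \<in> carrier R" for v
    by (rule linear_on_restrict[of A A]; use that in \<open>simp add: subset_iff\<close>)+
  then show ?thesis by (simp add: is_algebra_def)
qed

lemma R_left_module: "left_module H R (act R)"
proof -
  have "linear_on R R (act R h)" if "h \<in> carrier H" for h
    by (rule linear_on_eqI[OF linear_on_restrict[OF linear_ad(2)[OF linear_ident that]]])
      (use that in \<open>simp_all add: subset_iff\<close>)
  moreover have "linear_on H R (\<lambda>h. act R h r)" if "r \<in> carrier R" for r
    by (rule linear_on_eqI[OF linear_on_restrict[OF linear_ad(1)[OF linear_ident R_sub[OF that]]]])
      (use that in \<open>simp_all add: subset_iff\<close>)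
  ultimately show ?thesis
    by (simp add: left_module_def ad_mult unit_ad)
qed

lemma R_left_comodule: "left_comodule H R (coact R)"
proof -
  have 1: "linear_on R (H \<Otimes> R) (coact R)"
    by (rule linear_on_eqI[OF linear_on_restrict[OF lco_linear]]) (simp_all add: subset_iff)
  have 2: "tensor_assoc H H R (tsum H R (coact R r) (\<lambda>a r0. comult H a \<otimes>\<^bsub>H \<Otimes> H, R\<^esub> r0))
      = tsum H R (coact R r) (\<lambda>a r0. a \<otimes>\<^bsub>H, H \<Otimes> R\<^esub> coact R r0)" (is "?l = ?r") if r: "r \<in> carrier R" for r
  proof (rule tensor3_eqI[of H H R])
    fix G :: "'h \<Rightarrow> 'h \<Rightarrow> 'a \<Rightarrow> 'k" assume "triform H H R G"
    note G = triform_compose[OF this] this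
    note [simp] = G(1-3)
    \<comment> \<open>\<open>G\<close> is linear only on the diagram in its last argument. Composing
      with \<open>\<tau>\<close>, which is the identity there, extends it to \<open>A\<close>; the
      sums can then be moved to H \<otimes> A, where \<open>sum_assoc\<close> applies.\<close>
    have lin: "linear_on U R (\<lambda>x. \<tau> (g x))" if "linear_on U A g" for g and U :: "('k, 'w::ab_group_add, 'z) kspace_scheme"
      by (rule linear_on_restrict[OF linear_tau[OF that]]) (use linear_closed[OF that] in simp_all)
    note [simp] = lin
    have "ssum H (H \<Otimes> R) ?l
          (\<lambda>u p. ssum H R p (G u))
        = ssum H R (lco r) (\<lambda>a r0. csum H a (\<lambda>x y. G x y (\<tau> r0)))"
      using r G(4) by (simp add: form_tensor_assoc tsum_ssum triform_def R_tau)
    also have "\<dots> = LA r (\<lambda>a r0. csum H a (\<lambda>x y. G x y (\<tau> r0)))"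
      using r by (simp add: ssum_R)
    also have "\<dots> = LA r (\<lambda>a r0. LA r0 (\<lambda>b r1. G a b (\<tau> r1)))"
      using r by (simp add: sum_assoc triform_def)
    also have "\<dots> = ssum H R (lco r) (\<lambda>a r0. ssum H R (lco r0) (\<lambda>b r1. G a b (\<tau> r1)))"
      using r by (simp add: ssum_R)
    also have "\<dots> = ssum H (H \<Otimes> R) ?r
          (\<lambda>u p. ssum H R p (G u))"
      using r G(4) by (simp add: tsum_ssum triform_def R_tau)
    finally show "ssum H (H \<Otimes> R) ?l
          (\<lambda>u p. ssum H R p (G u))
      = ssum H (H \<Otimes> R) ?r
          (\<lambda>u p. ssum H R p (G u))" .
  qed (use r in \<open>simp_all add: tsum_ssum\<close>)
  have 3: "tsum H R (coact R r) (\<lambda>a r0. scale R (counit H a) r0) = r" (is "?l = _") if r: "r \<in> carrier R" for r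
  proof (rule form_eqI[OF A.vspace])
    fix \<phi> assume \<phi>: "form A \<phi>"
    note [simp] = form_rules[OF \<phi>] linear_scale[OF \<phi>]
    show "\<phi> ?l = \<phi> r"
      using r \<phi> by (simp add: tsum_ssum ssum_R)
  qed (use r in \<open>simp_all add: tsum_ssum\<close>)
  show ?thesis using 1 2 3 by (simp add: left_comodule_def)
qed

lemma R_yd_module: "yd_module H R"
proof -
  have "coact R (act R h r) = sw3 H h (\<lambda>h1 h2 h3. tsum H R (coact R r) (\<lambda>a r0.
            (h1 \<cdot>\<^bsub>H\<^esub> a \<cdot>\<^bsub>H\<^esub> antipode H h3) \<otimes>\<^bsub>H,R\<^esub> act R h2 r0))"
    if h: "h \<in> carrier H" and r: "r \<in> carrier R" for h r
  proof -
    have eq: "sw3 H h (\<lambda>h1 h2 h3. tsum H R (coact R r) (\<lambda>a r0.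
            (h1 \<cdot>\<^bsub>H\<^esub> a \<cdot>\<^bsub>H\<^esub> antipode H h3) \<otimes>\<^bsub>H,R\<^esub> act R h2 r0))
      = csum H h (\<lambda>x z. csum H z (\<lambda>y z. ssum H R (lco r) (\<lambda>b u. (x \<cdot>\<^bsub>H\<^esub> (b \<cdot>\<^bsub>H\<^esub> S z)) \<otimes>\<^bsub>H,A\<^esub> ad y u)))"
      using h r by (simp add: sw3_def tsum_ssum)
    show ?thesis
    proof (rule form_eqI[OF vspace_tensor])
      fix \<phi> assume \<phi>: "form (H \<Otimes> A) \<phi>"
      note [simp] = form_rules[OF \<phi>]
      have "\<phi> (coact R (act R h r)) = LA (ad h r) (\<lambda>b u. \<phi> (b \<otimes>\<^bsub>H,A\<^esub> u))"
        using h r by (simp add: form_tensor[OF \<phi>, of "lco (ad h r)"])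
      also have "\<dots> = \<phi> (sw3 H h (\<lambda>h1 h2 h3. tsum H R (coact R r) (\<lambda>a r0.
            (h1 \<cdot>\<^bsub>H\<^esub> a \<cdot>\<^bsub>H\<^esub> antipode H h3) \<otimes>\<^bsub>H,R\<^esub> act R h2 r0)))"
        unfolding eq using h r by (simp add: LA_ad ssum_R)
      finally show "\<phi> (coact R (act R h r)) = \<phi> (sw3 H h (\<lambda>h1 h2 h3. tsum H R (coact R r) (\<lambda>a r0.
            (h1 \<cdot>\<^bsub>H\<^esub> a \<cdot>\<^bsub>H\<^esub> antipode H h3) \<otimes>\<^bsub>H,R\<^esub> act R h2 r0)))" .
    next
      show "sw3 H h (\<lambda>h1 h2 h3. tsum H R (coact R r) (\<lambda>a r0.
            (h1 \<cdot>\<^bsub>H\<^esub> a \<cdot>\<^bsub>H\<^esub> antipode H h3) \<otimes>\<^bsub>H,R\<^esub> act R h2 r0)) \<in> carrier (H \<Otimes> A)"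
        unfolding eq using h r by simp
    qed (use h r in simp_all)
  qed
  then show ?thesis
    by (simp add: yd_module_def R_left_module R_left_comodule)
qed

lemma R_yd_algebra: "yd_algebra H R"
proof -
  \<comment> \<open>The multiplication as a linear map on A \<otimes> A, with which the product of
    the diagram is compared so that forms on \<open>A\<close> can be used.\<close>
  define m where "m = (\<lambda>t. ssum A A t (mult A))"
  have m_lin: "linear_on (A \<Otimes> A) A m"
    unfolding m_def by simp
  have form_m: "\<phi> (m t) = ssum A A t (\<lambda>r s. \<phi> (r \<cdot> s))" if "form A \<phi>" "t \<in> carrier (A \<Otimes> A)" for \<phi> t
    using that by (simp add: m_def linear_ssum[OF that(1)])
  have m: "tsum R R t (mult R) = m t \<and> m t \<in> carrier R" if t: "t \<in> carrier (R \<Otimes> R)" for t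
  proof -
    have eq: "tsum R R t (mult R) = ssum R R t (\<lambda>r s. r \<cdot> s)"
      using t by (simp add: tsum_ssum)
    have "tsum R R t (mult R) = m t"
    proof (rule form_eqI[OF A.vspace])
      fix \<phi> assume \<phi>: "form A \<phi>"
      note [simp] = form_rules[OF \<phi>]
      show "\<phi> (tsum R R t (mult R)) = \<phi> (m t)"
        unfolding eq using t by (simp add: m_def ssum_R tensor_space_R_sub)
    next
      show "tsum R R t (mult R) \<in> carrier A"
        unfolding eq using t by simp
    qed (use t in \<open>simp_all add: m_def\<close>)
    moreover have "tsum R R t (mult R) \<in> carrier R"
      unfolding eq by (rule ssum_closed) simp_all
    ultimately show ?thesis by simp
  qed
  have 1: "linear_on RR R (\<lambda>t. tsum R R t (mult R))"
    by (rule linear_on_eqI[OF linear_on_restrict[OF m_lin]])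
      (use m in \<open>simp_all add: subset_iff tensor_space_R_sub vspace_RR\<close>)
  have 2: "tsum R R (act RR h t) (mult R) = act R h (tsum R R t (mult R))"
    if h: "h \<in> carrier H" and t: "t \<in> carrier (R \<Otimes> R)" for h t
  proof -
    have act_mem: "act RR h t \<in> carrier (R \<Otimes> R)"
      using h t by (simp add: yd_tensor_def tsum_ssum)
    have "m (adAA h t) = ad h (m t)"
    proof (rule form_eqI[OF A.vspace])
      fix \<phi> assume \<phi>: "form A \<phi>"
      note [simp] = form_rules[OF \<phi>]
      have "\<phi> (ad h (m t)) = ssum A A t (\<lambda>r s. \<phi> (ad h (r \<cdot> s)))"
        using h t form_m[of "\<lambda>x. \<phi> (ad h x)" t] by (simp add: tensor_space_R_sub)
      moreover have "\<phi> (m (adAA h t)) = ssum A A t (\<lambda>r s. \<phi> (ad h (r \<cdot> s)))"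
        using h t by (simp add: form_m[OF \<phi>] tensor_space_R_sub adAA_def form_ad_mult)
      ultimately show "\<phi> (m (adAA h t)) = \<phi> (ad h (m t))" by simp
    qed (use h t in \<open>simp_all add: m_def tensor_space_R_sub\<close>)
    then show ?thesis
      using h t m[OF t] m[OF act_mem] by simp
  qed
  have 3: "coact R (tsum R R t (mult R)) = tsum H RR (coact RR t) (\<lambda>a u. a \<otimes>\<^bsub>H,R\<^esub> tsum R R u (mult R))"
    if t: "t \<in> carrier (R \<Otimes> R)" for t
  proof -
    have [simp]: "tsum H RR = tsum H (R \<Otimes> R)"
      by (rule tsum_cong_space) simp_all
    have coact_mem: "coact RR t \<in> carrier (H \<Otimes> (R \<Otimes> R))"
      using t by (rule RR_coact_closed)
    have eq: "tsum H RR (coact RR t) (\<lambda>a u. a \<otimes>\<^bsub>H,R\<^esub> tsum R R u (mult R))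
        = ssum H (R \<Otimes> R) (coact RR t) (\<lambda>a u. a \<otimes>\<^bsub>H,A\<^esub> m u)"
      using coact_mem m by (simp add: tsum_ssum)
    have "lco (m t) = ssum H (R \<Otimes> R) (coact RR t) (\<lambda>a u. a \<otimes>\<^bsub>H,A\<^esub> m u)" (is "_ = ?r")
    proof (rule form_eqI[OF vspace_tensor])
      fix \<phi> assume \<phi>: "form (H \<Otimes> A) \<phi>"
      note [simp] = form_rules[OF \<phi>] linear_compose[OF m_lin]
      have "\<phi> (lco (m t)) = ssum A A t (\<lambda>r s. \<phi> (lco (r \<cdot> s)))"
        using t by (simp add: m_def tensor_space_R_sub)
      also have "\<dots> = ssum A A t (\<lambda>r s. LA r (\<lambda>b u. LA s (\<lambda>c v. \<phi> ((b \<cdot>\<^bsub>H\<^esub> c) \<otimes>\<^bsub>H,A\<^esub> (u \<cdot> v)))))"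
        by (simp add: form_tensor[OF \<phi>, of "lco x" for x])
      \<comment> \<open>\<open>form_RR_coact\<close> is applied to the form that multiplies the last
        two factors before evaluating \<open>\<phi>\<close>.\<close>
      also have "\<dots> = ssum H (A \<Otimes> A) (coact RR t) (\<lambda>a u. \<phi> (a \<otimes>\<^bsub>H,A\<^esub> m u))"
        using t form_RR_coact[where \<phi> = "\<lambda>x. ssum H (A \<Otimes> A) x (\<lambda>a u. \<phi> (a \<otimes>\<^bsub>H,A\<^esub> m u))"]
        by (simp add: m_def ssum_tens[where U = A])
      also have "\<dots> = \<phi> ?r"
        using t coact_mem m by (simp add: ssum_RR linear_closed[OF m_lin])
      finally show "\<phi> (lco (m t)) = \<phi> ?r" .
    qed (use t m in \<open>simp_all add: tensor_space_R_sub\<close>)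
    then show ?thesis
      unfolding eq using t m by simp
  qed
  have 4: "yd_hom H (yd_ground H) R (\<lambda>c. scale R c \<one>\<^bsub>R\<^esub>)"
  proof -
    have [simp]: "scale (yd_ground H) = (*)" "carrier (yd_ground H) = UNIV"
      by (simp_all add: yd_ground_def)
    have [simp]: "tens H (yd_ground H) = tens H ground" "tsum H (yd_ground H) = tsum H ground"
      by (rule tens_cong tsum_cong_space; simp)+
    have [simp]: "scale A c \<one> \<in> carrier R" for c
      using vspaceD(3)[OF vspace_R unit_mem_R] by simp
    have [simp]: "ssum H ground (\<one>\<^bsub>H\<^esub> \<otimes>\<^bsub>H,ground\<^esub> c) (\<lambda>v w. tscale w (v \<otimes>\<^bsub>H,A\<^esub> \<one>)) = tscale c (\<one>\<^bsub>H\<^esub> \<otimes>\<^bsub>H,A\<^esub> \<one>)" for c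
      by (rule ssum_tens[where U = "H \<Otimes> A"]) simp_all
    show ?thesis
      by (simp add: yd_hom_def) (auto simp: yd_ground_def linear_on_def vspaceD[OF A.vspace] ad_unit linear_scale[OF lco_linear]
          linear_scale[OF linear_ad(2)[OF linear_ident]] tsum_ssum ssum_tens[where U = "H \<Otimes> A"] mult.commute)
  qed
  have "yd_hom H RR R (\<lambda>t. tsum R R t (mult R))"
    unfolding yd_hom_def RR_simps
    by (intro conjI ballI 1 2 3)
  with 4 show ?thesis
    unfolding yd_algebra_def by (intro conjI R_algebra R_yd_module)
qed

section \<open>The axioms of a Yetter-Drinfeld quadruple\<close>

definition \<omega> where "\<omega> h = \<delta> (\<sigma> h)"

lemma omega_linear: "linear_on H (A \<Otimes> A) \<omega>"
  unfolding \<omega>_def by simp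

lemma omega_mem_R [simp]: "h \<in> carrier H \<Longrightarrow> \<omega> h \<in> carrier (R \<Otimes> R)"
  by (simp add: \<omega>_def)

text \<open>The tail \<sigma>(S(h_2)) \<sigma>(h_3) cancels. This is the commutation rule of the
  smash product, read inside \<open>A\<close>.\<close>

lemma form_ad_sigma:
  fixes f :: "_ \<Rightarrow> 'k"
  assumes f: "form A f" and h: "h \<in> carrier H" and r: "r \<in> carrier A"
  shows "csum H h (\<lambda>x y. f (ad x r \<cdot> \<sigma> y)) = f (\<sigma> h \<cdot> r)"
proof -
  note [simp] = form_rules[OF f]
  have "csum H h (\<lambda>x y. f (ad x r \<cdot> \<sigma> y)) = csum H h (\<lambda>p z. csum H z (\<lambda>q y. f (\<sigma> p \<cdot> (r \<cdot> \<sigma> (S q \<cdot>\<^bsub>H\<^esub> y)))))"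
    using h r by (simp add: ad_def H.csum_assoc triform_def)
  also have "\<dots> = f (\<sigma> h \<cdot> r)"
    using h r H.antipode_form(1)[where f = "\<lambda>w. f (\<sigma> p \<cdot> (r \<cdot> \<sigma> w))" for p] by (simp del: sigma_simps(1))
  finally show ?thesis .
qed

lemma quadruple_coaction_delta:
  assumes r: "r \<in> carrier R"
  shows "coact RR (\<delta> r) = tsum H R (coact R r) (\<lambda>a r0. a \<otimes>\<^bsub>H,RR\<^esub> \<delta> r0)" (is "?l = ?r")
proof -
  have eq: "tsum H R (coact R r) (\<lambda>a r0. a \<otimes>\<^bsub>H,RR\<^esub> \<delta> r0) = ssum H R (lco r) (\<lambda>a r0. a \<otimes>\<^bsub>H,A \<Otimes> A\<^esub> \<delta> r0)"
    using r by (simp add: tsum_ssum)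
  show ?thesis
  proof (rule form_eqI[OF vspace_tensor])
    fix \<phi> assume \<phi>: "form (H \<Otimes> (A \<Otimes> A)) \<phi>"
    note [simp] = form_rules[OF \<phi>]
    have "\<phi> ?l = LA r (\<lambda>b z. RA z (\<lambda>w k. csum A w (\<lambda>x y. \<phi> ((b \<cdot>\<^bsub>H\<^esub> S k) \<otimes>\<^bsub>H,A \<Otimes> A\<^esub> (\<tau> x \<otimes>\<^bsub>A,A\<^esub> \<tau> y)))))"
      using r form_coaction_delta[where G = "\<lambda>b u v. \<phi> (b \<otimes>\<^bsub>H,A \<Otimes> A\<^esub> (u \<otimes>\<^bsub>A,A\<^esub> v))"]
      by (simp add: form_RR_coact[OF \<phi>] triform_def del: LA_tau)
    \<comment> \<open>Exchanging the two coactions puts the right one outermost, where coinvariance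
      of \<open>r\<close> makes it trivial.\<close>
    also have "\<dots> = RA r (\<lambda>x k. LA x (\<lambda>b w. csum A w (\<lambda>x y. \<phi> ((b \<cdot>\<^bsub>H\<^esub> S k) \<otimes>\<^bsub>H,A \<Otimes> A\<^esub> (\<tau> x \<otimes>\<^bsub>A,A\<^esub> \<tau> y)))))"
      using r by (simp add: sum_assoc triform_def)
    also have "\<dots> = \<phi> ?r"
      unfolding eq using r by (simp add: R_coinv \<delta>_def ssum_R)
    finally show "\<phi> ?l = \<phi> ?r" .
  next
    show "coact RR (\<delta> r) \<in> carrier (H \<Otimes> (A \<Otimes> A))"
      using RR_coact_closed[of "\<delta> r"] r tensor_space_mono[of H H "R \<Otimes> R" "A \<Otimes> A"]
      by (simp add: subset_iff tensor_space_R_sub)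
  qed (unfold eq, use r in simp)
qed

lemma quadruple_coaction_omega:
  assumes h: "h \<in> carrier H"
  shows "coact RR (\<omega> h) = sw3 H h (\<lambda>h1 h2 h3. (h1 \<cdot>\<^bsub>H\<^esub> antipode H h3) \<otimes>\<^bsub>H,RR\<^esub> \<omega> h2)" (is "?l = ?r")
proof -
  have eq: "sw3 H h (\<lambda>h1 h2 h3. (h1 \<cdot>\<^bsub>H\<^esub> antipode H h3) \<otimes>\<^bsub>H,RR\<^esub> \<omega> h2)
      = csum H h (\<lambda>x y. csum H y (\<lambda>u v. (x \<cdot>\<^bsub>H\<^esub> S v) \<otimes>\<^bsub>H,A \<Otimes> A\<^esub> \<delta> (\<sigma> u)))"
    using h by (simp add: sw3_def \<omega>_def)
  show ?thesis
  proof (rule form_eqI[OF vspace_tensor])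
    fix \<phi> assume \<phi>: "form (H \<Otimes> (A \<Otimes> A)) \<phi>"
    note [simp] = form_rules[OF \<phi>]
    show "\<phi> ?l = \<phi> ?r"
      unfolding eq using h form_coaction_delta[where G = "\<lambda>b u v. \<phi> (b \<otimes>\<^bsub>H,A \<Otimes> A\<^esub> (u \<otimes>\<^bsub>A,A\<^esub> v))"]
      by (simp add: form_RR_coact[OF \<phi>] triform_def \<omega>_def del: LA_tau) (simp add: \<delta>_def)
  next
    show "coact RR (\<omega> h) \<in> carrier (H \<Otimes> (A \<Otimes> A))"
      using RR_coact_closed[of "\<omega> h"] h tensor_space_mono[of H H "R \<Otimes> R" "A \<Otimes> A"]
      by (simp add: subset_iff tensor_space_R_sub)
  qed (unfold eq, use h in simp)
qed

text \<open>The formula \<open>delta_mult\<close> at \<sigma>(h), whose right coaction is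
  \<sigma>(h_1) \<otimes> h_2. For \<open>a\<close> in the image of \<open>\<sigma>\<close> it
  becomes multiplicativity of \<open>\<omega>\<close>, for \<open>a\<close> in the diagram one half
  of the compatibility of \<open>\<delta>\<close> with \<open>\<omega>\<close>.\<close>

lemma delta_sigma_mult:
  assumes h: "h \<in> carrier H" and a: "a \<in> carrier A"
  shows "\<delta> (\<sigma> h \<cdot> a) = csum H h (\<lambda>x y. mAA (\<omega> x) (adAA y (\<delta> a)))" (is "?l = ?r")
proof (rule form_eqI[OF vspace_tensor])
  fix \<phi> assume \<phi>: "form (A \<Otimes> A) \<phi>"
  note [simp] = form_rules[OF \<phi>]
  show "\<phi> ?l = \<phi> ?r"
    using h a by (simp add: delta_mult \<omega>_def)
qed (use h a in \<open>simp_all add: \<omega>_def\<close>)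

lemma adAA_mem_R [simp]: "h \<in> carrier H \<Longrightarrow> t \<in> carrier (R \<Otimes> R) \<Longrightarrow> adAA h t \<in> carrier (R \<Otimes> R)"
proof -
  assume ht: "h \<in> carrier H" "t \<in> carrier (R \<Otimes> R)"
  have "act RR h t \<in> carrier (R \<Otimes> R)"
    using ht by (simp add: yd_tensor_def tsum_ssum)
  with ht show ?thesis by simp
qed

lemma quadruple_omega_mult:
  "h \<in> carrier H \<Longrightarrow> k \<in> carrier H \<Longrightarrow> \<omega> (h \<cdot>\<^bsub>H\<^esub> k) = sw2 H h (\<lambda>h1 h2. \<omega> h1 \<cdot>\<^bsub>RR\<^esub> act RR h2 (\<omega> k))"
  by (simp add: \<omega>_def[of "h \<cdot>\<^bsub>H\<^esub> k"] delta_sigma_mult) (simp add: \<omega>_def)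

text \<open>Both sides equal \<delta>(\<sigma>(h) r): the left one because ad(h_1)(r) \<sigma>(h_2)
  is \<sigma>(h) r and \<open>ad\<close> preserves the diagram, the right one by
  \<open>delta_sigma_mult\<close>.\<close>

lemma quadruple_compat:
  assumes h: "h \<in> carrier H" and r: "r \<in> carrier R"
  shows "sw2 H h (\<lambda>h1 h2. \<delta> (act R h1 r) \<cdot>\<^bsub>RR\<^esub> \<omega> h2) = sw2 H h (\<lambda>h1 h2. \<omega> h1 \<cdot>\<^bsub>RR\<^esub> act RR h2 (\<delta> r))"
proof -
  have "csum H h (\<lambda>x y. \<delta> (ad x r \<cdot> \<sigma> y)) = \<delta> (\<sigma> h \<cdot> r)" (is "?l = ?r")
  proof (rule form_eqI[OF vspace_tensor])
    fix \<phi> assume \<phi>: "form (A \<Otimes> A) \<phi>"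
    note [simp] = form_rules[OF \<phi>]
    show "\<phi> ?l = \<phi> ?r"
      using h r form_ad_sigma[of "\<lambda>x. \<phi> (\<delta> x)"] by simp
  qed (use h r in simp_all)
  then show ?thesis
    using h r by (simp add: delta_mult_R delta_sigma_mult \<omega>_def)
qed

text \<open>Both coassociativity axioms compare two expressions for \<tau>(a_(1)) \<otimes>
  \<tau>(a_(2)) \<otimes> \<tau>(a_(3)). The extra right coaction lets one statement serve for both:
  it is trivial at a coinvariant and supplies the factor h_2 of the axiom for
  \<open>\<omega>\<close> at \<sigma>(h).\<close>

lemma coassoc_left:
  assumes a: "a \<in> carrier A"
  shows "RA a (\<lambda>x k. csum A x (\<lambda>p q. \<tau> p \<otimes>\<^bsub>A,A \<Otimes> A\<^esub> \<delta> (\<tau> q \<cdot> \<sigma> k)))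
    = csum A a (\<lambda>x y. csum A x (\<lambda>u v. \<tau> u \<otimes>\<^bsub>A,A \<Otimes> A\<^esub> (\<tau> v \<otimes>\<^bsub>A,A\<^esub> \<tau> y)))" (is "?l = ?r")
proof (rule form_eqI[OF vspace_tensor])
  fix \<phi> assume \<phi>: "form (A \<Otimes> (A \<Otimes> A)) \<phi>"
  note [simp] = form_rules[OF \<phi>]
  show "\<phi> ?l
    = \<phi> ?r"
    using a form_coassoc_left[where G = "\<lambda>p q. \<phi> (\<tau> p \<otimes>\<^bsub>A,A \<Otimes> A\<^esub> \<delta> q)"]
    by (simp add: A.csum_assoc triform_def) (simp add: \<delta>_def)
qed (use a in simp_all)

lemma coassoc_right:
  assumes a: "a \<in> carrier A"
  shows "tensor_assoc R R R (RA a (\<lambda>x k. csum A x (\<lambda>p q. LA (\<tau> q) (\<lambda>c t. \<delta> (\<tau> p \<cdot> \<sigma> (c \<cdot>\<^bsub>H\<^esub> k)) \<otimes>\<^bsub>A \<Otimes> A,A\<^esub> t))))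
    = csum A a (\<lambda>x y. csum A x (\<lambda>u v. \<tau> u \<otimes>\<^bsub>A,A \<Otimes> A\<^esub> (\<tau> v \<otimes>\<^bsub>A,A\<^esub> \<tau> y)))"
proof -
  have "RA a (\<lambda>x k. csum A x (\<lambda>p q. LA (\<tau> q) (\<lambda>c t. \<delta> (\<tau> p \<cdot> \<sigma> (c \<cdot>\<^bsub>H\<^esub> k)) \<otimes>\<^bsub>A \<Otimes> A,A\<^esub> t)))
    = csum A a (\<lambda>x y. csum A x (\<lambda>u v. (\<tau> u \<otimes>\<^bsub>A,A\<^esub> \<tau> v) \<otimes>\<^bsub>A \<Otimes> A,A\<^esub> \<tau> y))" (is "?l = ?r")
  proof (rule form_eqI[OF vspace_tensor])
    fix \<phi> assume \<phi>: "form ((A \<Otimes> A) \<Otimes> A) \<phi>"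
    note [simp] = form_rules[OF \<phi>]
    show "\<phi> ?l
      = \<phi> ?r"
      using a form_coassoc_right[where G = "\<lambda>p t. \<phi> (\<delta> p \<otimes>\<^bsub>A \<Otimes> A,A\<^esub> t)"]
      by (simp del: sigma_simps(1) LA_tau) (simp add: \<delta>_def)
  qed (use a in simp_all)
  moreover have "tensor_assoc R R R (csum A a (\<lambda>x y. csum A x (\<lambda>u v. (\<tau> u \<otimes>\<^bsub>A,A\<^esub> \<tau> v) \<otimes>\<^bsub>A \<Otimes> A,A\<^esub> \<tau> y)))
    = csum A a (\<lambda>x y. csum A x (\<lambda>u v. \<tau> u \<otimes>\<^bsub>A,A \<Otimes> A\<^esub> (\<tau> v \<otimes>\<^bsub>A,A\<^esub> \<tau> y)))"
  proof -
    have [simp]: "(r \<otimes>\<^bsub>A,A\<^esub> s) \<otimes>\<^bsub>A \<Otimes> A,A\<^esub> t \<in> carrier ((R \<Otimes> R) \<Otimes> R)"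
      "tensor_assoc R R R ((r \<otimes>\<^bsub>A,A\<^esub> s) \<otimes>\<^bsub>A \<Otimes> A,A\<^esub> t) = r \<otimes>\<^bsub>A,A \<Otimes> A\<^esub> (s \<otimes>\<^bsub>A,A\<^esub> t)"
      if "r \<in> carrier R" "s \<in> carrier R" "t \<in> carrier R" for r s t
      using that tens_closed[of "r \<otimes>\<^bsub>A,A\<^esub> s" "R \<Otimes> R" t R] linear_tensor_assoc(2)[of R R R r s t] by simp_all
    note [simp] = linear_ssum[OF linear_tensor_assoc(1)[OF vspace_R vspace_R vspace_R]]
    show ?thesis using a by simp
  qed
  ultimately show ?thesis by simp
qed

lemma linear_R_A [simp]: "linear_on R A (\<lambda>x. x)"
  by (simp add: linear_on_def)

lemma ssum_HR:
  "bilinear_on H A U f \<Longrightarrow> vspace U \<Longrightarrow> s \<in> carrier (H \<Otimes> R) \<Longrightarrow> ssum H R s f = ssum H A s f"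
  by (rule ssum_subspace; (simp add: subset_iff; fail)?; assumption)

lemma ssum_R_delta:
  assumes f: "bilinear_on R R U f" and U: "vspace U" and a: "a \<in> carrier A"
  shows "ssum R R (\<delta> a) f = csum A a (\<lambda>x y. f (\<tau> x) (\<tau> y))"
  using ssum_tens[OF f vspace_R vspace_R U]
  by (simp add: \<delta>_def linear_ssum[OF linear_ssum_arg[OF f vspace_R vspace_R U]])

lemma quadruple:
  "yd_quadruple H R (counit A) \<delta> \<omega>"
proof -
  have lin: "form R (counit A)" "linear_on R RR \<delta>" "linear_on H RR \<omega>"
    using linear_on_restrict[OF A.counit_form, of R ground] linear_on_restrict[OF delta_linear, of R RR]
      linear_on_restrict[OF omega_linear, of H RR] by (simp_all add: subset_iff)
  \<comment> \<open>The counit on the second leg of the left coaction gives \<open>\<pi> r\<close>,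
    a multiple of the unit by \<open>pi_R\<close>.\<close>
  have eps: "tsum H R (coact R r) (\<lambda>a r0. scale H (counit A r0) a) = scale H (counit A r) \<one>\<^bsub>H\<^esub>" (is "?l = ?r")
    if r: "r \<in> carrier R" for r
  proof (rule form_eqI[OF H.vspace])
    fix \<phi> assume \<phi>: "form H \<phi>"
    note [simp] = form_rules[OF \<phi>] linear_scale[OF \<phi>]
    show "\<phi> ?l = \<phi> ?r"
      using r \<phi> by (simp add: tsum_ssum ssum_R pi_R)
  qed (use r in \<open>simp_all add: tsum_ssum\<close>)
  have c8: "tsum R R (\<delta> r) (\<lambda>x y. x \<otimes>\<^bsub>R,RR\<^esub> \<delta> y)
      = tensor_assoc R R R (tsum R R (\<delta> r) (\<lambda>x y. tsum H R (coact R y) (\<lambda>a y0.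
          (\<delta> x \<cdot>\<^bsub>RR\<^esub> \<omega> a) \<otimes>\<^bsub>RR,R\<^esub> y0)))" if r: "r \<in> carrier R" for r
  proof -
    have "tsum R R (\<delta> r) (\<lambda>x y. x \<otimes>\<^bsub>R,RR\<^esub> \<delta> y) = csum A r (\<lambda>x y. \<tau> x \<otimes>\<^bsub>A,A \<Otimes> A\<^esub> \<delta> (\<tau> y))"
      using r by (simp add: tsum_ssum ssum_R_delta[where U = "A \<Otimes> (A \<Otimes> A)"])
    moreover have "tsum R R (\<delta> r) (\<lambda>x y. tsum H R (coact R y) (\<lambda>a y0. (\<delta> x \<cdot>\<^bsub>RR\<^esub> \<omega> a) \<otimes>\<^bsub>RR,R\<^esub> y0))
      = csum A r (\<lambda>p q. LA (\<tau> q) (\<lambda>c t. \<delta> (\<tau> p \<cdot> \<sigma> c) \<otimes>\<^bsub>A \<Otimes> A,A\<^esub> t))"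
      using r by (simp add: tsum_ssum ssum_R_delta[where U = "(A \<Otimes> A) \<Otimes> A"] ssum_HR[where U = "(A \<Otimes> A) \<Otimes> A"]
        delta_mult_R \<omega>_def)
    ultimately show ?thesis
      using coassoc_left[of r] coassoc_right[of r] r
      by (simp add: R_coinv ssum_tens[where U = "A \<Otimes> (A \<Otimes> A)"] ssum_tens[where U = "(A \<Otimes> A) \<Otimes> A"] del: LA_tau)
  qed
  have c9: "sw2 H h (\<lambda>h1 h2. tsum R R (\<omega> h1) (\<lambda>x y. x \<otimes>\<^bsub>R,RR\<^esub> (\<delta> y \<cdot>\<^bsub>RR\<^esub> \<omega> h2)))
      = tensor_assoc R R R (sw2 H h (\<lambda>h1 h2. tsum R R (\<omega> h1) (\<lambda>x y. tsum H R (coact R y) (\<lambda>a y0.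
          (\<delta> x \<cdot>\<^bsub>RR\<^esub> \<omega> (a \<cdot>\<^bsub>H\<^esub> h2)) \<otimes>\<^bsub>RR,R\<^esub> y0))))" if h: "h \<in> carrier H" for h
  proof -
    \<comment> \<open>\<open>delta_mult_R\<close> folds each product with a value of
      \<open>\<omega>\<close> into a single value of \<open>\<delta>\<close>, which is the shape of
      \<open>coassoc_left\<close> and \<open>coassoc_right\<close> at \<sigma>(h).\<close>
    have "sw2 H h (\<lambda>h1 h2. tsum R R (\<omega> h1) (\<lambda>x y. x \<otimes>\<^bsub>R,RR\<^esub> (\<delta> y \<cdot>\<^bsub>RR\<^esub> \<omega> h2)))
      = csum H h (\<lambda>h1 h2. csum A (\<sigma> h1) (\<lambda>x y. \<tau> x \<otimes>\<^bsub>A,A \<Otimes> A\<^esub> \<delta> (\<tau> y \<cdot> \<sigma> h2)))"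
      using h by (simp add: tsum_ssum ssum_R_delta[where U = "A \<Otimes> (A \<Otimes> A)"] delta_mult_R \<omega>_def)
    moreover have "sw2 H h (\<lambda>h1 h2. tsum R R (\<omega> h1) (\<lambda>x y. tsum H R (coact R y) (\<lambda>a y0.
          (\<delta> x \<cdot>\<^bsub>RR\<^esub> \<omega> (a \<cdot>\<^bsub>H\<^esub> h2)) \<otimes>\<^bsub>RR,R\<^esub> y0)))
      = csum H h (\<lambda>h1 h2. csum A (\<sigma> h1) (\<lambda>p q. LA (\<tau> q) (\<lambda>c t. \<delta> (\<tau> p \<cdot> \<sigma> (c \<cdot>\<^bsub>H\<^esub> h2)) \<otimes>\<^bsub>A \<Otimes> A,A\<^esub> t)))"
      using h by (simp add: tsum_ssum ssum_R_delta[where U = "(A \<Otimes> A) \<Otimes> A"] ssum_HR[where U = "(A \<Otimes> A) \<Otimes> A"]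
        delta_mult_R \<omega>_def)
    ultimately show ?thesis
      using coassoc_left[of "\<sigma> h"] coassoc_right[of "\<sigma> h"] h
      by (simp add: sigma_bicolinear linear_ssum[OF linear_ssum_arg[where U = "A \<Otimes> (A \<Otimes> A)"]]
        linear_ssum[OF linear_ssum_arg[where U = "(A \<Otimes> A) \<Otimes> A"]]
        ssum_tens[where U = "A \<Otimes> (A \<Otimes> A)"] ssum_tens[where U = "(A \<Otimes> A) \<Otimes> A"] del: LA_tau)
  qed
  have scale_tau: "csum A a (\<lambda>x y. scale A (counit A x) (\<tau> y)) = \<tau> a"
    "csum A a (\<lambda>x y. scale A (counit A y) (\<tau> x)) = \<tau> a" if a: "a \<in> carrier A" for a
  proof -
    have "\<phi> (csum A a (\<lambda>x y. scale A (counit A x) (\<tau> y))) = \<phi> (\<tau> a)"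
      "\<phi> (csum A a (\<lambda>x y. scale A (counit A y) (\<tau> x))) = \<phi> (\<tau> a)" if \<phi>: "form A \<phi>" for \<phi>
    proof -
      note [simp] = form_rules[OF \<phi>] linear_scale[OF \<phi>]
      show "\<phi> (csum A a (\<lambda>x y. scale A (counit A x) (\<tau> y))) = \<phi> (\<tau> a)"
        "\<phi> (csum A a (\<lambda>x y. scale A (counit A y) (\<tau> x))) = \<phi> (\<tau> a)"
        using a by simp_all
    qed
    with a show "csum A a (\<lambda>x y. scale A (counit A x) (\<tau> y)) = \<tau> a"
      "csum A a (\<lambda>x y. scale A (counit A y) (\<tau> x)) = \<tau> a"
      by (auto intro: form_eqI[OF A.vspace])
  qed
  have c10: "tsum R R (\<delta> r) (\<lambda>x y. scale R (counit A x) y) = r"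
    "tsum R R (\<delta> r) (\<lambda>x y. scale R (counit A y) x) = r" if r: "r \<in> carrier R" for r
    using r by (simp_all add: tsum_ssum ssum_R_delta[where U = A] scale_tau R_tau)
  have c11: "tsum R R (\<omega> h) (\<lambda>x y. scale R (counit A x) y) = scale R (counit H h) \<one>\<^bsub>R\<^esub>"
    "tsum R R (\<omega> h) (\<lambda>x y. scale R (counit A y) x) = scale R (counit H h) \<one>\<^bsub>R\<^esub>" if h: "h \<in> carrier H" for h
    using h by (simp_all add: \<omega>_def tsum_ssum ssum_R_delta[where U = A] scale_tau tau_sigma)
  have unit: "\<delta> \<one>\<^bsub>R\<^esub> = \<one>\<^bsub>R\<^esub> \<otimes>\<^bsub>R,R\<^esub> \<one>\<^bsub>R\<^esub>" "\<omega> \<one>\<^bsub>H\<^esub> = \<one>\<^bsub>R\<^esub> \<otimes>\<^bsub>R,R\<^esub> \<one>\<^bsub>R\<^esub>"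
    by (simp_all add: \<delta>_def \<omega>_def tau_eq ssum_tens[where U = "A \<Otimes> A"])
  show ?thesis
    unfolding yd_quadruple_def Let_def
    by (intro conjI ballI R_yd_algebra lin eps quadruple_coaction_delta quadruple_coaction_omega
        quadruple_omega_mult quadruple_compat c8 c9 c10 c11 unit)
      (simp_all add: delta_mult_R)
qed

section \<open>The isomorphism onto the bosonization\<close>

abbreviation B where "B \<equiv> bosonization H R (counit A) \<delta> \<omega>"

definition to_bos where "to_bos a = RA a (\<lambda>x h. \<tau> x \<otimes>\<^bsub>A,H\<^esub> h)"

lemma B_simps [simp]:
  "carrier B = carrier (R \<Otimes> H)" "scale B = tscale" "unit B = \<one> \<otimes>\<^bsub>A,H\<^esub> \<one>\<^bsub>H\<^esub>"
  by (simp_all add: bosonization_def)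

lemma tens_B [simp]: "tens B B = tens (A \<Otimes> H) (A \<Otimes> H)"
  by (rule tens_cong) simp_all

lemma to_bos_linear: "linear_on A (A \<Otimes> H) to_bos"
  unfolding to_bos_def by simp

lemmas linear_to_bos [simp] = linear_compose[OF to_bos_linear]

lemma to_bos_closed [simp]: "a \<in> carrier A \<Longrightarrow> to_bos a \<in> carrier (R \<Otimes> H)"
  by (simp add: to_bos_def)

lemma to_bos_closed_A [simp]: "a \<in> carrier A \<Longrightarrow> to_bos a \<in> carrier (A \<Otimes> H)"
  by (simp add: to_bos_def)

lemma ssum_to_bos:
  assumes f: "bilinear_on R H U f" and U: "vspace U" and a: "a \<in> carrier A"
  shows "ssum R H (to_bos a) f = RA a (\<lambda>x h. f (\<tau> x) h)"
  using ssum_tens[OF f vspace_R H.vspace U] a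
  by (simp add: to_bos_def linear_ssum[OF linear_ssum_arg[OF f vspace_R H.vspace U]])

lemma to_bos_mult_sigma:
  assumes r: "r \<in> carrier R" and h: "h \<in> carrier H"
  shows "to_bos (r \<cdot> \<sigma> h) = r \<otimes>\<^bsub>A,H\<^esub> h"
proof (rule form_eqI[OF vspace_tensor])
  fix \<phi> assume \<phi>: "form (A \<Otimes> H) \<phi>"
  note [simp] = form_rules[OF \<phi>] linear_scale[OF \<phi>, unfolded scale_tensor_space]
  show "\<phi> (to_bos (r \<cdot> \<sigma> h)) = \<phi> (r \<otimes>\<^bsub>A,H\<^esub> h)"
    using r h by (simp add: to_bos_def R_coinv tau_mult_sigma R_tau)
qed (use r h in simp_all)

lemma to_bos_bij: "bij_betw to_bos (carrier A) (carrier B)"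
proof (rule bij_betw_byWitness[where f' = "\<lambda>t. ssum A H t (\<lambda>r h. r \<cdot> \<sigma> h)"])
  have inv: "ssum A H (to_bos a) (\<lambda>r h. r \<cdot> \<sigma> h) = a" (is "?l = _") if a: "a \<in> carrier A" for a
  proof (rule form_eqI[OF A.vspace])
    fix \<phi> assume \<phi>: "form A \<phi>"
    note [simp] = form_rules[OF \<phi>]
    show "\<phi> ?l = \<phi> a"
      using a \<phi> by (simp add: to_bos_def form_tau_sigma)
  qed (use a in simp_all)
  then show "\<forall>a\<in>carrier A. ssum A H (to_bos a) (\<lambda>r h. r \<cdot> \<sigma> h) = a" by simp
  show "\<forall>t\<in>carrier B. to_bos (ssum A H t (\<lambda>r h. r \<cdot> \<sigma> h)) = t"
  proof
    fix t assume "t \<in> carrier B"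
    then have t: "t \<in> carrier (R \<Otimes> H)" by simp
    show "to_bos (ssum A H t (\<lambda>r h. r \<cdot> \<sigma> h)) = t"
    proof (rule linear_eq_tensor[OF _ _ _ _ t])
      show "linear_on (R \<Otimes> H) (A \<Otimes> H) (\<lambda>t. to_bos (ssum A H t (\<lambda>r h. r \<cdot> \<sigma> h)))"
        by (rule linear_on_restrict[of "A \<Otimes> H" "A \<Otimes> H"]) (simp_all add: subset_iff tensor_space_R_sub)
      show "linear_on (R \<Otimes> H) (A \<Otimes> H) (\<lambda>t. t)"
        by (rule linear_on_restrict[of "A \<Otimes> H" "A \<Otimes> H"]) (simp_all add: subset_iff tensor_space_R_sub)
    qed (simp_all add: ssum_tens[where U = A] to_bos_mult_sigma)
  qed
  show "to_bos ` carrier A \<subseteq> carrier B" by auto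
  show "(\<lambda>t. ssum A H t (\<lambda>r h. r \<cdot> \<sigma> h)) ` carrier B \<subseteq> carrier A" by auto
qed

lemma to_bos_mult:
  assumes a: "a \<in> carrier A" and b: "b \<in> carrier A"
  shows "to_bos (a \<cdot> b) = to_bos a \<cdot>\<^bsub>B\<^esub> to_bos b" (is "?l = ?r")
proof -
  have eq: "to_bos a \<cdot>\<^bsub>B\<^esub> to_bos b = RA a (\<lambda>x h. RA b (\<lambda>y k. csum H h (\<lambda>h1 h2.
      (\<tau> x \<cdot> ad h1 (\<tau> y)) \<otimes>\<^bsub>A,H\<^esub> (h2 \<cdot>\<^bsub>H\<^esub> k))))"
    using a b by (simp add: bosonization_def tsum_ssum ssum_to_bos[where U = "A \<Otimes> H"])
  show ?thesis
  proof (rule form_eqI[OF vspace_tensor])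
    fix \<phi> assume \<phi>: "form (A \<Otimes> H) \<phi>"
    note [simp] = form_rules[OF \<phi>]
    have "\<phi> ?l = RA a (\<lambda>x h. RA b (\<lambda>y k. RA x (\<lambda>x h1.
        \<phi> ((\<tau> x \<cdot> ad h1 (\<tau> y)) \<otimes>\<^bsub>A,H\<^esub> (h \<cdot>\<^bsub>H\<^esub> k)))))"
      using a b by (simp add: to_bos_def tau_mult)
    also have "\<dots> = RA a (\<lambda>x h. RA x (\<lambda>x h1. RA b (\<lambda>y k.
        \<phi> ((\<tau> x \<cdot> ad h1 (\<tau> y)) \<otimes>\<^bsub>A,H\<^esub> (h \<cdot>\<^bsub>H\<^esub> k)))))"
      by (rule ssum_cong[OF refl], rule ssum_swap)
    \<comment> \<open>The repeated right coaction of \<open>a\<close>, one of them coming from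
      \<open>tau_mult\<close>, becomes one coaction followed by the coproduct of \<open>H\<close>,
      as in the smash product.\<close>
    also have "\<dots> = RA a (\<lambda>x h. csum H h (\<lambda>h1 h2. RA b (\<lambda>y k. 
        \<phi> ((\<tau> x \<cdot> ad h1 (\<tau> y)) \<otimes>\<^bsub>A,H\<^esub> (h2 \<cdot>\<^bsub>H\<^esub> k)))))"
      using a b by (simp add: sum_assoc triform_def)
    also have "\<dots> = RA a (\<lambda>x h. RA b (\<lambda>y k. csum H h (\<lambda>h1 h2.
        \<phi> ((\<tau> x \<cdot> ad h1 (\<tau> y)) \<otimes>\<^bsub>A,H\<^esub> (h2 \<cdot>\<^bsub>H\<^esub> k)))))"
      by (rule ssum_cong[OF refl], rule ssum_swap)
    also have "\<dots> = \<phi> ?r"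
      unfolding eq using a b by simp
    finally show "\<phi> ?l = \<phi> ?r" .
  qed (use a b in \<open>simp_all add: eq del: B_simps\<close>)
qed

text \<open>The factors \<tau>(a_0) \<sigma>(a_1) recombine, so that the coproduct of
  \<open>A\<close> is taken at an unprojected element. The antipode in the coaction of
  \<open>\<tau> q\<close> then cancels against \<open>h2\<close>, and the left coaction that
  survives is read as a right coaction on the first leg.\<close>

lemma form_to_bos_comult:
  fixes G :: "_ \<Rightarrow> _ \<Rightarrow> _ \<Rightarrow> _ \<Rightarrow> 'k"
  assumes G: "\<And>w k. w \<in> carrier A \<Longrightarrow> k \<in> carrier H \<Longrightarrow> biform A H (\<lambda>x h. G x h w k)"
    "\<And>x h. x \<in> carrier A \<Longrightarrow> h \<in> carrier H \<Longrightarrow> biform A H (G x h)"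
    and a: "a \<in> carrier A"
  shows "RA a (\<lambda>x h. csum H h (\<lambda>h1 z. csum H z (\<lambda>h2 h3. csum A (\<tau> x \<cdot> \<sigma> h1) (\<lambda>p q. LA (\<tau> q) (\<lambda>c q0.
      G (\<tau> p) (c \<cdot>\<^bsub>H\<^esub> h2) q0 h3)))))
    = csum A a (\<lambda>x y. RA x (\<lambda>u h. RA y (\<lambda>v k. G (\<tau> u) h (\<tau> v) k)))"
proof -
  have G1: "linear_on U A g \<Longrightarrow> h \<in> carrier H \<Longrightarrow> w \<in> carrier A \<Longrightarrow> k \<in> carrier H \<Longrightarrow> form U (\<lambda>x. G (g x) h w k)"
    "linear_on U H g' \<Longrightarrow> x \<in> carrier A \<Longrightarrow> w \<in> carrier A \<Longrightarrow> k \<in> carrier H \<Longrightarrow> form U (\<lambda>h. G x (g' h) w k)"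
    "linear_on U A g'' \<Longrightarrow> x \<in> carrier A \<Longrightarrow> h \<in> carrier H \<Longrightarrow> k \<in> carrier H \<Longrightarrow> form U (\<lambda>w. G x h (g'' w) k)"
    "linear_on U H g''' \<Longrightarrow> x \<in> carrier A \<Longrightarrow> h \<in> carrier H \<Longrightarrow> w \<in> carrier A \<Longrightarrow> form U (\<lambda>k. G x h w (g''' k))"
    for U :: "('k, 'w::ab_group_add, 'z) kspace_scheme" and g g' g'' g''' x h w k
    using bilinear_compose1[OF G(1)] bilinear_compose2[OF G(1)] bilinear_compose1[OF G(2)]
      bilinear_compose2[OF G(2)] by blast+
  note [simp] = G1
  \<comment> \<open>Hiding the inner sums in an opaque bilinear form keeps the coproduct of the
    product from being expanded before its two factors recombine.\<close>
  define F where "F w z = csum H z (\<lambda>h2 h3. csum A w (\<lambda>p q. LA (\<tau> q) (\<lambda>c q0. G (\<tau> p) (c \<cdot>\<^bsub>H\<^esub> h2) q0 h3)))" for w z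
  have F: "biform A H F"
    unfolding F_def by simp
  note [simp] = bilinear_rules[OF F]
  have "RA a (\<lambda>x h. csum H h (\<lambda>h1 z. csum H z (\<lambda>h2 h3. csum A (\<tau> x \<cdot> \<sigma> h1) (\<lambda>p q. LA (\<tau> q) (\<lambda>c q0.
      G (\<tau> p) (c \<cdot>\<^bsub>H\<^esub> h2) q0 h3)))))
    = RA a (\<lambda>x h. csum H h (\<lambda>h1 z. F (\<tau> x \<cdot> \<sigma> h1) z))"
    by (simp add: F_def)
  also have "\<dots> = RA a (\<lambda>x z. RA x (\<lambda>x h1. F (\<tau> x \<cdot> \<sigma> h1) z))"
    using a by (simp add: sum_assoc triform_def)
  also have "\<dots> = RA a (\<lambda>x z. F x z)"
    using a form_tau_sigma[where f = "\<lambda>w. F w z" for z] by simp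
  also have "\<dots> = RA a (\<lambda>x z. csum A x (\<lambda>p q. csum H z (\<lambda>h2 h3. LA (\<tau> q) (\<lambda>c q0. G (\<tau> p) (c \<cdot>\<^bsub>H\<^esub> h2) q0 h3))))"
    unfolding F_def by (rule ssum_cong[OF refl], rule ssum_swap)
  also have "\<dots> = RA a (\<lambda>x z. csum A x (\<lambda>p q. LA (\<tau> q) (\<lambda>c q0. csum H z (\<lambda>h2 h3. G (\<tau> p) (c \<cdot>\<^bsub>H\<^esub> h2) q0 h3))))"
    by (rule ssum_cong[OF refl], rule ssum_cong[OF refl], rule ssum_swap)
  also have "\<dots> = csum A a (\<lambda>p z. LA z (\<lambda>b z. RA z (\<lambda>d m. csum H m (\<lambda>l h. csum H h (\<lambda>h2 h3.
      G (\<tau> p) (b \<cdot>\<^bsub>H\<^esub> (S l \<cdot>\<^bsub>H\<^esub> h2)) (\<tau> d) h3)))))"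
    using a by (simp add: sum_assoc triform_def)
  also have "\<dots> = csum A a (\<lambda>p z. LA z (\<lambda>b z. RA z (\<lambda>d m. G (\<tau> p) b (\<tau> d) m)))"
    using a H.antipode_biform(1)[where K = "\<lambda>w h3. G (\<tau> p) (b \<cdot>\<^bsub>H\<^esub> w) (\<tau> d) h3" for p b d] by simp
  also have "\<dots> = csum A a (\<lambda>x y. RA x (\<lambda>u h. RA y (\<lambda>v k. G (\<tau> u) h (\<tau> v) k)))"
    using a by (simp add: sum_assoc triform_def)
  finally show ?thesis .
qed

lemma delta_mult_sigma: "r \<in> carrier R \<Longrightarrow> h \<in> carrier H \<Longrightarrow> mAA (\<delta> r) (\<omega> h) = \<delta> (r \<cdot> \<sigma> h)"
  by (simp add: delta_mult_R \<omega>_def)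

lemma to_bos_comult:
  assumes a: "a \<in> carrier A"
  shows "comult B (to_bos a) = sw2 A a (\<lambda>a1 a2. to_bos a1 \<otimes>\<^bsub>B,B\<^esub> to_bos a2)" (is "?l = ?r")
proof -
  let ?U = "(A \<Otimes> H) \<Otimes> (A \<Otimes> H)"
  have eq: "comult B (to_bos a) = RA a (\<lambda>x h. csum H h (\<lambda>h1 z. csum H z (\<lambda>h2 h3.
      csum A (\<tau> x \<cdot> \<sigma> h1) (\<lambda>p q. LA (\<tau> q) (\<lambda>c q0.
        (\<tau> p \<otimes>\<^bsub>A,H\<^esub> (c \<cdot>\<^bsub>H\<^esub> h2)) \<otimes>\<^bsub>A \<Otimes> H,A \<Otimes> H\<^esub> (q0 \<otimes>\<^bsub>A,H\<^esub> h3))))))"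
    using a by (simp add: bosonization_def tsum_ssum sw3_def delta_mult_sigma ssum_R_delta[where U = ?U]
        ssum_HR[where U = ?U] ssum_to_bos[where U = ?U])
  show ?thesis
  proof (rule form_eqI[OF vspace_tensor])
    fix \<phi> assume \<phi>: "form ((A \<Otimes> H) \<Otimes> (A \<Otimes> H)) \<phi>"
    note [simp] = form_rules[OF \<phi>]
    have "\<phi> ?l = csum A a (\<lambda>x y. RA x (\<lambda>u h. RA y (\<lambda>v k.
        \<phi> ((\<tau> u \<otimes>\<^bsub>A,H\<^esub> h) \<otimes>\<^bsub>A \<Otimes> H,A \<Otimes> H\<^esub> (\<tau> v \<otimes>\<^bsub>A,H\<^esub> k)))))"
      unfolding eq using a
        form_to_bos_comult[where G = "\<lambda>x h w k. \<phi> ((x \<otimes>\<^bsub>A,H\<^esub> h) \<otimes>\<^bsub>A \<Otimes> H,A \<Otimes> H\<^esub> (w \<otimes>\<^bsub>A,H\<^esub> k))"]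
      by (simp del: LA_tau A.csum_mult)
    also have "\<dots> = csum A a (\<lambda>x y. RA y (\<lambda>v k. RA x (\<lambda>u h.
        \<phi> ((\<tau> u \<otimes>\<^bsub>A,H\<^esub> h) \<otimes>\<^bsub>A \<Otimes> H,A \<Otimes> H\<^esub> (\<tau> v \<otimes>\<^bsub>A,H\<^esub> k)))))"
      by (rule ssum_cong[OF refl], rule ssum_swap)
    also have "\<dots> = \<phi> ?r"
      using a by (simp add: to_bos_def)
    finally show "\<phi> ?l = \<phi> ?r" .
  qed (use a in \<open>simp_all add: eq del: LA_tau A.csum_mult\<close>)
qed

lemma to_bos_counit:
  assumes a: "a \<in> carrier A"
  shows "counit B (to_bos a) = counit A a"
  using a by (simp add: bosonization_def tsum_ssum ssum_to_bos[where U = ground] linear_on_restrict[OF A.counit_form]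
      A.counit_form)

theorem bosonization_iso: "A \<simeq> B"
proof -
  have "linear_on A B to_bos"
    using linear_on_restrict[OF to_bos_linear, of A B] by simp
  moreover have "to_bos \<one> = unit B"
    by (simp add: to_bos_def ssum_tens[where U = "A \<Otimes> H"] tau_eq)
  ultimately have "bialgebra_hom A B to_bos"
    unfolding bialgebra_hom_def algebra_hom_def
    using to_bos_mult to_bos_comult to_bos_counit by blast
  then show ?thesis
    unfolding bialgebra_iso_def using to_bos_bij by blast
qed

end

section \<open>Splittings from Hopf bimodule structures\<close>

locale compatible = A: bialgebra_on A + H: hopf_on H
  for A :: "('k::field, 'a::ab_group_add) bialgebra" (structure) and H :: "('k, 'h::ab_group_add) hopf" +
  fixes M :: "('k, 'h, 'a) hopf_bimod"
  assumes compatible: "compatible_structure H A M"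
begin

lemma M_space: "carrier M = carrier A" "scale M = scale A"
  using compatible by (simp_all add: compatible_structure_def)

sublocale M: same_space A M
  by standard (fact M_space)+

lemma M_hopf_bimodule: "is_hopf_bimodule H M"
  using compatible by (simp add: compatible_structure_def)

lemma M_bicomodule: "is_bicomodule H M"
  using M_hopf_bimodule by (simp add: is_hopf_bimodule_def)

lemma M_left_comodule: "left_comodule H M (lcoact M)" and M_right_comodule: "right_comodule H M (rcoact M)"
  using M_bicomodule by (simp_all add: is_bicomodule_def)

lemma lM_linear: "linear_on A (H \<Otimes> A) (lcoact M)" and rM_linear: "linear_on A (A \<Otimes> H) (rcoact M)"
  using M_left_comodule M_right_comodule by (simp_all add: left_comodule_def right_comodule_def)

lemmas linear_lM [simp] = linear_compose[OF lM_linear]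
lemmas linear_rM [simp] = linear_compose[OF rM_linear]

lemma lM_closed [simp]: "a \<in> carrier A \<Longrightarrow> lcoact M a \<in> carrier (H \<Otimes> A)"
  and rM_closed [simp]: "a \<in> carrier A \<Longrightarrow> rcoact M a \<in> carrier (A \<Otimes> H)"
  using linear_closed[OF lM_linear] linear_closed[OF rM_linear] by auto

abbreviation RM :: "'a \<Rightarrow> ('a \<Rightarrow> 'h \<Rightarrow> 'u::ab_group_add) \<Rightarrow> 'u" where "RM a \<equiv> ssum A H (rcoact M a)"
abbreviation LM :: "'a \<Rightarrow> ('h \<Rightarrow> 'a \<Rightarrow> 'u::ab_group_add) \<Rightarrow> 'u" where "LM a \<equiv> ssum H A (lcoact M a)"

lemma RM_assoc:
  fixes G :: "_ \<Rightarrow> _ \<Rightarrow> _ \<Rightarrow> 'k"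
  assumes a: "a \<in> carrier A" and G: "triform A H H G"
  shows "RM a (\<lambda>x h. RM x (\<lambda>u k. G u k h)) = RM a (\<lambda>u z. csum H z (G u))"
proof -
  note [simp] = triform_compose[OF G]
  let ?t = "RM a (\<lambda>x h. rcoact M x \<otimes>\<^bsub>A \<Otimes> H, H\<^esub> h)"
  have "ssum A (H \<Otimes> H) (tensor_assoc A H H ?t) (\<lambda>u p. ssum H H p (\<lambda>k l. G u k l))
      = ssum (A \<Otimes> H) H ?t (\<lambda>p l. ssum A H p (\<lambda>u k. G u k l))"
    by (rule form_tensor_assoc) (use a G in simp_all)
  moreover have "tensor_assoc A H H ?t = RM a (\<lambda>x h. x \<otimes>\<^bsub>A, H \<Otimes> H\<^esub> comult H h)"
    using M_right_comodule a by (simp add: right_comodule_def tsum_ssum)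
  ultimately show ?thesis
    using a by simp
qed

lemma RM_counit:
  fixes f :: "_ \<Rightarrow> 'k"
  assumes a: "a \<in> carrier A" and f: "form A f"
  shows "RM a (\<lambda>x h. counit H h * f x) = f a"
proof -
  note [simp] = linear_ssum[OF f] linear_scale[OF f]
  have "f (RM a (\<lambda>x h. scale A (counit H h) x)) = f a"
    using M_right_comodule a by (simp add: right_comodule_def tsum_ssum)
  then show ?thesis by simp
qed

lemma comult_cotensor: "a \<in> carrier A \<Longrightarrow> comult A a \<in> carrier (cotensor H M M)"
  and comult_bicolinear: "bicomodule_hom H M (cotensor H M M) (comult A)"
  using compatible M_space by (auto simp: compatible_structure_def becomes_coalgebra_def)

text \<open>The cotensor condition and the two colinearity conditions on the comultiplication,
  tested on trilinear forms so that no associator remains.\<close>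

lemma csum_coaction:
  fixes G :: "_ \<Rightarrow> _ \<Rightarrow> _ \<Rightarrow> 'k"
  assumes a: "a \<in> carrier A"
  shows "triform A H A G \<Longrightarrow> csum A a (\<lambda>x y. RM x (\<lambda>u h. G u h y)) = csum A a (\<lambda>u z. LM z (G u))"
    and "triform H A A G' \<Longrightarrow> csum A a (\<lambda>x y. LM x (\<lambda>h v. G' h v y)) = LM a (\<lambda>h z. csum A z (G' h))"
    and "triform A A H G'' \<Longrightarrow> csum A a (\<lambda>x y. RM y (G'' x)) = RM a (\<lambda>x h. csum A x (\<lambda>u v. G'' u v h))"
proof -
  have [simp]: "tens H (cotensor H M M) = tens H (A \<Otimes> A)" "tens (cotensor H M M) H = tens (A \<Otimes> A) H"
    by (rule tens_cong; simp add: cotensor_def)+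
  show "csum A a (\<lambda>x y. RM x (\<lambda>u h. G u h y)) = csum A a (\<lambda>u z. LM z (G u))" if G: "triform A H A G"
  proof -
    note [simp] = triform_compose[OF G]
    let ?t = "csum A a (\<lambda>m n. rcoact M m \<otimes>\<^bsub>A \<Otimes> H, A\<^esub> n)"
    have "ssum A (H \<Otimes> A) (tensor_assoc A H A ?t) (\<lambda>u p. ssum H A p (\<lambda>k l. G u k l))
        = ssum (A \<Otimes> H) A ?t (\<lambda>p l. ssum A H p (\<lambda>u k. G u k l))"
      by (rule form_tensor_assoc) (use a G in simp_all)
    moreover have "tensor_assoc A H A ?t = csum A a (\<lambda>m n. m \<otimes>\<^bsub>A, H \<Otimes> A\<^esub> lcoact M n)"
      using comult_cotensor[OF a] a by (simp add: cotensor_def tsum_ssum)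
    ultimately show ?thesis using a by simp
  qed
  show "csum A a (\<lambda>x y. LM x (\<lambda>h v. G' h v y)) = LM a (\<lambda>h z. csum A z (G' h))" if G: "triform H A A G'"
  proof -
    note [simp] = triform_compose[OF G]
    let ?t = "csum A a (\<lambda>m n. lcoact M m \<otimes>\<^bsub>H \<Otimes> A, A\<^esub> n)"
    have "ssum H (A \<Otimes> A) (tensor_assoc H A A ?t) (\<lambda>u p. ssum A A p (\<lambda>k l. G' u k l))
        = ssum (H \<Otimes> A) A ?t (\<lambda>p l. ssum H A p (\<lambda>u k. G' u k l))"
      by (rule form_tensor_assoc) (use a G in simp_all)
    moreover have "tensor_assoc H A A ?t = LM a (\<lambda>h z. h \<otimes>\<^bsub>H, A \<Otimes> A\<^esub> comult A z)"
      using comult_bicolinear a by (simp add: bicomodule_hom_def tsum_ssum) (simp add: cotensor_def tsum_ssum)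
    ultimately show ?thesis using a by simp
  qed
  show "csum A a (\<lambda>x y. RM y (G'' x)) = RM a (\<lambda>x h. csum A x (\<lambda>u v. G'' u v h))" if G: "triform A A H G''"
  proof -
    note [simp] = triform_compose[OF G]
    have "csum A a (\<lambda>m n. RM n (\<lambda>n0 b. (m \<otimes>\<^bsub>A,A\<^esub> n0) \<otimes>\<^bsub>A \<Otimes> A, H\<^esub> b)) = RM a (\<lambda>x b. comult A x \<otimes>\<^bsub>A \<Otimes> A, H\<^esub> b)"
      using comult_bicolinear a by (simp add: bicomodule_hom_def tsum_ssum) (simp add: cotensor_def tsum_ssum)
    then have "ssum (A \<Otimes> A) H (csum A a (\<lambda>m n. RM n (\<lambda>n0 b. (m \<otimes>\<^bsub>A,A\<^esub> n0) \<otimes>\<^bsub>A \<Otimes> A, H\<^esub> b))) (\<lambda>p h. ssum A A p (\<lambda>u v. G'' u v h))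
      = ssum (A \<Otimes> A) H (RM a (\<lambda>x b. comult A x \<otimes>\<^bsub>A \<Otimes> A, H\<^esub> b)) (\<lambda>p h. ssum A A p (\<lambda>u v. G'' u v h))"
      by simp
    then show ?thesis using a by simp
  qed
qed

section \<open>The projection recovered from the coactions\<close>

definition \<pi> where "\<pi> a = RM a (\<lambda>x h. scale H (counit A x) h)"
definition \<sigma> where "\<sigma> h = ract M \<one> h"

lemma pi_linear: "linear_on A H \<pi>"
  unfolding \<pi>_def by simp

lemmas linear_pi [simp] = linear_compose[OF pi_linear]

lemma pi_closed [simp]: "a \<in> carrier A \<Longrightarrow> \<pi> a \<in> carrier H"
  by (rule linear_closed[OF pi_linear])

lemma form_pi:
  fixes f :: "_ \<Rightarrow> 'k"
  assumes f: "form H f" and a: "a \<in> carrier A"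
  shows "f (\<pi> a) = RM a (\<lambda>x h. counit A x * f h)"
proof -
  note [simp] = linear_ssum[OF f] linear_scale[OF f]
  show ?thesis using a by (simp add: \<pi>_def)
qed

text \<open>Right colinearity of the comultiplication lets the coaction act on a_(2) alone; applying
  the counit to its first leg there produces \<open>\<pi>\<close>, while a_(1) keeps the
  rest.\<close>

lemma RM_pi:
  fixes G :: "_ \<Rightarrow> _ \<Rightarrow> 'k"
  assumes G: "biform A H G" and a: "a \<in> carrier A"
  shows "RM a G = csum A a (\<lambda>x y. G x (\<pi> y))"
proof -
  note [simp] = bilinear_rules[OF G]
  have "csum A a (\<lambda>x y. G x (\<pi> y)) = csum A a (\<lambda>x y. RM y (\<lambda>n h. counit A n * G x h))"
    by (rule ssum_cong[OF refl], rule form_pi) simp_all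
  also have "\<dots> = RM a (\<lambda>x h. csum A x (\<lambda>u v. counit A v * G u h))"
    by (rule csum_coaction) (use a in \<open>simp_all add: triform_def\<close>)
  also have "\<dots> = RM a G"
    using a by simp
  finally show ?thesis ..
qed

text \<open>The left coaction defines the same map as the right one. With a counit inserted on
  a_(2), the cotensor condition trades the right coaction of a_(1) for the left coaction of a_(2),
  and the other counit disappears.\<close>

lemma form_pi_left:
  fixes f :: "_ \<Rightarrow> 'k"
  assumes f: "form H f" and a: "a \<in> carrier A"
  shows "f (\<pi> a) = LM a (\<lambda>h x. counit A x * f h)"
proof -
  note [simp] = linear_compose[OF f]
  have "f (\<pi> a) = csum A a (\<lambda>x y. counit A y * f (\<pi> x))"
    using a by simp
  also have "\<dots> = csum A a (\<lambda>x y. RM x (\<lambda>u h. counit A y * (counit A u * f h)))"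
    by (simp add: form_pi[OF f])
  also have "\<dots> = csum A a (\<lambda>u z. LM z (\<lambda>h y. counit A y * (counit A u * f h)))"
    by (rule csum_coaction) (use a in \<open>simp_all add: triform_def\<close>)
  also have "\<dots> = csum A a (\<lambda>u z. counit A u * LM z (\<lambda>h y. counit A y * f h))"
    by (simp add: mult.left_commute)
  also have "\<dots> = LM a (\<lambda>h x. counit A x * f h)"
    using a by simp
  finally show ?thesis .
qed

lemma LM_pi:
  fixes G :: "_ \<Rightarrow> _ \<Rightarrow> 'k"
  assumes G: "biform H A G" and a: "a \<in> carrier A"
  shows "LM a G = csum A a (\<lambda>x y. G (\<pi> x) y)"
proof -
  note [simp] = bilinear_rules[OF G]
  have "csum A a (\<lambda>x y. G (\<pi> x) y) = csum A a (\<lambda>x y. LM x (\<lambda>h v. counit A v * G h y))"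
    by (rule ssum_cong[OF refl], rule form_pi_left) simp_all
  also have "\<dots> = LM a (\<lambda>h z. csum A z (\<lambda>u v. counit A u * G h v))"
    by (rule csum_coaction) (use a in \<open>simp_all add: triform_def\<close>)
  also have "\<dots> = LM a G"
    using a by simp
  finally show ?thesis ..
qed

lemma M_coact_pi:
  assumes a: "a \<in> carrier A"
  shows "lcoact M a = csum A a (\<lambda>x y. \<pi> x \<otimes>\<^bsub>H,A\<^esub> y)" and "rcoact M a = csum A a (\<lambda>x y. x \<otimes>\<^bsub>A,H\<^esub> \<pi> y)"
proof -
  show "lcoact M a = csum A a (\<lambda>x y. \<pi> x \<otimes>\<^bsub>H,A\<^esub> y)"
  proof (rule form_eqI[OF vspace_tensor])
    fix \<phi> assume \<phi>: "form (H \<Otimes> A) \<phi>"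
    note [simp] = form_rules[OF \<phi>]
    show "\<phi> (lcoact M a) = \<phi> (csum A a (\<lambda>x y. \<pi> x \<otimes>\<^bsub>H,A\<^esub> y))"
      using a by (subst form_tensor[OF \<phi>]) (simp_all add: LM_pi)
  qed (use a in simp_all)
  show "rcoact M a = csum A a (\<lambda>x y. x \<otimes>\<^bsub>A,H\<^esub> \<pi> y)"
  proof (rule form_eqI[OF vspace_tensor])
    fix \<phi> assume \<phi>: "form (A \<Otimes> H) \<phi>"
    note [simp] = form_rules[OF \<phi>]
    show "\<phi> (rcoact M a) = \<phi> (csum A a (\<lambda>x y. x \<otimes>\<^bsub>A,H\<^esub> \<pi> y))"
      using a by (subst form_tensor[OF \<phi>]) (simp_all add: RM_pi)
  qed (use a in simp_all)
qed

lemma M_coact_hom: "algebra_hom A (tensor_algebra H A) (lcoact M)" "algebra_hom A (tensor_algebra A H) (rcoact M)"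
  using compatible by (simp_all add: compatible_structure_def becomes_algebra_def)

lemma M_coact_unit: "lcoact M \<one> = \<one>\<^bsub>H\<^esub> \<otimes>\<^bsub>H,A\<^esub> \<one>" "rcoact M \<one> = \<one> \<otimes>\<^bsub>A,H\<^esub> \<one>\<^bsub>H\<^esub>"
  using M_coact_hom by (simp_all add: algebra_hom_def)

text \<open>\<open>\<pi>\<close> is the right coaction followed by the counit on its first leg. Both
  are algebra maps, which gives multiplicativity; coassociativity of the coaction together with
  \<open>RM_pi\<close> gives comultiplicativity.\<close>

lemma pi_hom: "bialgebra_hom A H \<pi>"
proof -
  have "\<pi> (a \<cdot> b) = \<pi> a \<cdot>\<^bsub>H\<^esub> \<pi> b" if ab: "a \<in> carrier A" "b \<in> carrier A" for a b
  proof (rule form_eqI[OF H.vspace])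
    fix \<phi> assume \<phi>: "form H \<phi>"
    note [simp] = form_rules[OF \<phi>]
    have "\<phi> (\<pi> (a \<cdot> b)) = RM a (\<lambda>x h. RM b (\<lambda>y k. counit A x * counit A y * \<phi> (h \<cdot>\<^bsub>H\<^esub> k)))"
      using ab form_algebra_hom_tensor[OF A.algebra H.algebra M_coact_hom(2), where G = "\<lambda>x h. counit A x * \<phi> h"]
      by (simp add: form_pi[OF \<phi>])
    also have "\<dots> = RM a (\<lambda>x h. counit A x * \<phi> (h \<cdot>\<^bsub>H\<^esub> \<pi> b))"
      using ab form_pi[where f = "\<lambda>k. \<phi> (h \<cdot>\<^bsub>H\<^esub> k)" and a = b for h] by (simp add: mult.assoc)
    also have "\<dots> = \<phi> (\<pi> a \<cdot>\<^bsub>H\<^esub> \<pi> b)"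
      using ab form_pi[where f = "\<lambda>h. \<phi> (h \<cdot>\<^bsub>H\<^esub> \<pi> b)" and a = a] by simp
    finally show "\<phi> (\<pi> (a \<cdot> b)) = \<phi> (\<pi> a \<cdot>\<^bsub>H\<^esub> \<pi> b)" .
  qed (use ab in simp_all)
  moreover have "\<pi> \<one> = \<one>\<^bsub>H\<^esub>"
    by (simp add: \<pi>_def M_coact_unit ssum_tens[where U = H] vspaceD)
  moreover have "comult H (\<pi> a) = sw2 A a (\<lambda>a1 a2. \<pi> a1 \<otimes>\<^bsub>H,H\<^esub> \<pi> a2)" (is "?l = ?r") if a: "a \<in> carrier A" for a
  proof (rule form_eqI[OF vspace_tensor])
    fix \<phi> assume \<phi>: "form (H \<Otimes> H) \<phi>"
    note [simp] = form_rules[OF \<phi>]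
    have "\<phi> ?l = RM a (\<lambda>x h. counit A x * \<phi> (comult H h))"
      using a by (simp add: form_pi[where f = "\<lambda>h. \<phi> (comult H h)"])
    also have "\<dots> = RM a (\<lambda>x h. csum H h (\<lambda>k l. counit A x * \<phi> (k \<otimes>\<^bsub>H,H\<^esub> l)))"
      by (simp add: form_tensor[OF \<phi>, of "comult H h" for h])
    also have "\<dots> = RM a (\<lambda>x h. RM x (\<lambda>u k. counit A u * \<phi> (k \<otimes>\<^bsub>H,H\<^esub> h)))"
      by (rule RM_assoc[symmetric]) (use a in \<open>simp_all add: triform_def\<close>)
    also have "\<dots> = RM a (\<lambda>x h. \<phi> (\<pi> x \<otimes>\<^bsub>H,H\<^esub> h))"
      by (simp add: form_pi[where f = "\<lambda>k. \<phi> (k \<otimes>\<^bsub>H,H\<^esub> h)" for h])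
    also have "\<dots> = \<phi> ?r"
      using a by (simp add: RM_pi)
    finally show "\<phi> ?l = \<phi> ?r" .
  qed (use a in simp_all)
  moreover have "counit H (\<pi> a) = counit A a" if a: "a \<in> carrier A" for a
    using RM_counit[OF a A.counit_form] a by (simp add: form_pi[OF H.counit_form] mult.commute)
  ultimately show ?thesis
    unfolding bialgebra_hom_def algebra_hom_def using pi_linear by simp
qed

section \<open>The section recovered from the actions\<close>

lemma M_modules: "left_module H M (lact M)" "right_module H M (ract M)"
  and M_bimodule: "h \<in> carrier H \<Longrightarrow> k \<in> carrier H \<Longrightarrow> m \<in> carrier A \<Longrightarrow> ract M (lact M h m) k = lact M h (ract M m k)"
  using M_hopf_bimodule by (simp_all add: is_hopf_bimodule_def M_space)

lemma M_act_closed [simp]: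
  "h \<in> carrier H \<Longrightarrow> a \<in> carrier A \<Longrightarrow> lact M h a \<in> carrier A"
  "h \<in> carrier H \<Longrightarrow> a \<in> carrier A \<Longrightarrow> ract M a h \<in> carrier A"
  using M_modules by (simp_all add: left_module_def right_module_def linear_on_def M_space)

text \<open>Let \<mu> be the factorisation of the product through the tensor product over
  \<open>H\<close>. Its right linearity gives a \<sigma>(h) = \<mu>(a \<otimes> 1 h) = \<mu>(a
  \<otimes> 1) h = a h. Balancing gives \<sigma>(h) a = \<mu>(1 h \<otimes> a) = \<mu>(1 \<otimes> h
  a) = h a.\<close>

lemma M_act:
  assumes h: "h \<in> carrier H" and a: "a \<in> carrier A"
  shows "ract M a h = a \<cdot> \<sigma> h" and "lact M h a = \<sigma> h \<cdot> a"
proof -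
  obtain \<mu> where hom: "hopf_bimodule_hom H (hopf_bimod_tensor H M M) M \<mu>"
    and mu: "\<And>a b. a \<in> carrier A \<Longrightarrow> b \<in> carrier A \<Longrightarrow> a \<cdot> b = \<mu> (btens H M M a b)"
    using compatible by (auto simp: compatible_structure_def becomes_algebra_def)
  let ?MM = "balanced_space H M M"
  have bt_closed: "btens H M M m n \<in> carrier ?MM" if "m \<in> carrier A" "n \<in> carrier A" for m n
    using linear_closed[OF bilinear_compose1[OF bilinear_btens[of M M H] linear_ident]] that
    by (simp add: M_space)
  have balanced: "btens H M M (ract M m k) n = btens H M M m (lact M k n)"
    if "m \<in> carrier A" "k \<in> carrier H" "n \<in> carrier A" for m k n
    using balanced_btens[of m M k H n M] that by (simp add: M_space)
  have "\<sigma> h \<in> carrier A"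
    using h by (simp add: \<sigma>_def)
  have "ract (hopf_bimod_tensor H M M) (btens H M M a \<one>) h = btens H M M a (\<sigma> h)"
  proof -
    have ract_lin: "linear_on A A (\<lambda>n. ract M n h)"
      using M_modules h by (simp add: right_module_def)
    note [simp] = bilinear_compose1[OF bilinear_btens[of M M H]] bilinear_compose2[OF bilinear_btens[of M M H]]
      linear_compose[OF ract_lin]
    have "bsum H M M (btens H M M a \<one>) (\<lambda>m n. btens H M M m (ract M n h)) = btens H M M a (ract M \<one> h)"
      by (rule balanced_universal(2)[of M M ?MM])
        (use h a in \<open>simp_all add: vspace_balanced M_space balanced M_bimodule\<close>)
    then show ?thesis
      by (simp add: hopf_bimod_tensor_def Let_def \<sigma>_def)
  qed
  moreover have "carrier (hopf_bimod_tensor H M M) = carrier ?MM"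
    by (simp add: hopf_bimod_tensor_def Let_def)
  ultimately have "\<mu> (btens H M M a (\<sigma> h)) = ract M (\<mu> (btens H M M a \<one>)) h"
    using hom h a bt_closed[of a "\<one>"] by (metis A.unit_closed hopf_bimodule_hom_def)
  then show "ract M a h = a \<cdot> \<sigma> h"
    using mu[of a "\<sigma> h"] mu[of a "\<one>"] a \<open>\<sigma> h \<in> carrier A\<close> by simp
  have "\<sigma> h \<cdot> a = \<mu> (btens H M M \<one> (lact M h a))"
    using mu[of "\<sigma> h" a] balanced[of "\<one>" h a] h a by (simp add: \<sigma>_def)
  also have "\<dots> = lact M h a"
    using mu[of "\<one>" "lact M h a"] h a by simp
  finally show "lact M h a = \<sigma> h \<cdot> a" by simp
qed

lemma sigma_closed [simp]: "h \<in> carrier H \<Longrightarrow> \<sigma> h \<in> carrier A"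
  by (simp add: \<sigma>_def)

text \<open>The coactions are algebra maps, so the unit of \<open>A\<close> has trivial coactions,
  and the Hopf bimodule condition determines those of 1 h.\<close>

lemma sigma_coact:
  assumes h: "h \<in> carrier H"
  shows "lcoact M (\<sigma> h) = csum H h (\<lambda>x y. x \<otimes>\<^bsub>H,A\<^esub> \<sigma> y)" and "rcoact M (\<sigma> h) = csum H h (\<lambda>x y. \<sigma> x \<otimes>\<^bsub>A,H\<^esub> y)"
proof -
  have sigma_linear: "linear_on H A \<sigma>"
    using M_modules unfolding \<sigma>_def by (simp add: right_module_def M_space)
  note [simp] = linear_compose[OF sigma_linear]
  have "lcoact M (ract M \<one> h) = sw2 H h (\<lambda>h1 h2. tsum H M (lcoact M \<one>) (\<lambda>a m0. (a \<cdot>\<^bsub>H\<^esub> h1) \<otimes>\<^bsub>H,M\<^esub> ract M m0 h2))"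
    "rcoact M (ract M \<one> h) = sw2 H h (\<lambda>h1 h2. tsum M H (rcoact M \<one>) (\<lambda>m0 a. ract M m0 h1 \<otimes>\<^bsub>M,H\<^esub> (a \<cdot>\<^bsub>H\<^esub> h2)))"
    using M_hopf_bimodule h by (simp_all add: is_hopf_bimodule_def M_space)
  then show "lcoact M (\<sigma> h) = csum H h (\<lambda>x y. x \<otimes>\<^bsub>H,A\<^esub> \<sigma> y)" "rcoact M (\<sigma> h) = csum H h (\<lambda>x y. \<sigma> x \<otimes>\<^bsub>A,H\<^esub> y)"
    using h by (simp_all add: \<sigma>_def[of h, symmetric] tsum_ssum M_act M_coact_unit
        ssum_tens[where U = "H \<Otimes> A"] ssum_tens[where U = "A \<Otimes> H"])
qed

lemma splitting: "splitting_bimodule A H \<pi> \<sigma> M"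
proof -
  have sigma_linear: "linear_on H A \<sigma>"
    using M_modules unfolding \<sigma>_def by (simp add: right_module_def M_space)
  have "algebra_hom H A \<sigma>"
    unfolding algebra_hom_def
  proof (intro conjI ballI)
    fix h k assume hk: "h \<in> carrier H" "k \<in> carrier H"
    then have "\<sigma> (h \<cdot>\<^bsub>H\<^esub> k) = ract M (\<sigma> h) k"
      using M_modules by (simp add: right_module_def \<sigma>_def M_space)
    with hk show "\<sigma> (h \<cdot>\<^bsub>H\<^esub> k) = \<sigma> h \<cdot> \<sigma> k" by (simp add: M_act)
  next
    show "\<sigma> \<one>\<^bsub>H\<^esub> = \<one>"
      using M_modules by (simp add: right_module_def \<sigma>_def M_space)
  qed (fact sigma_linear)
  moreover have "\<pi> (\<sigma> h) = h" if h: "h \<in> carrier H" for h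
  proof (rule form_eqI[OF H.vspace])
    fix \<phi> assume \<phi>: "form H \<phi>"
    note [simp] = linear_compose[OF sigma_linear] linear_compose[OF \<phi>]
    \<comment> \<open>Here right linearity of the counit enters. It makes \<pi>(\<sigma>(h)) =
      \<epsilon>(\<sigma>(h_1)) h_2 equal to \<open>h\<close>.\<close>
    have "counit A (\<sigma> x) = counit H x" if "x \<in> carrier H" for x
      using compatible that by (simp add: compatible_structure_def \<sigma>_def)
    then show "\<phi> (\<pi> (\<sigma> h)) = \<phi> h"
      using h \<phi> by (simp add: form_pi sigma_coact)
  qed (use h in simp_all)
  moreover have "bicomodule_hom H (bicomod_via H H id) (bicomod_via H A \<pi>) \<sigma>"
  proof -
    have [simp]: "carrier (bicomod_via H A \<pi>) = carrier A" "scale (bicomod_via H A \<pi>) = scale A"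
      "carrier (bicomod_via H H id) = carrier H" "scale (bicomod_via H H id) = scale H"
      by (simp_all add: bicomod_via_def)
    interpret A': same_space A "bicomod_via H A \<pi>" by standard simp_all
    interpret H': same_space H "bicomod_via H H id" by standard simp_all
    show ?thesis
      unfolding bicomodule_hom_def
      using sigma_linear by (simp add: tsum_ssum) (simp add: bicomod_via_def sigma_coact M_coact_pi[symmetric] tsum_ssum)
  qed
  ultimately have "bicolinear_splitting H A \<pi> \<sigma>"
    using pi_hom by (simp add: bicolinear_splitting_def)
  then interpret splitting A H \<pi> \<sigma> by unfold_locales
  show ?thesis
    by unfold_locales (simp_all add: M_space M_act M_coact_pi rco_def lco_def)
qed

end

section \<open>Splittings from bosonizations\<close>

text \<open>\<open>R\<close> may live on any type; it is tied to \<open>A\<close> only through the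
  isomorphism \<open>f\<close>.\<close>

locale bosonized = A: bialgebra_on A + H: hopf_on H
  for A :: "('k::field, 'a::ab_group_add) bialgebra" (structure) and H :: "('k, 'h::ab_group_add) hopf" +
  fixes R :: "('k, 'h, 'r::ab_group_add) yd" and e d w f
  assumes quadruple: "yd_quadruple H R e d w"
    and hom: "bialgebra_hom A (bosonization H R e d w) f"
    and bij: "bij_betw f (carrier A) (carrier (bosonization H R e d w))"
begin

abbreviation RR where "RR \<equiv> yd_tensor H R R"
abbreviation B where "B \<equiv> bosonization H R e d w"
abbreviation LR :: "'r \<Rightarrow> ('h \<Rightarrow> 'r \<Rightarrow> 'u::ab_group_add) \<Rightarrow> 'u" where "LR r \<equiv> ssum H R (coact R r)"

lemma R_yd_algebra: "yd_algebra H R"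
  using quadruple by (simp add: yd_quadruple_def Let_def)

sublocale R: algebra_on R
  by standard (use R_yd_algebra in \<open>simp add: yd_algebra_def\<close>)

lemma R_module: "left_module H R (act R)" and R_comodule: "left_comodule H R (coact R)"
  using R_yd_algebra by (simp_all add: yd_algebra_def yd_module_def)

lemma act_bilinear: "bilinear_on H R R (act R)" and coact_linear: "linear_on R (H \<Otimes> R) (coact R)"
  using R_module R_comodule unfolding left_module_def left_comodule_def by blast+

lemmas linear_act [simp] = bilinear_rules[OF act_bilinear]
lemmas linear_coact [simp] = linear_compose[OF coact_linear]

lemma act_closed [simp]: "h \<in> carrier H \<Longrightarrow> r \<in> carrier R \<Longrightarrow> act R h r \<in> carrier R"
  and coact_closed [simp]: "r \<in> carrier R \<Longrightarrow> coact R r \<in> carrier (H \<Otimes> R)"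
  using linear_closed[OF linear_act(1)[OF linear_ident]] linear_closed[OF coact_linear] by auto

lemma unit_act [simp]: "r \<in> carrier R \<Longrightarrow> act R \<one>\<^bsub>H\<^esub> r = r"
  using R_module by (simp add: left_module_def)

lemma LR_counit [simp]:
  fixes g :: "_ \<Rightarrow> 'k"
  assumes r: "r \<in> carrier R" and g: "form R g"
  shows "LR r (\<lambda>a s. counit H a * g s) = g r"
proof -
  note [simp] = linear_ssum[OF g] linear_scale[OF g]
  have "g (LR r (\<lambda>a s. scale R (counit H a) s)) = g r"
    using R_comodule r by (simp add: left_comodule_def tsum_ssum)
  then show ?thesis using r by simp
qed

lemma act_one [simp]: "h \<in> carrier H \<Longrightarrow> act R h \<one>\<^bsub>R\<^esub> = scale R (counit H h) \<one>\<^bsub>R\<^esub>"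
  and coact_one [simp]: "coact R \<one>\<^bsub>R\<^esub> = \<one>\<^bsub>H\<^esub> \<otimes>\<^bsub>H,R\<^esub> \<one>\<^bsub>R\<^esub>"
proof -
  have unit: "yd_hom H (yd_ground H) R (\<lambda>c. scale R c \<one>\<^bsub>R\<^esub>)"
    using R_yd_algebra by (simp add: yd_algebra_def)
  have [simp]: "carrier (yd_ground H) = UNIV" "scale (yd_ground H) = (*)"
    by (simp_all add: yd_ground_def)
  have [simp]: "scale R 1 \<one>\<^bsub>R\<^esub> = \<one>\<^bsub>R\<^esub>"
    by (simp add: vspaceD)
  have act: "scale R (act (yd_ground H) h c) \<one>\<^bsub>R\<^esub> = act R h (scale R c \<one>\<^bsub>R\<^esub>)" if "h \<in> carrier H" for h c
    using unit that by (simp add: yd_hom_def)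
  show "act R h \<one>\<^bsub>R\<^esub> = scale R (counit H h) \<one>\<^bsub>R\<^esub>" if "h \<in> carrier H"
    using act[OF that, of 1] by (simp add: yd_ground_def)
  have yd_ground_coact: "coact (yd_ground H) c = \<one>\<^bsub>H\<^esub> \<otimes>\<^bsub>H,ground\<^esub> c" for c
    by (simp add: yd_ground_def)
  have [simp]: "tsum H (yd_ground H) = tsum H ground"
    by (rule tsum_cong_space) simp_all
  have "\<forall>c\<in>carrier (yd_ground H). coact R (scale R c \<one>\<^bsub>R\<^esub>)
      = tsum H (yd_ground H) (coact (yd_ground H) c) (\<lambda>a c. a \<otimes>\<^bsub>H,R\<^esub> scale R c \<one>\<^bsub>R\<^esub>)"
    using unit unfolding yd_hom_def by blast
  from bspec[OF this, of 1] show "coact R \<one>\<^bsub>R\<^esub> = \<one>\<^bsub>H\<^esub> \<otimes>\<^bsub>H,R\<^esub> \<one>\<^bsub>R\<^esub>"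
    by (simp add: yd_ground_coact tsum_ssum ssum_tens[where U = "H \<Otimes> R"])
qed

lemma RR_space [simp]: "carrier RR = carrier (R \<Otimes> R)" "scale RR = tscale"
  by (simp_all add: yd_tensor_def)

lemma e_form: "form R e" and d_linear: "linear_on R (R \<Otimes> R) d" and w_linear: "linear_on H (R \<Otimes> R) w"
proof -
  interpret RR: same_space "R \<Otimes> R" RR by standard simp_all
  show "form R e" "linear_on R (R \<Otimes> R) d" "linear_on H (R \<Otimes> R) w"
    using quadruple unfolding yd_quadruple_def Let_def RR.same_space_simps by blast+
qed

lemmas linear_e [simp] = linear_compose[OF e_form]

lemma d_closed [simp]: "r \<in> carrier R \<Longrightarrow> d r \<in> carrier (R \<Otimes> R)"
  and w_closed [simp]: "h \<in> carrier H \<Longrightarrow> w h \<in> carrier (R \<Otimes> R)"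
  using linear_closed[OF d_linear] linear_closed[OF w_linear] by auto

lemma e_simps [simp]:
  "h \<in> carrier H \<Longrightarrow> r \<in> carrier R \<Longrightarrow> e (act R h r) = e r * counit H h"
  "r \<in> carrier R \<Longrightarrow> s \<in> carrier R \<Longrightarrow> e (r \<cdot>\<^bsub>R\<^esub> s) = e r * e s"
  "e \<one>\<^bsub>R\<^esub> = 1"
  using quadruple by (simp_all add: yd_quadruple_def Let_def)

lemma LR_e:
  fixes g :: "_ \<Rightarrow> 'k"
  assumes r: "r \<in> carrier R" and g: "form H g"
  shows "LR r (\<lambda>a s. e s * g a) = e r * g \<one>\<^bsub>H\<^esub>"
proof -
  note [simp] = linear_ssum[OF g] linear_scale[OF g]
  have "g (LR r (\<lambda>a s. scale H (e s) a)) = g (scale H (e r) \<one>\<^bsub>H\<^esub>)"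
    using quadruple r by (simp add: yd_quadruple_def Let_def tsum_ssum)
  then show ?thesis using r by simp
qed

lemma d_counit:
  fixes g :: "_ \<Rightarrow> 'k"
  assumes r: "r \<in> carrier R" and g: "form R g"
  shows "ssum R R (d r) (\<lambda>x y. e x * g y) = g r" and "ssum R R (d r) (\<lambda>x y. e y * g x) = g r"
proof -
  note [simp] = linear_ssum[OF g] linear_scale[OF g]
  have "g (ssum R R (d r) (\<lambda>x y. scale R (e x) y)) = g r" "g (ssum R R (d r) (\<lambda>x y. scale R (e y) x)) = g r"
    using quadruple r by (simp_all add: yd_quadruple_def Let_def tsum_ssum)
  then show "ssum R R (d r) (\<lambda>x y. e x * g y) = g r" "ssum R R (d r) (\<lambda>x y. e y * g x) = g r"
    using r by simp_all
qed

lemma w_counit: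
  fixes g :: "_ \<Rightarrow> 'k"
  assumes h: "h \<in> carrier H" and g: "form R g"
  shows "ssum R R (w h) (\<lambda>x y. e x * g y) = counit H h * g \<one>\<^bsub>R\<^esub>"
    and "ssum R R (w h) (\<lambda>x y. e y * g x) = counit H h * g \<one>\<^bsub>R\<^esub>"
proof -
  note [simp] = linear_ssum[OF g] linear_scale[OF g]
  have "g (ssum R R (w h) (\<lambda>x y. scale R (e x) y)) = g (scale R (counit H h) \<one>\<^bsub>R\<^esub>)"
    "g (ssum R R (w h) (\<lambda>x y. scale R (e y) x)) = g (scale R (counit H h) \<one>\<^bsub>R\<^esub>)"
    using quadruple h by (simp_all add: yd_quadruple_def Let_def tsum_ssum)
  then show "ssum R R (w h) (\<lambda>x y. e x * g y) = counit H h * g \<one>\<^bsub>R\<^esub>"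
    "ssum R R (w h) (\<lambda>x y. e y * g x) = counit H h * g \<one>\<^bsub>R\<^esub>"
    using h by simp_all
qed

lemma RR_mult:
  assumes "s \<in> carrier (R \<Otimes> R)" and "t \<in> carrier (R \<Otimes> R)"
  shows "s \<cdot>\<^bsub>RR\<^esub> t = ssum R R s (\<lambda>r s. ssum R R t (\<lambda>t v. LR s (\<lambda>a s0. (r \<cdot>\<^bsub>R\<^esub> act R a t) \<otimes>\<^bsub>R,R\<^esub> (s0 \<cdot>\<^bsub>R\<^esub> v))))"
  using assms by (simp add: yd_tensor_def tsum_ssum)

lemma RR_mult_closed [simp]:
  "s \<in> carrier (R \<Otimes> R) \<Longrightarrow> t \<in> carrier (R \<Otimes> R) \<Longrightarrow> s \<cdot>\<^bsub>RR\<^esub> t \<in> carrier (R \<Otimes> R)"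
  by (simp add: RR_mult)

text \<open>The point is that \<open>e \<otimes> R\<close> and \<open>R \<otimes> e\<close> are multiplicative on \<open>R \<Otimes> R\<close>.\<close>

lemma dw_counit:
  fixes g :: "_ \<Rightarrow> 'k"
  assumes r: "r \<in> carrier R" and h: "h \<in> carrier H" and g: "form R g"
  shows "ssum R R (d r \<cdot>\<^bsub>RR\<^esub> w h) (\<lambda>x y. e x * g y) = counit H h * g r"
    and "ssum R R (d r \<cdot>\<^bsub>RR\<^esub> w h) (\<lambda>x y. e y * g x) = counit H h * g r"
proof -
  note [simp] = form_rules[OF g]
  have "ssum R R (d r \<cdot>\<^bsub>RR\<^esub> w h) (\<lambda>x y. e x * g y)
    = ssum R R (d r) (\<lambda>x y. ssum R R (w h) (\<lambda>t v. LR y (\<lambda>a y0. e x * (e t * (counit H a * g (y0 \<cdot>\<^bsub>R\<^esub> v))))))"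
    using r h by (simp add: RR_mult mult.assoc)
  also have "\<dots> = ssum R R (d r) (\<lambda>x y. e x * ssum R R (w h) (\<lambda>t v. e t * g (y \<cdot>\<^bsub>R\<^esub> v)))"
    using LR_counit[where g = "\<lambda>y. g (y \<cdot>\<^bsub>R\<^esub> v)" for v] by simp
  also have "\<dots> = ssum R R (w h) (\<lambda>t v. e t * g (r \<cdot>\<^bsub>R\<^esub> v))"
    by (rule d_counit(1)) (use r in simp_all)
  also have "\<dots> = counit H h * g r"
    using r h w_counit(1)[where g = "\<lambda>v. g (r \<cdot>\<^bsub>R\<^esub> v)"] by simp
  finally show "ssum R R (d r \<cdot>\<^bsub>RR\<^esub> w h) (\<lambda>x y. e x * g y) = counit H h * g r" .
  have "ssum R R (d r \<cdot>\<^bsub>RR\<^esub> w h) (\<lambda>x y. e y * g x)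
    = ssum R R (d r) (\<lambda>x y. ssum R R (w h) (\<lambda>t v. LR y (\<lambda>a y0. e y0 * (e v * g (x \<cdot>\<^bsub>R\<^esub> act R a t)))))"
    using r h by (simp add: RR_mult mult.assoc)
  also have "\<dots> = ssum R R (d r) (\<lambda>x y. e y * ssum R R (w h) (\<lambda>t v. e v * g (x \<cdot>\<^bsub>R\<^esub> t)))"
    using LR_e[where g = "\<lambda>a. e v * g (x \<cdot>\<^bsub>R\<^esub> act R a t)" for v x t] by simp
  also have "\<dots> = ssum R R (w h) (\<lambda>t v. e v * g (r \<cdot>\<^bsub>R\<^esub> t))"
    by (rule d_counit(2)) (use r in simp_all)
  also have "\<dots> = counit H h * g r"
    using r h w_counit(2)[where g = "\<lambda>v. g (r \<cdot>\<^bsub>R\<^esub> v)"] by simp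
  finally show "ssum R R (d r \<cdot>\<^bsub>RR\<^esub> w h) (\<lambda>x y. e y * g x) = counit H h * g r" .
qed

lemma B_space [simp]: "carrier B = carrier (R \<Otimes> H)" "scale B = tscale" "unit B = \<one>\<^bsub>R\<^esub> \<otimes>\<^bsub>R,H\<^esub> \<one>\<^bsub>H\<^esub>"
  by (simp_all add: bosonization_def)

sublocale B: same_space "R \<Otimes> H" B
  by standard simp_all

section \<open>The projection of the bosonization onto H\<close>

definition p where "p t = ssum R H t (\<lambda>r h. scale H (e r) h)"

lemma p_linear: "linear_on (R \<Otimes> H) H p"
  unfolding p_def by simp

lemmas linear_p [simp] = linear_compose[OF p_linear]

lemma p_closed [simp]: "t \<in> carrier (R \<Otimes> H) \<Longrightarrow> p t \<in> carrier H"
  by (rule linear_closed[OF p_linear])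

lemma form_p:
  fixes g :: "_ \<Rightarrow> 'k"
  shows "form H g \<Longrightarrow> t \<in> carrier (R \<Otimes> H) \<Longrightarrow> g (p t) = ssum R H t (\<lambda>r h. e r * g h)"
  by (simp add: p_def linear_ssum[of H ground g] linear_scale[of H ground g])

lemma p_tens [simp]: "r \<in> carrier R \<Longrightarrow> h \<in> carrier H \<Longrightarrow> p (r \<otimes>\<^bsub>R,H\<^esub> h) = scale H (e r) h"
  by (simp add: p_def ssum_tens[where U = H])

lemma B_mult:
  assumes "x \<in> carrier (R \<Otimes> H)" and "y \<in> carrier (R \<Otimes> H)"
  shows "x \<cdot>\<^bsub>B\<^esub> y = ssum R H x (\<lambda>r h. ssum R H y (\<lambda>s k. csum H h (\<lambda>h1 h2.
    (r \<cdot>\<^bsub>R\<^esub> act R h1 s) \<otimes>\<^bsub>R,H\<^esub> (h2 \<cdot>\<^bsub>H\<^esub> k))))"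
  using assms by (simp add: bosonization_def tsum_ssum)

text \<open>\<open>e\<close> is multiplicative and sees the action only through the counit of
  \<open>H\<close>, so the twist of the smash product disappears under \<open>p\<close>.\<close>

lemma p_mult:
  assumes x: "x \<in> carrier (R \<Otimes> H)" and y: "y \<in> carrier (R \<Otimes> H)"
  shows "p (x \<cdot>\<^bsub>B\<^esub> y) = p x \<cdot>\<^bsub>H\<^esub> p y"
proof (rule form_eqI[OF H.vspace])
  fix \<phi> assume \<phi>: "form H \<phi>"
  note [simp] = form_rules[OF \<phi>] linear_scale[OF \<phi>] linear_ssum[OF p_linear]
  have "\<phi> (p (x \<cdot>\<^bsub>B\<^esub> y)) = ssum R H x (\<lambda>r h. ssum R H y (\<lambda>s k. csum H h (\<lambda>h1 h2.
      e r * (e s * (counit H h1 * \<phi> (h2 \<cdot>\<^bsub>H\<^esub> k))))))"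
    using x y by (simp add: B_mult mult.assoc)
  also have "\<dots> = ssum R H x (\<lambda>r h. e r * ssum R H y (\<lambda>s k. e s * \<phi> (h \<cdot>\<^bsub>H\<^esub> k)))"
    by simp
  also have "\<dots> = ssum R H x (\<lambda>r h. e r * \<phi> (h \<cdot>\<^bsub>H\<^esub> p y))"
    using y form_p[where g = "\<lambda>k. \<phi> (h \<cdot>\<^bsub>H\<^esub> k)" for h] by simp
  also have "\<dots> = \<phi> (p x \<cdot>\<^bsub>H\<^esub> p y)"
    using x y form_p[where g = "\<lambda>h. \<phi> (h \<cdot>\<^bsub>H\<^esub> p y)"] by simp
  finally show "\<phi> (p (x \<cdot>\<^bsub>B\<^esub> y)) = \<phi> (p x \<cdot>\<^bsub>H\<^esub> p y)" .
qed (use x y in \<open>simp_all add: B_mult\<close>)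

lemma B_comult:
  assumes "x \<in> carrier (R \<Otimes> H)"
  shows "comult B x = ssum R H x (\<lambda>r h. csum H h (\<lambda>h1 z. csum H z (\<lambda>h2 h3.
    ssum R R (d r \<cdot>\<^bsub>RR\<^esub> w h1) (\<lambda>p q. LR q (\<lambda>a q0.
      (p \<otimes>\<^bsub>R,H\<^esub> (a \<cdot>\<^bsub>H\<^esub> h2)) \<otimes>\<^bsub>R \<Otimes> H, R \<Otimes> H\<^esub> (q0 \<otimes>\<^bsub>R,H\<^esub> h3))))))"
  using assms by (simp add: bosonization_def tsum_ssum sw3_def)

text \<open>These are the left and right coactions that \<open>p\<close> induces on the
  bosonization. Applying \<open>e\<close> to one leg reduces \<delta>(r) \<omega>(h_1) to
  \<open>r\<close> by \<open>dw_counit\<close>; for the right leg \<open>LR_e\<close> first removes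
  the coaction of \<open>q\<close>. Both the comultiplicativity of \<open>\<pi>\<close> and the
  bicolinearity of \<open>\<sigma>\<close> are read off from them.\<close>

lemma ssum_B_comult:
  fixes G :: "_ \<Rightarrow> _ \<Rightarrow> 'k"
  assumes x: "x \<in> carrier (R \<Otimes> H)"
  shows "biform H (R \<Otimes> H) G \<Longrightarrow> ssum (R \<Otimes> H) (R \<Otimes> H) (comult B x) (\<lambda>u v. G (p u) v)
      = ssum R H x (\<lambda>r h. csum H h (\<lambda>h1 h2. LR r (\<lambda>a r0. G (a \<cdot>\<^bsub>H\<^esub> h1) (r0 \<otimes>\<^bsub>R,H\<^esub> h2))))"
    and "biform (R \<Otimes> H) H G' \<Longrightarrow> ssum (R \<Otimes> H) (R \<Otimes> H) (comult B x) (\<lambda>u v. G' u (p v))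
      = ssum R H x (\<lambda>r h. csum H h (\<lambda>h1 h2. G' (r \<otimes>\<^bsub>R,H\<^esub> h1) h2))"
proof -
  assume G: "biform H (R \<Otimes> H) G"
  note [simp] = bilinear_rules[OF G]
    linear_scale[OF bilinear_compose1[OF G linear_ident]]
  have "ssum (R \<Otimes> H) (R \<Otimes> H) (comult B x) (\<lambda>u v. G (p u) v)
    = ssum R H x (\<lambda>r h. csum H h (\<lambda>h1 z. csum H z (\<lambda>h2 h3.
        ssum R R (d r \<cdot>\<^bsub>RR\<^esub> w h1) (\<lambda>p q. e p * LR q (\<lambda>a q0. G (a \<cdot>\<^bsub>H\<^esub> h2) (q0 \<otimes>\<^bsub>R,H\<^esub> h3))))))"
    using x by (simp add: B_comult)
  also have "\<dots> = ssum R H x (\<lambda>r h. csum H h (\<lambda>h1 z. counit H h1 * csum H z (\<lambda>h2 h3.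
        LR r (\<lambda>a q0. G (a \<cdot>\<^bsub>H\<^esub> h2) (q0 \<otimes>\<^bsub>R,H\<^esub> h3)))))"
    using dw_counit(1)[where g = "\<lambda>q. LR q (\<lambda>a q0. G (a \<cdot>\<^bsub>H\<^esub> h2) (q0 \<otimes>\<^bsub>R,H\<^esub> h3))" for h2 h3] by simp
  also have "\<dots> = ssum R H x (\<lambda>r h. csum H h (\<lambda>h1 h2. LR r (\<lambda>a r0. G (a \<cdot>\<^bsub>H\<^esub> h1) (r0 \<otimes>\<^bsub>R,H\<^esub> h2))))"
    by simp
  finally show "ssum (R \<Otimes> H) (R \<Otimes> H) (comult B x) (\<lambda>u v. G (p u) v)
      = ssum R H x (\<lambda>r h. csum H h (\<lambda>h1 h2. LR r (\<lambda>a r0. G (a \<cdot>\<^bsub>H\<^esub> h1) (r0 \<otimes>\<^bsub>R,H\<^esub> h2))))" .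
next
  assume G: "biform (R \<Otimes> H) H G'"
  note [simp] = bilinear_rules[OF G]
    linear_scale[OF bilinear_compose2[OF G linear_ident]]
  have "ssum (R \<Otimes> H) (R \<Otimes> H) (comult B x) (\<lambda>u v. G' u (p v))
    = ssum R H x (\<lambda>r h. csum H h (\<lambda>h1 z. csum H z (\<lambda>h2 h3.
        ssum R R (d r \<cdot>\<^bsub>RR\<^esub> w h1) (\<lambda>p q. LR q (\<lambda>a q0. e q0 * G' (p \<otimes>\<^bsub>R,H\<^esub> (a \<cdot>\<^bsub>H\<^esub> h2)) h3)))))"
    using x by (simp add: B_comult)
  also have "\<dots> = ssum R H x (\<lambda>r h. csum H h (\<lambda>h1 z. csum H z (\<lambda>h2 h3.
        ssum R R (d r \<cdot>\<^bsub>RR\<^esub> w h1) (\<lambda>p q. e q * G' (p \<otimes>\<^bsub>R,H\<^esub> h2) h3))))"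
    using LR_e[where g = "\<lambda>a. G' (p \<otimes>\<^bsub>R,H\<^esub> (a \<cdot>\<^bsub>H\<^esub> h2)) h3" for p h2 h3] by simp
  also have "\<dots> = ssum R H x (\<lambda>r h. csum H h (\<lambda>h1 z. counit H h1 * csum H z (\<lambda>h2 h3.
        G' (r \<otimes>\<^bsub>R,H\<^esub> h2) h3)))"
    using dw_counit(2)[where g = "\<lambda>p. G' (p \<otimes>\<^bsub>R,H\<^esub> h2) h3" for h2 h3] by simp
  also have "\<dots> = ssum R H x (\<lambda>r h. csum H h (\<lambda>h1 h2. G' (r \<otimes>\<^bsub>R,H\<^esub> h1) h2))"
    by simp
  finally show "ssum (R \<Otimes> H) (R \<Otimes> H) (comult B x) (\<lambda>u v. G' u (p v))
      = ssum R H x (\<lambda>r h. csum H h (\<lambda>h1 h2. G' (r \<otimes>\<^bsub>R,H\<^esub> h1) h2))" .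
qed

section \<open>Transport of the splitting along the isomorphism\<close>

lemma f_linear: "linear_on A (R \<Otimes> H) f"
  using hom unfolding bialgebra_hom_def algebra_hom_def by simp

lemmas linear_f [simp] = linear_compose[OF f_linear]

lemma f_closed [simp]: "a \<in> carrier A \<Longrightarrow> f a \<in> carrier (R \<Otimes> H)"
  by (rule linear_closed[OF f_linear])

lemma f_hom:
  "a \<in> carrier A \<Longrightarrow> b \<in> carrier A \<Longrightarrow> f (a \<cdot> b) = f a \<cdot>\<^bsub>B\<^esub> f b"
  "f \<one> = \<one>\<^bsub>R\<^esub> \<otimes>\<^bsub>R,H\<^esub> \<one>\<^bsub>H\<^esub>"
  "a \<in> carrier A \<Longrightarrow> comult B (f a) = csum A a (\<lambda>x y. f x \<otimes>\<^bsub>R \<Otimes> H, R \<Otimes> H\<^esub> f y)"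
  "a \<in> carrier A \<Longrightarrow> counit B (f a) = counit A a"
  using hom by (simp_all add: bialgebra_hom_def algebra_hom_def)

definition g where "g = inv_into (carrier A) f"

lemma g_closed [simp]: "t \<in> carrier (R \<Otimes> H) \<Longrightarrow> g t \<in> carrier A"
  and f_g [simp]: "t \<in> carrier (R \<Otimes> H) \<Longrightarrow> f (g t) = t"
  and g_f [simp]: "a \<in> carrier A \<Longrightarrow> g (f a) = a"
  using bij by (auto simp: g_def bij_betw_def inv_into_into f_inv_into_f inv_into_f_f)

lemma f_inj: "a \<in> carrier A \<Longrightarrow> b \<in> carrier A \<Longrightarrow> f a = f b \<Longrightarrow> a = b"
  using g_f by metis

lemma g_linear: "linear_on (R \<Otimes> H) A g"
  unfolding linear_on_def
proof (intro conjI ballI allI)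
  show "g (s + t) = g s + g t" if "s \<in> carrier (R \<Otimes> H)" "t \<in> carrier (R \<Otimes> H)" for s t
    using that by (intro f_inj) (simp_all add: linear_add[OF f_linear] vspaceD
        vspaceD(2)[OF vspace_tensor])
  show "g (scale (R \<Otimes> H) c t) = scale A c (g t)" if "t \<in> carrier (R \<Otimes> H)" for c t
    using that by (intro f_inj) (simp_all add: linear_scale[OF f_linear])
qed simp

lemmas linear_g [simp] = linear_compose[OF g_linear]

definition \<pi> where "\<pi> a = p (f a)"
definition \<sigma> where "\<sigma> h = g (\<one>\<^bsub>R\<^esub> \<otimes>\<^bsub>R,H\<^esub> h)"

lemma pi_linear: "linear_on A H \<pi>" and sigma_linear: "linear_on H A \<sigma>"
  unfolding \<pi>_def \<sigma>_def by simp_all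

lemmas linear_pi_sigma [simp] = linear_compose[OF pi_linear] linear_compose[OF sigma_linear]

lemma pi_sigma_closed [simp]: "a \<in> carrier A \<Longrightarrow> \<pi> a \<in> carrier H" "h \<in> carrier H \<Longrightarrow> \<sigma> h \<in> carrier A"
  by (simp_all add: \<pi>_def \<sigma>_def)

lemma pi_sigma: "h \<in> carrier H \<Longrightarrow> \<pi> (\<sigma> h) = h"
  by (simp add: \<pi>_def \<sigma>_def vspaceD)

lemma pi_hom: "bialgebra_hom A H \<pi>"
proof -
  have "\<pi> (a \<cdot> b) = \<pi> a \<cdot>\<^bsub>H\<^esub> \<pi> b" if "a \<in> carrier A" "b \<in> carrier A" for a b
    using that by (simp add: \<pi>_def f_hom p_mult)
  moreover have "\<pi> \<one> = \<one>\<^bsub>H\<^esub>"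
    by (simp add: \<pi>_def f_hom vspaceD)
  moreover have "comult H (\<pi> a) = sw2 A a (\<lambda>x y. \<pi> x \<otimes>\<^bsub>H,H\<^esub> \<pi> y)" (is "?l = ?r") if a: "a \<in> carrier A" for a
  proof (rule form_eqI[OF vspace_tensor])
    fix \<phi> assume \<phi>: "form (H \<Otimes> H) \<phi>"
    note [simp] = form_rules[OF \<phi>]
      linear_scale[OF linear_compose[OF \<phi> linear_tens(1)[OF linear_ident]]]
    have "\<phi> ?r
      = ssum (R \<Otimes> H) (R \<Otimes> H) (comult B (f a)) (\<lambda>u v. \<phi> (p u \<otimes>\<^bsub>H,H\<^esub> p v))"
      using a by (simp add: \<pi>_def f_hom)
    \<comment> \<open>Only the second \<open>p\<close> is pulled through the comultiplication; the
      first is left in place and then meets an elementary tensor.\<close>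
    also have "\<dots> = ssum R H (f a) (\<lambda>r h. csum H h (\<lambda>k l. \<phi> (p (r \<otimes>\<^bsub>R,H\<^esub> k) \<otimes>\<^bsub>H,H\<^esub> l)))"
      by (rule ssum_B_comult) (use a in simp_all)
    also have "\<dots> = ssum R H (f a) (\<lambda>r h. e r * csum H h (\<lambda>k l. \<phi> (k \<otimes>\<^bsub>H,H\<^esub> l)))"
      by (simp del: tens_scale)
    also have "\<dots> = ssum R H (f a) (\<lambda>r h. e r * \<phi> (comult H h))"
      by (simp add: form_tensor[OF \<phi>, of "comult H h" for h])
    also have "\<dots> = \<phi> ?l"
      using a form_p[where g = "\<lambda>h. \<phi> (comult H h)"] by (simp add: \<pi>_def)
    finally show "\<phi> ?l = \<phi> ?r" by simp
  qed (use a in simp_all)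
  moreover have "counit H (\<pi> a) = counit A a" if a: "a \<in> carrier A" for a
  proof -
    have "counit H (\<pi> a) = counit B (f a)"
      using a form_p[OF H.counit_form] by (simp add: \<pi>_def bosonization_def tsum_ssum)
    with a show ?thesis by (simp add: f_hom)
  qed
  ultimately show ?thesis
    unfolding bialgebra_hom_def algebra_hom_def using pi_linear by simp
qed

lemma sigma_hom: "algebra_hom H A \<sigma>"
proof -
  have "\<sigma> (h \<cdot>\<^bsub>H\<^esub> k) = \<sigma> h \<cdot> \<sigma> k" if hk: "h \<in> carrier H" "k \<in> carrier H" for h k
  proof (rule f_inj)
    have "(\<one>\<^bsub>R\<^esub> \<otimes>\<^bsub>R,H\<^esub> h) \<cdot>\<^bsub>B\<^esub> (\<one>\<^bsub>R\<^esub> \<otimes>\<^bsub>R,H\<^esub> k) = \<one>\<^bsub>R\<^esub> \<otimes>\<^bsub>R,H\<^esub> (h \<cdot>\<^bsub>H\<^esub> k)" (is "?l = ?r")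
    proof (rule form_eqI[OF vspace_tensor])
      fix \<phi> assume \<phi>: "form (R \<Otimes> H) \<phi>"
      note [simp] = form_rules[OF \<phi>] linear_scale[OF \<phi>, unfolded scale_tensor_space]
      show "\<phi> ?l = \<phi> ?r"
        using hk by (simp add: B_mult)
    qed (use hk in \<open>simp_all add: B_mult\<close>)
    then show "f (\<sigma> (h \<cdot>\<^bsub>H\<^esub> k)) = f (\<sigma> h \<cdot> \<sigma> k)"
      using hk by (simp add: f_hom) (simp add: \<sigma>_def)
  qed (use hk in simp_all)
  moreover have "\<sigma> \<one>\<^bsub>H\<^esub> = \<one>"
    by (rule f_inj) (simp_all add: f_hom, simp add: \<sigma>_def)
  ultimately show ?thesis
    unfolding algebra_hom_def using sigma_linear by simp
qed

lemma sigma_coact: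
  assumes h: "h \<in> carrier H"
  shows "csum A (\<sigma> h) (\<lambda>x y. \<pi> x \<otimes>\<^bsub>H,A\<^esub> y) = csum H h (\<lambda>x y. x \<otimes>\<^bsub>H,A\<^esub> \<sigma> y)"
    and "csum A (\<sigma> h) (\<lambda>x y. x \<otimes>\<^bsub>A,H\<^esub> \<pi> y) = csum H h (\<lambda>x y. \<sigma> x \<otimes>\<^bsub>A,H\<^esub> y)"
proof -
  show "csum A (\<sigma> h) (\<lambda>x y. \<pi> x \<otimes>\<^bsub>H,A\<^esub> y) = csum H h (\<lambda>x y. x \<otimes>\<^bsub>H,A\<^esub> \<sigma> y)" (is "?l = ?r")
  proof (rule form_eqI[OF vspace_tensor])
    fix \<phi> assume \<phi>: "form (H \<Otimes> A) \<phi>"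
    note [simp] = form_rules[OF \<phi>]
    have "\<phi> ?l
      = ssum (R \<Otimes> H) (R \<Otimes> H) (comult B (f (\<sigma> h))) (\<lambda>u v. \<phi> (p u \<otimes>\<^bsub>H,A\<^esub> g v))"
      using h by (simp add: f_hom) (simp add: \<pi>_def)
    also have "\<dots> = ssum R H (f (\<sigma> h)) (\<lambda>r h. csum H h (\<lambda>k l. LR r (\<lambda>a s. \<phi> ((a \<cdot>\<^bsub>H\<^esub> k) \<otimes>\<^bsub>H,A\<^esub> g (s \<otimes>\<^bsub>R,H\<^esub> l)))))"
      by (rule ssum_B_comult) (use h in simp_all)
    \<comment> \<open>\<sigma>(h) corresponds to 1 # h, and the unit of \<open>R\<close> has trivial
      coaction.\<close>
    also have "\<dots> = \<phi> ?r"
      using h by (simp add: \<sigma>_def)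
    finally show "\<phi> ?l = \<phi> ?r" .
  qed (use h in simp_all)
  show "csum A (\<sigma> h) (\<lambda>x y. x \<otimes>\<^bsub>A,H\<^esub> \<pi> y) = csum H h (\<lambda>x y. \<sigma> x \<otimes>\<^bsub>A,H\<^esub> y)" (is "?l = ?r")
  proof (rule form_eqI[OF vspace_tensor])
    fix \<phi> assume \<phi>: "form (A \<Otimes> H) \<phi>"
    note [simp] = form_rules[OF \<phi>]
    have "\<phi> ?l
      = ssum (R \<Otimes> H) (R \<Otimes> H) (comult B (f (\<sigma> h))) (\<lambda>u v. \<phi> (g u \<otimes>\<^bsub>A,H\<^esub> p v))"
      using h by (simp add: f_hom) (simp add: \<pi>_def)
    also have "\<dots> = ssum R H (f (\<sigma> h)) (\<lambda>r h. csum H h (\<lambda>k l. \<phi> (g (r \<otimes>\<^bsub>R,H\<^esub> k) \<otimes>\<^bsub>A,H\<^esub> l)))"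
      by (rule ssum_B_comult) (use h in simp_all)
    also have "\<dots> = \<phi> ?r"
      using h by (simp add: \<sigma>_def)
    finally show "\<phi> ?l = \<phi> ?r" .
  qed (use h in simp_all)
qed

lemma bosonized_splitting: "bicolinear_splitting H A \<pi> \<sigma>"
proof -
  have "bicomodule_hom H (bicomod_via H H id) (bicomod_via H A \<pi>) \<sigma>"
  proof -
    have [simp]: "carrier (bicomod_via H A \<pi>) = carrier A" "scale (bicomod_via H A \<pi>) = scale A"
      "carrier (bicomod_via H H id) = carrier H" "scale (bicomod_via H H id) = scale H"
      by (simp_all add: bicomod_via_def)
    interpret A': same_space A "bicomod_via H A \<pi>" by standard simp_all
    interpret H': same_space H "bicomod_via H H id" by standard simp_all
    show ?thesis
      unfolding bicomodule_hom_def
      using sigma_linear by simp (simp add: bicomod_via_def sigma_coact tsum_ssum)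
  qed
  then show ?thesis
    using pi_hom sigma_hom pi_sigma by (simp add: bicolinear_splitting_def)
qed

end

section \<open>The equivalences\<close>

lemma bosonization_splitting:
  fixes A :: "('k::field, 'a::ab_group_add) bialgebra" and H :: "('k, 'h::ab_group_add) hopf"
    and R :: "('k, 'h, 'r::ab_group_add) yd"
  assumes "is_bialgebra A" and "is_hopf H" and "yd_quadruple H R e d w" and "A \<simeq> bosonization H R e d w"
  shows "\<exists>\<pi> \<sigma>. bicolinear_splitting H A \<pi> \<sigma>"
proof -
  obtain f where "bialgebra_hom A (bosonization H R e d w) f"
    "bij_betw f (carrier A) (carrier (bosonization H R e d w))"
    using assms(4) by (auto simp: bialgebra_iso_def)
  with assms interpret bosonized A H R e d w f
    by unfold_locales
  show ?thesis using bosonized_splitting by blast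
qed

lemma splitting_compatible:
  fixes A :: "('k::field, 'a::ab_group_add) bialgebra" and H :: "('k, 'h::ab_group_add) hopf"
  assumes "is_bialgebra A" and "is_hopf H" and "bicolinear_splitting H A \<pi> \<sigma>"
  shows "compatible_structure H A (hopf_bimod_via H A \<pi> \<sigma>)"
proof -
  from assms interpret splitting A H \<pi> \<sigma> by unfold_locales
  show ?thesis by (rule V_compatible)
qed

lemma compatible_splitting_bimodule:
  fixes A :: "('k::field, 'a::ab_group_add) bialgebra" and H :: "('k, 'h::ab_group_add) hopf"
  assumes "is_bialgebra A" and "is_hopf H" and "compatible_structure H A M"
  shows "\<exists>\<pi> \<sigma>. splitting_bimodule A H \<pi> \<sigma> M"
proof -
  from assms interpret compatible A H M by unfold_locales
  show ?thesis using splitting by blast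
qed

text \<open>An existential quantifier cannot range over types. Condition (b) is therefore stated
  with \<open>R\<close> on the type of \<open>A\<close>, where the diagram lives, and a separate
  conjunct derives (a) from a quadruple on an arbitrary type. The last two conjuncts identify
  \<open>R\<close> with the diagram, both for a structure as in (a) and for the one built from a
  splitting.\<close>

theorem theorem4p44:
  fixes A :: "('k::field, 'a::ab_group_add) bialgebra"
    and H :: "('k, 'h::ab_group_add) hopf"
  assumes "is_bialgebra A" and "is_hopf H"
  shows
    "((\<exists>M. compatible_structure H A M) \<longleftrightarrow>
        (\<exists>(R :: ('k, 'h, 'a) yd) \<epsilon> \<delta> \<omega>.
           yd_quadruple H R \<epsilon> \<delta> \<omega> \<and> A \<simeq> bosonization H R \<epsilon> \<delta> \<omega>)) \<and>
     (\<forall>(R :: ('k, 'h, 'r::ab_group_add) yd) \<epsilon> \<delta> \<omega>.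
        yd_quadruple H R \<epsilon> \<delta> \<omega> \<and> A \<simeq> bosonization H R \<epsilon> \<delta> \<omega>
          \<longrightarrow> (\<exists>M. compatible_structure H A M)) \<and>
     ((\<exists>M. compatible_structure H A M) \<longleftrightarrow> (\<exists>\<pi> \<sigma>. bicolinear_splitting H A \<pi> \<sigma>)) \<and>
     (\<forall>M. compatible_structure H A M
        \<longrightarrow> (\<exists>\<epsilon> \<delta> \<omega>. yd_quadruple H (diagram H A M) \<epsilon> \<delta> \<omega> \<and>
               A \<simeq> bosonization H (diagram H A M) \<epsilon> \<delta> \<omega>)) \<and>
     (\<forall>\<pi> \<sigma>. bicolinear_splitting H A \<pi> \<sigma>
        \<longrightarrow> (\<exists>\<epsilon> \<delta> \<omega>. yd_quadruple H (diagram H A (hopf_bimod_via H A \<pi> \<sigma>)) \<epsilon> \<delta> \<omega> \<and>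
               A \<simeq> bosonization H (diagram H A (hopf_bimod_via H A \<pi> \<sigma>)) \<epsilon> \<delta> \<omega>))"
proof -
  note compatible = splitting_compatible[OF assms]
  have diagram: "\<exists>\<epsilon> \<delta> \<omega>. yd_quadruple H (diagram H A M) \<epsilon> \<delta> \<omega> \<and> A \<simeq> bosonization H (diagram H A M) \<epsilon> \<delta> \<omega>"
    if M: "compatible_structure H A M" for M
  proof -
    obtain \<pi> \<sigma> where "splitting_bimodule A H \<pi> \<sigma> M"
      using compatible_splitting_bimodule[OF assms M] by blast
    then interpret splitting_bimodule A H \<pi> \<sigma> M .
    show ?thesis using quadruple bosonization_iso by blast
  qed
  have split: "\<exists>\<pi> \<sigma>. bicolinear_splitting H A \<pi> \<sigma>" if M: "compatible_structure H A M" for M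
  proof -
    obtain \<pi> \<sigma> where "splitting_bimodule A H \<pi> \<sigma> M"
      using compatible_splitting_bimodule[OF assms M] by blast
    then interpret splitting_bimodule A H \<pi> \<sigma> M .
    show ?thesis using splitting by blast
  qed
  show ?thesis
  proof (intro conjI iffI allI impI)
    show "\<exists>(R :: ('k, 'h, 'a) yd) \<epsilon> \<delta> \<omega>. yd_quadruple H R \<epsilon> \<delta> \<omega> \<and> A \<simeq> bosonization H R \<epsilon> \<delta> \<omega>"
      if "\<exists>M. compatible_structure H A M"
      using that diagram by blast
    show "\<exists>M. compatible_structure H A M"
      if "\<exists>(R :: ('k, 'h, 'a) yd) \<epsilon> \<delta> \<omega>. yd_quadruple H R \<epsilon> \<delta> \<omega> \<and> A \<simeq> bosonization H R \<epsilon> \<delta> \<omega>"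
    proof -
      from that obtain R :: "('k, 'h, 'a) yd" and \<epsilon> \<delta> \<omega>
        where "yd_quadruple H R \<epsilon> \<delta> \<omega>" "A \<simeq> bosonization H R \<epsilon> \<delta> \<omega>" by (elim exE conjE)
      from bosonization_splitting[OF assms this] show ?thesis using compatible by (elim exE) (rule exI)
    qed
    show "\<exists>M. compatible_structure H A M"
      if "yd_quadruple H R \<epsilon> \<delta> \<omega> \<and> A \<simeq> bosonization H R \<epsilon> \<delta> \<omega>" for R :: "('k, 'h, 'r) yd" and \<epsilon> \<delta> \<omega>
      using bosonization_splitting[OF assms that[THEN conjunct1] that[THEN conjunct2]] compatible
      by (elim exE) (rule exI)
    show "\<exists>\<pi> \<sigma>. bicolinear_splitting H A \<pi> \<sigma>" if "\<exists>M. compatible_structure H A M"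
      using that split by (elim exE)
    show "\<exists>M. compatible_structure H A M" if "\<exists>\<pi> \<sigma>. bicolinear_splitting H A \<pi> \<sigma>"
      using that compatible by (elim exE) (rule exI)
    show "\<exists>\<epsilon> \<delta> \<omega>. yd_quadruple H (diagram H A M) \<epsilon> \<delta> \<omega> \<and> A \<simeq> bosonization H (diagram H A M) \<epsilon> \<delta> \<omega>"
      if "compatible_structure H A M" for M
      by (rule diagram[OF that])
    show "\<exists>\<epsilon> \<delta> \<omega>. yd_quadruple H (diagram H A (hopf_bimod_via H A \<pi> \<sigma>)) \<epsilon> \<delta> \<omega> \<and>
        A \<simeq> bosonization H (diagram H A (hopf_bimod_via H A \<pi> \<sigma>)) \<epsilon> \<delta> \<omega>"
      if "bicolinear_splitting H A \<pi> \<sigma>" for \<pi> \<sigma>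
      by (rule diagram[OF compatible[OF that]])
  qed
qed

end
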